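(* Let $q\in\mathbb{C}$, $|q|=1$, and let $(T_1,T_2)$ be a pair of $q$-commuting contractions on a Hilbert space $\mathcal{H}$, with $T=T_1T_2$. (Forward direction.) Let $(\mathcal{F};\Lambda,P,U)$ be a special Andô tuple for $(T_1,T_2)$. Define operators on $\mathcal{H}\oplus H^2(\mathcal{F})$ by $$V^S_1=\begin{bmatrix} T_1 & 0\\ \mathbf{ev}_0^*PU\Lambda D_T & q\,M_{(P^\perp+zP)U}R_q\end{bmatrix},\qquad V^S_2=\begin{bmatrix} T_2&0\\ \overline{q}\,\mathbf{ev}_0^*U^*P^\perp\Lambda D_T & \overline{q}\,R_{\overline{q}}M_{U^*(P+zP^\perp)}\end{bmatrix}.$$ Then $(V_1^S,V_2^S)$ is a $q$-commuting isometric dilation of $(T_1,T_2)$. (Converse direction.) If $(V_1,V_2)$ is a minimal $q$-commuting isometric lift of $(T_1,T_2)$ acting on a Hilbert space $\mathcal{K}$ containing $\mathcal{H}$ as a subspace, then there is an Andô tuple $(\mathcal{F};\Lambda,P,U)$ of $(T_1,T_2)$ such that $(V_1,V_2)$ is unitarily equivalent to the pair on $\mathcal{H}\oplus H^2(\mathcal{F})$ given by the two displayed block matrices formed with this tuple. Moreover, the operators $P,U,\Lambda$ satisfy $$T_1^*T_1+D_T\Lambda^*U^*PU\Lambda D_T=I_{\mathcal{H}},\qquad T_2^*T_2+D_T\Lambda^*P^\perp\Lambda D_T=I_{\mathcal{H}},$$ $$PU\Lambda D_TT_2+P^\perp\Lambda D_T=\Lambda D_T=U^*(P^\perp\Lambda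 D_TT_1+PU\Lambda D_T).$$
   Context: A pair $(A_1,A_2)$ of bounded operators is $q$-commuting if $A_1A_2=qA_2A_1$. For a contraction $T$, $D_T=(I-T^*T)^{1/2}$ and $\mathcal{D}_T=\overline{\operatorname{Ran}D_T}$. Special Andô tuple for a $q$-commuting contractive pair $(T_1,T_2)$, $T=T_1T_2$: a tuple $(\mathcal{F};\Lambda,P,U)$ where $\mathcal{F}=\mathcal{D}_{T_1}\oplus\mathcal{D}_{T_2}\oplus\mathcal{E}$, with $\mathcal{E}=\{0\}$ or $\mathcal{E}$ a copy of $\mathcal{H}$ (added if required for the extension below to exist); $\Lambda:\mathcal{D}_T\to\mathcal{F}$ is the isometry $\Lambda D_Th=D_{T_1}T_2h\oplus D_{T_2}h\oplus 0$; $U$ is a unitary on $\mathcal{F}$ extending the isometry $D_{T_1}T_2h\oplus D_{T_2}h\oplus 0\mapsto D_{T_1}h\oplus D_{T_2}T_1h\oplus 0$ ($h\in\mathcal{H}$); $P$ is the orthogonal projection of $\mathcal{F}$ onto $\mathcal{D}_{T_1}\oplus\{0\}\oplus\{0\}$. Andô tuple of $(T_1,T_2)$ (general): a tuple $(\mathcal{F};\Lambda,P,U)$ consisting of a Hilbert space $\mathcal{F}$, an isometry $\Lambda:\mathcal{D}_T\to\mathcal{F}$, an orthogonal projection $P$ and a unitary $U$ on $\mathcal{F}$. $P^\perp=I-P$. $H^2(\mathcal{F})$ is the $\mathcal{F}$-valued Hardy space on the unit disk $\mathbb{D}$; $\mathbf{ev}_0:H^2(\mathcal{F})\to\mathcal{F}$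 is $f\mapsto f(0)$, so $\mathbf{ev}_0^*$ sends a vector to the corresponding constant function; $M_\varphi$ is multiplication by $\varphi$; $(R_qf)(z)=f(qz)$. A pair $(V_1,V_2)$ of isometries on $\mathcal{K}\supseteq\mathcal{H}$ is an isometric lift (the word dilation is used here for the same notion) of $(T_1,T_2)$ if $V_j^*|_{\mathcal{H}}=T_j^*$ for $j=1,2$. It is minimal if $\mathcal{K}=\bigvee_{n_1,n_2\ge0}V_1^{n_1}V_2^{n_2}\mathcal{H}$. Pairs are unitarily equivalent if a single unitary intertwines both components. *)

theory Defs
  imports "HOL-Analysis.Analysis"
begin

section \<open>Complex Hilbert spaces\<close>

text \<open>
  The library only has real inner product spaces. A complex inner product space is a real one
  (with the real inner product \<open>Re \<langle>x, y\<rangle>\<close>, hence the same norm and topology) that carries a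
  compatible complex scalar multiplication and sesquilinear form. The form is linear in its
  first argument.
\<close>

class complex_inner = real_inner +
  fixes scaleC :: "complex \<Rightarrow> 'a \<Rightarrow> 'a"  (infixr \<open>*\<^sub>C\<close> 75)
    and cinner :: "'a \<Rightarrow> 'a \<Rightarrow> complex"
  assumes scaleC_add_right: "a *\<^sub>C (x + y) = a *\<^sub>C x + a *\<^sub>C y"
    and scaleC_add_left: "(a + b) *\<^sub>C x = a *\<^sub>C x + b *\<^sub>C x"
    and scaleC_scaleC: "a *\<^sub>C b *\<^sub>C x = (a * b) *\<^sub>C x"
    and scaleR_scaleC: "r *\<^sub>R x = complex_of_real r *\<^sub>C x"
    and cinner_commute: "cinner x y = cnj (cinner y x)"
    and cinner_add_left: "cinner (x + y) z = cinner x z + cinner y z"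
    and cinner_scaleC_left: "cinner (a *\<^sub>C x) y = a * cinner x y"
    and inner_eq_Re_cinner: "inner x y = Re (cinner x y)"

class complex_hilbert = complex_inner + banach

lemma scaleC_one [simp]: "1 *\<^sub>C x = (x::'a::complex_inner)"
  using scaleR_scaleC[of 1 x] by simp

global_interpretation complex_vector: vector_space "scaleC :: complex \<Rightarrow> 'a \<Rightarrow> 'a::complex_inner"
  by standard (auto simp: scaleC_add_right scaleC_add_left scaleC_scaleC)

lemma cinner_add_right: "cinner x (y + z) = cinner x y + cinner (x::'a::complex_inner) z"
  by (metis cinner_add_left cinner_commute complex_cnj_add)

lemma cinner_scaleC_right: "cinner x (a *\<^sub>C y) = cnj a * cinner (x::'a::complex_inner) y"
  by (metis cinner_scaleC_left cinner_commute complex_cnj_mult)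

lemma cinner_zero_left [simp]: "cinner 0 (x::'a::complex_inner) = 0"
  using cinner_add_left[of 0 0 x] by simp

lemma Im_cinner: "Im (cinner x y) = inner x (\<i> *\<^sub>C (y::'a::complex_inner))"
  by (simp add: inner_eq_Re_cinner cinner_scaleC_right)

lemma cinner_self: "cinner x x = complex_of_real ((norm (x::'a::complex_inner))\<^sup>2)"
proof (rule complex_eqI)
  show "Re (cinner x x) = Re (complex_of_real ((norm x)\<^sup>2))"
    by (simp add: inner_eq_Re_cinner[symmetric] dot_square_norm)
  have "Im (cinner x x) = Im (cnj (cinner x x))"
    using cinner_commute[of x x] by simp
  then show "Im (cinner x x) = Im (complex_of_real ((norm x)\<^sup>2))"
    by simp
qed

lemma norm_scaleC: "norm (a *\<^sub>C x) = norm a * norm (x::'a::complex_inner)"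
proof -
  have "complex_of_real ((norm (a *\<^sub>C x))\<^sup>2) = a * cnj a * complex_of_real ((norm x)\<^sup>2)"
    by (simp only: cinner_self[symmetric] cinner_scaleC_left cinner_scaleC_right mult_ac)
  also have "\<dots> = complex_of_real ((norm a * norm x)\<^sup>2)"
    by (simp only: complex_norm_square[of a] power_mult_distrib of_real_mult)
  finally have "(norm (a *\<^sub>C x))\<^sup>2 = (norm a * norm x)\<^sup>2"
    using of_real_eq_iff by blast
  then show ?thesis by simp
qed

lemma norm_cinner_le: "norm (cinner x y) \<le> norm x * norm (y::'a::complex_inner)"
proof (cases "cinner x y = 0")
  case False
  define u where "u = cnj (sgn (cinner x y))"
  have u: "norm u = 1" using False by (simp add: u_def norm_sgn)
  have "cnj (cinner x y) * cinner x y = complex_of_real (norm (cinner x y) * norm (cinner x y))"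
    by (metis complex_norm_square mult.commute power2_eq_square of_real_mult)
  then have "u * cinner x y = complex_of_real (norm (cinner x y))"
    using False by (simp add: u_def sgn_eq)
  then have "norm (cinner x y) = inner (u *\<^sub>C x) y"
    by (simp only: inner_eq_Re_cinner cinner_scaleC_left Re_complex_of_real)
  also have "\<dots> \<le> norm (u *\<^sub>C x) * norm y" by (rule norm_cauchy_schwarz)
  finally show ?thesis by (simp add: norm_scaleC u)
qed simp

lemma bounded_linear_scaleC: "bounded_linear (\<lambda>x::'a::complex_inner. a *\<^sub>C x)"
  by (rule bounded_linear_intro[where K = "norm a"])
     (auto simp: scaleC_add_right scaleR_scaleC scaleC_scaleC norm_scaleC mult.commute)

lemma bounded_linear_cinner_left: "bounded_linear (\<lambda>x::'a::complex_inner. cinner x y)"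
  by (rule bounded_linear_intro[where K = "norm y"])
     (auto simp: cinner_add_left cinner_scaleC_left scaleR_scaleC scaleR_conv_of_real norm_cinner_le)

instantiation complex :: complex_hilbert
begin
definition "a *\<^sub>C x = a * (x::complex)"
definition "cinner x y = x * cnj (y::complex)"
instance
  by standard (auto simp: scaleC_complex_def cinner_complex_def algebra_simps
      scaleR_conv_of_real inner_complex_def)
end

instantiation prod :: (complex_inner, complex_inner) complex_inner
begin
definition "a *\<^sub>C x = (a *\<^sub>C fst x, a *\<^sub>C snd x)"
definition "cinner x y = cinner (fst x) (fst y) + cinner (snd x) (snd y)"
instance
  by standard
     (auto simp: scaleC_prod_def cinner_prod_def prod_eq_iff scaleC_add_right scaleC_add_left
       scaleC_scaleC scaleR_scaleC cinner_add_left cinner_scaleC_left algebra_simps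
       inner_eq_Re_cinner inner_prod_def cinner_commute[symmetric])
end

instance prod :: (complex_hilbert, complex_hilbert) complex_hilbert ..


section \<open>The Hardy space of vector-valued functions on the unit disk\<close>

definition sq_summable :: "(nat \<Rightarrow> 'a::complex_hilbert) \<Rightarrow> bool" where
  "sq_summable a \<longleftrightarrow> summable (\<lambda>n. (norm (a n))\<^sup>2)"

definition hardy_series :: "(nat \<Rightarrow> 'a::complex_hilbert) \<Rightarrow> complex \<Rightarrow> 'a" where
  "hardy_series a z = (if norm z < 1 then (\<Sum>n. z ^ n *\<^sub>C a n) else 0)"

text \<open>
  Elements of the type are the functions on the open unit disk whose Taylor coefficients at \<open>0\<close>
  are square summable; as members of a function type they are extended by \<open>0\<close> outside the disk.
\<close>

typedef (overloaded) 'a::complex_hilbert hardy = "hardy_series ` {a :: nat \<Rightarrow> 'a. sq_summable a}"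
  morphisms hardy_eval Abs_hardy
  by (auto simp: sq_summable_def intro!: exI[of _ "\<lambda>_. 0"])

definition hcoeff :: "'a::complex_hilbert hardy \<Rightarrow> nat \<Rightarrow> 'a" where
  "hcoeff f = (THE a. sq_summable a \<and> hardy_eval f = hardy_series a)"

lemma sq_summable_zero: "sq_summable (\<lambda>_. 0)"
  by (simp add: sq_summable_def)

lemma sq_summable_scaleC: "sq_summable a \<Longrightarrow> sq_summable (\<lambda>n. c *\<^sub>C a n)"
  by (simp add: sq_summable_def norm_scaleC power_mult_distrib summable_mult)

lemma sq_summable_add:
  assumes "sq_summable a" "sq_summable b"
  shows "sq_summable (\<lambda>n. a n + b n)"
  unfolding sq_summable_def
proof (rule summable_comparison_test'[where N = 0])
  show "summable (\<lambda>n. 2 * (norm (a n))\<^sup>2 + 2 * (norm (b n))\<^sup>2)"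
    using assms by (intro summable_add summable_mult) (auto simp: sq_summable_def)
  fix n
  have "(norm (a n + b n))\<^sup>2 \<le> (norm (a n) + norm (b n))\<^sup>2"
    by (simp add: norm_triangle_ineq power_mono)
  also have "\<dots> \<le> 2 * (norm (a n))\<^sup>2 + 2 * (norm (b n))\<^sup>2"
    using zero_le_power2[of "norm (a n) - norm (b n)"] by (simp add: power2_eq_square algebra_simps)
  finally show "norm ((norm (a n + b n))\<^sup>2) \<le> 2 * (norm (a n))\<^sup>2 + 2 * (norm (b n))\<^sup>2" by simp
qed

lemma mult_le_sum_squares:
  assumes "0 \<le> x" "0 \<le> y"
  shows "x * y \<le> x\<^sup>2 + (y::real)\<^sup>2"
  using sum_squares_bound[of x y] mult_nonneg_nonneg[OF assms] by linarith

lemma summable_cinner: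
  assumes "sq_summable a" "sq_summable b"
  shows "summable (\<lambda>n. cinner (a n) (b n))"
proof (rule summable_comparison_test'[where N = 0])
  show "summable (\<lambda>n. (norm (a n))\<^sup>2 + (norm (b n))\<^sup>2)"
    using assms by (intro summable_add) (auto simp: sq_summable_def)
  fix n
  have "norm (a n) * norm (b n) \<le> (norm (a n))\<^sup>2 + (norm (b n))\<^sup>2"
    by (rule mult_le_sum_squares) simp_all
  then show "norm (cinner (a n) (b n)) \<le> (norm (a n))\<^sup>2 + (norm (b n))\<^sup>2"
    using norm_cinner_le[of "a n" "b n"] by linarith
qed

lemma summable_hardy_series:
  assumes "sq_summable a" "norm z < 1"
  shows "summable (\<lambda>n. z ^ n *\<^sub>C a n)"
proof -
  have "summable (\<lambda>n. norm (z ^ n *\<^sub>C a n))"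
  proof (rule summable_comparison_test'[where N = 0])
    have "(norm z)\<^sup>2 < 1" using assms(2) by (simp add: power_less_one_iff)
    then have "summable (\<lambda>n. ((norm z)\<^sup>2) ^ n)" by (intro summable_geometric) auto
    then show "summable (\<lambda>n. ((norm z)\<^sup>2) ^ n + (norm (a n))\<^sup>2)"
      using assms(1) by (intro summable_add) (auto simp: sq_summable_def)
    fix n
    have "norm z ^ n * norm (a n) \<le> (norm z ^ n)\<^sup>2 + (norm (a n))\<^sup>2"
      by (rule mult_le_sum_squares) simp_all
    then show "norm (norm (z ^ n *\<^sub>C a n)) \<le> ((norm z)\<^sup>2) ^ n + (norm (a n))\<^sup>2"
      by (simp add: norm_scaleC norm_power power_mult[symmetric] mult.commute)
  qed
  then show ?thesis by (rule summable_norm_cancel)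
qed

lemma hardy_series_add:
  assumes "sq_summable a" "sq_summable b"
  shows "hardy_series (\<lambda>n. a n + b n) = (\<lambda>z. hardy_series a z + hardy_series b z)"
  using assms
  by (auto simp: hardy_series_def fun_eq_iff scaleC_add_right suminf_add summable_hardy_series)

lemma hardy_series_scaleC:
  assumes "sq_summable a"
  shows "hardy_series (\<lambda>n. c *\<^sub>C a n) = (\<lambda>z. c *\<^sub>C hardy_series a z)"
proof
  fix z
  have "(\<Sum>n. z ^ n *\<^sub>C c *\<^sub>C a n) = c *\<^sub>C (\<Sum>n. z ^ n *\<^sub>C a n)" if "norm z < 1"
    using bounded_linear.suminf[OF bounded_linear_scaleC summable_hardy_series[OF assms that], of c]
    by (simp add: scaleC_scaleC mult.commute)
  then show "hardy_series (\<lambda>n. c *\<^sub>C a n) z = c *\<^sub>C hardy_series a z"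
    by (auto simp: hardy_series_def)
qed

lemma hardy_series_inj:
  assumes a: "sq_summable a" and b: "sq_summable b" and eq: "hardy_series a = hardy_series b"
  shows "a = b"
proof
  fix n
  define d where "d = a n - b n"
  define F where "F c = Abs_fps (\<lambda>k. cinner (c k) d)" for c :: "nat \<Rightarrow> 'a"
  have sums: "(\<lambda>k. fps_nth (F c) k * z ^ k) sums cinner (hardy_series c z) d"
    if c: "sq_summable c" and z: "norm z < 1" for c and z :: complex
    using bounded_linear.sums[OF bounded_linear_cinner_left
        summable_sums[OF summable_hardy_series[OF c z]], of d] z
    by (simp add: F_def hardy_series_def cinner_scaleC_left mult.commute)
  have rad: "fps_conv_radius (F c) > 0" if c: "sq_summable c" for c
  proof -
    have "summable (\<lambda>k. fps_nth (F c) k * (1/2) ^ k)"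
      using sums[OF c, of "1/2"] by (auto simp: sums_iff)
    then have "ereal (norm (1/2::complex)) \<le> fps_conv_radius (F c)"
      unfolding fps_conv_radius_def by (rule conv_radius_geI)
    moreover have "ereal (norm (1/2::complex)) > 0" by simp
    ultimately show ?thesis by (rule less_le_trans[rotated])
  qed
  have "eventually (\<lambda>z::complex. z \<in> ball 0 1) (nhds 0)"
    by (rule eventually_nhds_in_open) auto
  then have "eventually (\<lambda>z. eval_fps (F a) z = eval_fps (F b) z) (nhds 0)"
  proof eventually_elim
    case (elim z)
    then have "norm z < 1" by simp
    then show ?case
      using sums[OF a, of z] sums[OF b, of z] eq by (simp add: eval_fps_def sums_iff)
  qed
  then have "F a = F b" by (intro eval_fps_eqD rad a b)
  then have "fps_nth (F a) n = fps_nth (F b) n" by simp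
  then have "cinner (a n) d = cinner (b n) d" by (simp add: F_def)
  then have "inner d d = 0"
    by (simp add: d_def inner_diff_left) (simp add: inner_eq_Re_cinner)
  then show "a n = b n" by (simp add: d_def)
qed

lemma hcoeff_unique:
  assumes "sq_summable a" "hardy_eval f = hardy_series a"
  shows "hcoeff f = a"
  unfolding hcoeff_def using assms by (intro the_equality) (auto intro: hardy_series_inj)

lemma
  shows sq_summable_hcoeff: "sq_summable (hcoeff f)"
    and hardy_eval_hcoeff: "hardy_eval f = hardy_series (hcoeff f)"
proof -
  obtain a where "sq_summable a" "hardy_eval f = hardy_series a"
    using hardy_eval[of f] by auto
  with hcoeff_unique[OF this]
  show "sq_summable (hcoeff f)" "hardy_eval f = hardy_series (hcoeff f)" by simp_all
qed

lemma hardy_eqI: "hcoeff f = hcoeff g \<Longrightarrow> f = g"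
  by (metis hardy_eval_hcoeff hardy_eval_inject)

lemma hardy_eval_Abs_hardy_series:
  "sq_summable a \<Longrightarrow> hardy_eval (Abs_hardy (hardy_series a)) = hardy_series a"
  by (auto intro!: Abs_hardy_inverse)

lemma hcoeff_Abs_hardy: "sq_summable a \<Longrightarrow> hcoeff (Abs_hardy (hardy_series a)) = a"
  by (intro hcoeff_unique) (auto simp: hardy_eval_Abs_hardy_series)

instantiation hardy :: (complex_hilbert) complex_inner
begin

definition "0 = Abs_hardy (\<lambda>z. 0)"
definition "f + g = Abs_hardy (\<lambda>z. hardy_eval f z + hardy_eval g z)"
definition "c *\<^sub>C f = Abs_hardy (\<lambda>z. c *\<^sub>C hardy_eval f z)"
definition "cinner f g = (\<Sum>n. cinner (hcoeff f n) (hcoeff g n))"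
definition "- (f::'a hardy) = (- 1) *\<^sub>C f"
definition "(f::'a hardy) - g = f + (- g)"
definition "r *\<^sub>R (f::'a hardy) = complex_of_real r *\<^sub>C f"
definition "inner f (g::'a hardy) = Re (cinner f g)"
definition "norm (f::'a hardy) = sqrt (inner f f)"
definition "sgn (f::'a hardy) = inverse (norm f) *\<^sub>R f"
definition "dist (f::'a hardy) g = norm (f - g)"
definition "(uniformity :: ('a hardy \<times> 'a hardy) filter) =
  (INF e\<in>{0 <..}. principal {(x, y). dist x y < e})"
definition "open (S::'a hardy set) \<longleftrightarrow>
  (\<forall>x\<in>S. \<forall>\<^sub>F (x', y) in uniformity. x' = x \<longrightarrow> y \<in> S)"

lemma hcoeff_zero: "hcoeff (0::'a hardy) = (\<lambda>_. 0)"
proof -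
  have "(\<lambda>z. 0::'a) = hardy_series (\<lambda>_. 0)" by (auto simp: hardy_series_def)
  then show ?thesis unfolding zero_hardy_def by (simp add: hcoeff_Abs_hardy sq_summable_zero)
qed

lemma hcoeff_add: "hcoeff (f + g) = (\<lambda>n. hcoeff f n + hcoeff (g::'a hardy) n)"
proof -
  have "f + g = Abs_hardy (hardy_series (\<lambda>n. hcoeff f n + hcoeff g n))"
    unfolding plus_hardy_def
    by (simp add: hardy_series_add sq_summable_hcoeff hardy_eval_hcoeff)
  then show ?thesis by (simp add: hcoeff_Abs_hardy sq_summable_add sq_summable_hcoeff)
qed

lemma hcoeff_scaleC: "hcoeff (c *\<^sub>C f) = (\<lambda>n. c *\<^sub>C hcoeff (f::'a hardy) n)"
proof -
  have "c *\<^sub>C f = Abs_hardy (hardy_series (\<lambda>n. c *\<^sub>C hcoeff f n))"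
    unfolding scaleC_hardy_def
    by (simp add: hardy_series_scaleC sq_summable_hcoeff hardy_eval_hcoeff)
  then show ?thesis by (simp add: hcoeff_Abs_hardy sq_summable_scaleC sq_summable_hcoeff)
qed

lemma sums_inner_hardy: "(\<lambda>n. (norm (hcoeff (f::'a hardy) n))\<^sup>2) sums inner f f"
proof -
  have "(\<lambda>n. cinner (hcoeff f n) (hcoeff f n)) sums cinner f f"
    unfolding cinner_hardy_def by (intro summable_sums summable_cinner sq_summable_hcoeff)
  then have "(\<lambda>n. Re (cinner (hcoeff f n) (hcoeff f n))) sums Re (cinner f f)"
    by (rule sums_Re)
  then show ?thesis by (simp add: cinner_self inner_hardy_def del: of_real_power)
qed

instance
proof
  fix x y z :: "'a hardy" and a b :: complex and r s :: real
  show "x + y + z = x + (y + z)" "x + y = y + x" "0 + x = x"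
    by (rule hardy_eqI; simp add: hcoeff_add hcoeff_zero add_ac)+
  show "- x + x = 0"
    by (rule hardy_eqI) (simp add: uminus_hardy_def hcoeff_add hcoeff_scaleC hcoeff_zero)
  show "x - y = x + - y" by (rule minus_hardy_def)
  show "a *\<^sub>C (x + y) = a *\<^sub>C x + a *\<^sub>C y"
    by (rule hardy_eqI) (simp add: hcoeff_add hcoeff_scaleC scaleC_add_right)
  show "(a + b) *\<^sub>C x = a *\<^sub>C x + b *\<^sub>C x"
    by (rule hardy_eqI) (simp add: hcoeff_add hcoeff_scaleC scaleC_add_left)
  show "a *\<^sub>C b *\<^sub>C x = (a * b) *\<^sub>C x"
    by (rule hardy_eqI) (simp add: hcoeff_scaleC scaleC_scaleC)
  show "r *\<^sub>R x = complex_of_real r *\<^sub>C x" by (rule scaleR_hardy_def)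
  show "r *\<^sub>R (x + y) = r *\<^sub>R x + r *\<^sub>R y"
    by (rule hardy_eqI) (simp add: scaleR_hardy_def hcoeff_add hcoeff_scaleC scaleC_add_right)
  show "(r + s) *\<^sub>R x = r *\<^sub>R x + s *\<^sub>R x"
    by (rule hardy_eqI) (simp add: scaleR_hardy_def hcoeff_add hcoeff_scaleC scaleC_add_left)
  show "r *\<^sub>R s *\<^sub>R x = (r * s) *\<^sub>R x"
    by (rule hardy_eqI) (simp add: scaleR_hardy_def hcoeff_scaleC scaleC_scaleC)
  show "1 *\<^sub>R x = x"
    by (rule hardy_eqI) (simp add: scaleR_hardy_def hcoeff_scaleC)
  show "sgn x = inverse (norm x) *\<^sub>R x" by (rule sgn_hardy_def)
  show "dist x y = norm (x - y)" by (rule dist_hardy_def)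
  show "(uniformity :: ('a hardy \<times> 'a hardy) filter) =
      (INF e\<in>{0 <..}. principal {(x, y). dist x y < e})"
    by (rule uniformity_hardy_def)
  show "open S \<longleftrightarrow> (\<forall>x\<in>S. \<forall>\<^sub>F (x', y) in uniformity. x' = x \<longrightarrow> y \<in> S)"
    for S :: "'a hardy set" by (rule open_hardy_def)
  show comm: "cinner x y = cnj (cinner y x)" for x y :: "'a hardy"
  proof -
    have "(\<lambda>n. cinner (hcoeff y n) (hcoeff x n)) sums cinner y x"
      unfolding cinner_hardy_def by (intro summable_sums summable_cinner sq_summable_hcoeff)
    then have "(\<lambda>n. cnj (cinner (hcoeff y n) (hcoeff x n))) sums cnj (cinner y x)"
      by (simp add: sums_cnj)
    then show ?thesis
      by (simp add: cinner_commute[symmetric] cinner_hardy_def sums_iff)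
  qed
  show add: "cinner (x + y) z = cinner x z + cinner y z"
    by (simp add: cinner_hardy_def hcoeff_add cinner_add_left suminf_add summable_cinner
        sq_summable_hcoeff)
  show scale: "cinner (a *\<^sub>C x) y = a * cinner x y" for a
    by (simp add: cinner_hardy_def hcoeff_scaleC cinner_scaleC_left suminf_mult summable_cinner
        sq_summable_hcoeff)
  show "inner x y = Re (cinner x y)" by (rule inner_hardy_def)
  show "inner x y = inner y x"
    unfolding inner_hardy_def by (subst comm) simp
  show "inner (x + y) z = inner x z + inner y z"
    by (simp add: inner_hardy_def add)
  show "inner (r *\<^sub>R x) y = r * inner x y"
    by (simp add: inner_hardy_def scaleR_hardy_def scale)
  show "0 \<le> inner x x"
    by (rule sums_le[OF _ sums_zero sums_inner_hardy]) simp
  show "inner x x = 0 \<longleftrightarrow> x = 0"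
  proof
    assume "inner x x = 0"
    with sums_inner_hardy[of x] have "(\<lambda>n. (norm (hcoeff x n))\<^sup>2) sums 0" by simp
    then have "\<forall>n. (norm (hcoeff x n))\<^sup>2 = 0"
      by (subst suminf_eq_zero_iff[symmetric]) (auto simp: sums_iff)
    then show "x = 0" by (intro hardy_eqI) (simp add: hcoeff_zero fun_eq_iff)
  qed (simp add: inner_hardy_def cinner_hardy_def hcoeff_zero)
  show "norm x = sqrt (inner x x)" by (rule norm_hardy_def)
qed

end

lemma hardy_eval_add: "hardy_eval (f + g) z = hardy_eval f z + hardy_eval g z"
  by (simp add: hardy_eval_hcoeff hcoeff_add hardy_series_add sq_summable_hcoeff)

lemma hardy_eval_scaleC: "hardy_eval (c *\<^sub>C f) z = c *\<^sub>C hardy_eval f z"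
  by (simp add: hardy_eval_hcoeff hcoeff_scaleC hardy_series_scaleC sq_summable_hcoeff)

lemma hcoeff_diff: "hcoeff (f - g) n = hcoeff f n - hcoeff g n"
proof -
  have "hcoeff (f - g + g) n = hcoeff (f - g) n + hcoeff g n" by (simp only: hcoeff_add)
  then show ?thesis by simp
qed

lemma sums_norm_hardy: "(\<lambda>n. (norm (hcoeff f n))\<^sup>2) sums (norm f)\<^sup>2"
  using sums_inner_hardy[of f] by (simp add: dot_square_norm)

lemma sum_hcoeff_le:
  assumes "finite A"
  shows "(\<Sum>n\<in>A. (norm (hcoeff f n))\<^sup>2) \<le> (norm f)\<^sup>2"
proof -
  have "summable (\<lambda>n. (norm (hcoeff f n))\<^sup>2)" and eq: "(\<Sum>n. (norm (hcoeff f n))\<^sup>2) = (norm f)\<^sup>2"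
    using sums_norm_hardy[of f] by (auto simp: sums_iff)
  from sum_le_suminf[OF this(1) assms] show ?thesis by (simp add: eq)
qed

lemma norm_hcoeff_le: "norm (hcoeff f n) \<le> norm f"
proof (rule power2_le_imp_le)
  show "(norm (hcoeff f n))\<^sup>2 \<le> (norm f)\<^sup>2" using sum_hcoeff_le[of "{n}" f] by simp
qed simp

instance hardy :: (complex_hilbert) complex_hilbert
proof
  fix X :: "nat \<Rightarrow> 'a hardy"
  assume X: "Cauchy X"
  have "Cauchy (\<lambda>k. hcoeff (X k) n)" for n
  proof (rule metric_CauchyI)
    fix e :: real assume "e > 0"
    then obtain M where M: "\<And>k m. k \<ge> M \<Longrightarrow> m \<ge> M \<Longrightarrow> dist (X k) (X m) < e"
      using metric_CauchyD[OF X] by blast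
    have "dist (hcoeff (X k) n) (hcoeff (X m) n) < e" if "k \<ge> M" "m \<ge> M" for k m
      using norm_hcoeff_le[of "X k - X m" n] M[OF that] by (simp add: dist_norm hcoeff_diff)
    then show "\<exists>M. \<forall>k\<ge>M. \<forall>m\<ge>M. dist (hcoeff (X k) n) (hcoeff (X m) n) < e" by blast
  qed
  then obtain b where b: "\<And>n. (\<lambda>k. hcoeff (X k) n) \<longlonglongrightarrow> b n"
    by (meson Cauchy_convergent_iff convergent_LIMSEQ_iff)
  have tail: "sq_summable (\<lambda>n. hcoeff (X k) n - b n) \<and> (\<Sum>n. (norm (hcoeff (X k) n - b n))\<^sup>2) \<le> e\<^sup>2"
    if e: "e > 0" and M: "\<forall>k\<ge>M. \<forall>m\<ge>M. dist (X k) (X m) < e" and k: "k \<ge> M"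
    for e M k
  proof -
    have part: "(\<Sum>n<N. (norm (hcoeff (X k) n - b n))\<^sup>2) \<le> e\<^sup>2" for N
    proof (rule tendsto_upperbound)
      show "(\<lambda>m. \<Sum>n<N. (norm (hcoeff (X k) n - hcoeff (X m) n))\<^sup>2)
          \<longlonglongrightarrow> (\<Sum>n<N. (norm (hcoeff (X k) n - b n))\<^sup>2)"
        by (intro tendsto_intros b)
      show "\<forall>\<^sub>F m in sequentially. (\<Sum>n<N. (norm (hcoeff (X k) n - hcoeff (X m) n))\<^sup>2) \<le> e\<^sup>2"
        using eventually_ge_at_top[of M]
      proof eventually_elim
        case (elim m)
        have lt: "norm (X k - X m) < e"
          using M k elim unfolding dist_norm by blast
        have "(\<Sum>n<N. (norm (hcoeff (X k - X m) n))\<^sup>2) \<le> (norm (X k - X m))\<^sup>2"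
          by (rule sum_hcoeff_le) simp
        also have "\<dots> \<le> e\<^sup>2"
          using lt by (intro power_mono) auto
        finally show ?case by (simp add: hcoeff_diff)
      qed
    qed simp
    have sm: "summable (\<lambda>n. (norm (hcoeff (X k) n - b n))\<^sup>2)"
      by (rule summableI_nonneg_bounded[OF _ part]) simp
    then show ?thesis
      using suminf_le_const[OF sm part] by (simp add: sq_summable_def)
  qed
  obtain M1 where M1: "\<forall>k\<ge>M1. \<forall>m\<ge>M1. dist (X k) (X m) < 1"
    using metric_CauchyD[OF X zero_less_one] by blast
  have "sq_summable (\<lambda>n. hcoeff (X M1) n - b n)"
    using tail[OF zero_less_one M1 order_refl] by (rule conjunct1)
  from sq_summable_add[OF sq_summable_hcoeff[of "X M1"] sq_summable_scaleC[OF this, of "- 1"]]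
  have sb: "sq_summable b" by (simp add: complex_vector.scale_minus_left)
  define L where "L = Abs_hardy (hardy_series b)"
  have L: "hcoeff L = b" by (simp add: L_def hcoeff_Abs_hardy sb)
  have "X \<longlonglongrightarrow> L"
  proof (rule metric_LIMSEQ_I)
    fix r :: real assume r: "r > 0"
    then have r2: "r / 2 > 0" by simp
    obtain M where M: "\<forall>k\<ge>M. \<forall>m\<ge>M. dist (X k) (X m) < r / 2"
      using metric_CauchyD[OF X r2] by blast
    have "dist (X k) L < r" if "k \<ge> M" for k
    proof -
      have "(norm (X k - L))\<^sup>2 \<le> (r / 2)\<^sup>2"
        using conjunct2[OF tail[OF r2 M that]] sums_norm_hardy[of "X k - L"]
        by (simp only: sums_iff hcoeff_diff L)
      then have "norm (X k - L) \<le> r / 2"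
        by (rule power2_le_imp_le) (use r in simp)
      then show ?thesis using r by (simp add: dist_norm)
    qed
    then show "\<exists>M. \<forall>k\<ge>M. dist (X k) L < r" by blast
  qed
  then show "convergent X" by (auto simp: convergent_def)
qed

text \<open>\<open>H\<^sup>2(F)\<close> for a closed subspace \<open>F\<close>, as a closed subspace of the Hardy space type.\<close>

definition hardy_space :: "'a::complex_hilbert set \<Rightarrow> 'a hardy set" where
  "hardy_space F = {f. \<forall>z. norm z < 1 \<longrightarrow> hardy_eval f z \<in> F}"

definition ev0 :: "'a::complex_hilbert hardy \<Rightarrow> 'a" where
  "ev0 f = hardy_eval f 0"

definition hardy_mult :: "(complex \<Rightarrow> 'a \<Rightarrow> 'a) \<Rightarrow> 'a::complex_hilbert hardy \<Rightarrow> 'a hardy" where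
  "hardy_mult \<phi> f = Abs_hardy (\<lambda>z. if norm z < 1 then \<phi> z (hardy_eval f z) else 0)"

definition hardy_rot :: "complex \<Rightarrow> 'a::complex_hilbert hardy \<Rightarrow> 'a hardy" where
  "hardy_rot q f = Abs_hardy (\<lambda>z. hardy_eval f (q * z))"


section \<open>Operators between closed subspaces\<close>

text \<open>
  Hilbert spaces that are not a whole type are closed subspaces of one. An operator from the
  closed subspace \<open>A\<close> to the closed subspace \<open>B\<close> is a HOL function of which only the values
  on \<open>A\<close> matter.
\<close>

definition closed_csubspace :: "'a::complex_hilbert set \<Rightarrow> bool" where
  "closed_csubspace S \<longleftrightarrow> complex_vector.subspace S \<and> closed S"

definition bounded_op ::
  "'a::complex_hilbert set \<Rightarrow> 'b::complex_hilbert set \<Rightarrow> ('a \<Rightarrow> 'b) \<Rightarrow> bool" where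
  "bounded_op A B f \<longleftrightarrow> f ` A \<subseteq> B
     \<and> (\<forall>x\<in>A. \<forall>y\<in>A. f (x + y) = f x + f y)
     \<and> (\<forall>c. \<forall>x\<in>A. f (c *\<^sub>C x) = c *\<^sub>C f x)
     \<and> (\<exists>C. \<forall>x\<in>A. norm (f x) \<le> C * norm x)"

definition adjoint_op ::
  "'a::complex_hilbert set \<Rightarrow> 'b::complex_hilbert set \<Rightarrow> ('a \<Rightarrow> 'b) \<Rightarrow> 'b \<Rightarrow> 'a" where
  "adjoint_op A B f y = (THE x. x \<in> A \<and> (\<forall>a\<in>A. cinner (f a) y = cinner a x))"

definition contraction_op :: "('a::complex_hilbert \<Rightarrow> 'b::complex_hilbert) \<Rightarrow> bool" where
  "contraction_op T \<longleftrightarrow> bounded_op UNIV UNIV T \<and> (\<forall>x. norm (T x) \<le> norm x)"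

definition isometry_op ::
  "'a::complex_hilbert set \<Rightarrow> 'b::complex_hilbert set \<Rightarrow> ('a \<Rightarrow> 'b) \<Rightarrow> bool" where
  "isometry_op A B f \<longleftrightarrow> bounded_op A B f \<and> (\<forall>x\<in>A. norm (f x) = norm x)"

definition unitary_op ::
  "'a::complex_hilbert set \<Rightarrow> 'b::complex_hilbert set \<Rightarrow> ('a \<Rightarrow> 'b) \<Rightarrow> bool" where
  "unitary_op A B f \<longleftrightarrow> isometry_op A B f \<and> f ` A = B"

definition orth_proj_op :: "'a::complex_hilbert set \<Rightarrow> ('a \<Rightarrow> 'a) \<Rightarrow> bool" where
  "orth_proj_op F P \<longleftrightarrow> bounded_op F F P
     \<and> (\<forall>x\<in>F. P (P x) = P x) \<and> (\<forall>x\<in>F. \<forall>y\<in>F. cinner (P x) y = cinner x (P y))"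

definition compl_op :: "('a::complex_hilbert \<Rightarrow> 'a) \<Rightarrow> 'a \<Rightarrow> 'a" where
  "compl_op P x = x - P x"

definition positive_op :: "('a::complex_hilbert \<Rightarrow> 'a) \<Rightarrow> bool" where
  "positive_op A \<longleftrightarrow> bounded_op UNIV UNIV A
     \<and> (\<forall>x. cinner (A x) x \<in> \<real> \<and> 0 \<le> Re (cinner (A x) x))"

definition sqrt_op :: "('a::complex_hilbert \<Rightarrow> 'a) \<Rightarrow> 'a \<Rightarrow> 'a" where
  "sqrt_op A = (THE D. positive_op D \<and> D \<circ> D = A)"

definition defect_op :: "('a::complex_hilbert \<Rightarrow> 'a) \<Rightarrow> 'a \<Rightarrow> 'a" where
  "defect_op T = sqrt_op (\<lambda>x. x - adjoint_op UNIV UNIV T (T x))"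

definition defect_space :: "('a::complex_hilbert \<Rightarrow> 'a) \<Rightarrow> 'a set" where
  "defect_space T = closure (range (defect_op T))"


section \<open>Pairs of operators, lifts and Ando tuples\<close>

definition q_commuting ::
  "complex \<Rightarrow> 'a::complex_hilbert set \<Rightarrow> ('a \<Rightarrow> 'a) \<Rightarrow> ('a \<Rightarrow> 'a) \<Rightarrow> bool" where
  "q_commuting q K A1 A2 \<longleftrightarrow> bounded_op K K A1 \<and> bounded_op K K A2
     \<and> (\<forall>x\<in>K. A1 (A2 x) = q *\<^sub>C A2 (A1 x))"

text \<open>The Hilbert space of \<open>T1, T2\<close> is regarded as a subspace of \<open>K\<close> via the isometry \<open>J\<close>.\<close>

definition isometric_lift ::
  "('h::complex_hilbert \<Rightarrow> 'h) \<Rightarrow> ('h \<Rightarrow> 'h) \<Rightarrow> 'k::complex_hilbert set \<Rightarrow> ('h \<Rightarrow> 'k)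
    \<Rightarrow> ('k \<Rightarrow> 'k) \<Rightarrow> ('k \<Rightarrow> 'k) \<Rightarrow> bool" where
  "isometric_lift T1 T2 K J V1 V2 \<longleftrightarrow>
     closed_csubspace K \<and> isometry_op UNIV K J \<and> isometry_op K K V1 \<and> isometry_op K K V2
     \<and> (\<forall>h. adjoint_op K K V1 (J h) = J (adjoint_op UNIV UNIV T1 h))
     \<and> (\<forall>h. adjoint_op K K V2 (J h) = J (adjoint_op UNIV UNIV T2 h))"

definition minimal_lift ::
  "'k::complex_hilbert set \<Rightarrow> ('h \<Rightarrow> 'k) \<Rightarrow> ('k \<Rightarrow> 'k) \<Rightarrow> ('k \<Rightarrow> 'k) \<Rightarrow> bool" where
  "minimal_lift K J V1 V2 \<longleftrightarrow>
     K = closure (complex_vector.span {(V1 ^^ n1) ((V2 ^^ n2) (J h)) | n1 n2 h. True})"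

definition unitarily_equivalent ::
  "'a::complex_hilbert set \<Rightarrow> ('a \<Rightarrow> 'a) \<Rightarrow> ('a \<Rightarrow> 'a)
    \<Rightarrow> 'b::complex_hilbert set \<Rightarrow> ('b \<Rightarrow> 'b) \<Rightarrow> ('b \<Rightarrow> 'b) \<Rightarrow> bool" where
  "unitarily_equivalent K V1 V2 L W1 W2 \<longleftrightarrow>
     (\<exists>\<tau>. unitary_op K L \<tau> \<and> (\<forall>x\<in>K. \<tau> (V1 x) = W1 (\<tau> x) \<and> \<tau> (V2 x) = W2 (\<tau> x)))"

definition ando_tuple ::
  "('h::complex_hilbert \<Rightarrow> 'h) \<Rightarrow> ('h \<Rightarrow> 'h) \<Rightarrow> 'f::complex_hilbert set \<Rightarrow> ('h \<Rightarrow> 'f)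
    \<Rightarrow> ('f \<Rightarrow> 'f) \<Rightarrow> ('f \<Rightarrow> 'f) \<Rightarrow> bool" where
  "ando_tuple T1 T2 F \<Lambda> P U \<longleftrightarrow>
     closed_csubspace F \<and> isometry_op (defect_space (T1 \<circ> T2)) F \<Lambda>
     \<and> orth_proj_op F P \<and> unitary_op F F U"

text \<open>
  The summand \<open>E\<close> is either zero or a copy of the whole space; the direct sum of three spaces is
  a subspace of the threefold product.
\<close>

definition special_ando_tuple ::
  "('h::complex_hilbert \<Rightarrow> 'h) \<Rightarrow> ('h \<Rightarrow> 'h) \<Rightarrow> ('h \<times> 'h \<times> 'h) set \<Rightarrow> ('h \<Rightarrow> 'h \<times> 'h \<times> 'h)
    \<Rightarrow> ('h \<times> 'h \<times> 'h \<Rightarrow> 'h \<times> 'h \<times> 'h) \<Rightarrow> ('h \<times> 'h \<times> 'h \<Rightarrow> 'h \<times> 'h \<times> 'h) \<Rightarrow> bool" where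
  "special_ando_tuple T1 T2 F \<Lambda> P U \<longleftrightarrow>
     (\<exists>E. (E = {0} \<or> E = UNIV) \<and> F = defect_space T1 \<times> defect_space T2 \<times> E)
     \<and> isometry_op (defect_space (T1 \<circ> T2)) F \<Lambda>
     \<and> (\<forall>h. \<Lambda> (defect_op (T1 \<circ> T2) h) = (defect_op T1 (T2 h), defect_op T2 h, 0))
     \<and> unitary_op F F U
     \<and> (\<forall>h. U (defect_op T1 (T2 h), defect_op T2 h, 0) = (defect_op T1 h, defect_op T2 (T1 h), 0))
     \<and> orth_proj_op F P \<and> P ` F = defect_space T1 \<times> {0} \<times> {0}"

text \<open>The block matrices \<open>V\<^sub>1\<^sup>S\<close> and \<open>V\<^sub>2\<^sup>S\<close>, acting on \<open>H \<oplus> H\<^sup>2(F)\<close>.\<close>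

definition schaffer1 ::
  "complex \<Rightarrow> ('h::complex_hilbert \<Rightarrow> 'h) \<Rightarrow> ('h \<Rightarrow> 'h) \<Rightarrow> 'f::complex_hilbert set \<Rightarrow> ('h \<Rightarrow> 'f)
    \<Rightarrow> ('f \<Rightarrow> 'f) \<Rightarrow> ('f \<Rightarrow> 'f) \<Rightarrow> 'h \<times> 'f hardy \<Rightarrow> 'h \<times> 'f hardy" where
  "schaffer1 q T1 T2 F \<Lambda> P U = (\<lambda>(h, f).
     (T1 h,
      adjoint_op (hardy_space F) F ev0 (P (U (\<Lambda> (defect_op (T1 \<circ> T2) h))))
      + q *\<^sub>C hardy_mult (\<lambda>z x. compl_op P (U x) + z *\<^sub>C P (U x)) (hardy_rot q f)))"

definition schaffer2 ::
  "complex \<Rightarrow> ('h::complex_hilbert \<Rightarrow> 'h) \<Rightarrow> ('h \<Rightarrow> 'h) \<Rightarrow> 'f::complex_hilbert set \<Rightarrow> ('h \<Rightarrow> 'f)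
    \<Rightarrow> ('f \<Rightarrow> 'f) \<Rightarrow> ('f \<Rightarrow> 'f) \<Rightarrow> 'h \<times> 'f hardy \<Rightarrow> 'h \<times> 'f hardy" where
  "schaffer2 q T1 T2 F \<Lambda> P U = (\<lambda>(h, f).
     (T2 h,
      cnj q *\<^sub>C adjoint_op (hardy_space F) F ev0
        (adjoint_op F F U (compl_op P (\<Lambda> (defect_op (T1 \<circ> T2) h))))
      + cnj q *\<^sub>C hardy_rot (cnj q)
          (hardy_mult (\<lambda>z x. adjoint_op F F U (P x + z *\<^sub>C compl_op P x)) f)))"

end

theory Submission
  imports Defs
begin

text \<open>
  Write \<open>D\<^sub>T\<close> for the defect operator of \<open>T = T\<^sub>1 T\<^sub>2\<close> and \<open>L = \<Lambda> D\<^sub>T\<close>. Everything is computed on Taylor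
  coefficients: on \<open>H\<^sup>2(F)\<close>, multiplication by \<open>A + z B\<close> sends the coefficients \<open>f\<^sub>n\<close> to \<open>A f\<^sub>n + B f\<^sub>n\<^sub>-\<^sub>1\<close>, and
  \<open>R\<^sub>q\<close> multiplies \<open>f\<^sub>n\<close> by \<open>q\<^sup>n\<close>.

  For any tuple, both products of the block matrices have the diagonal \<open>T\<close>, \<open>M\<^sub>z\<close> up to the factor \<open>q\<close>. The
  relations \<open>P U L T\<^sub>2 + P\<^sup>\<bottom> L = L\<close> and \<open>P\<^sup>\<bottom> L T\<^sub>1 + P U L = U L\<close> make both corners equal to \<open>L\<close>, up to the
  same factor, and the matrices are isometric when \<open>\<parallel>T\<^sub>1 h\<parallel>\<^sup>2 + \<parallel>P U L h\<parallel>\<^sup>2 = \<parallel>h\<parallel>\<^sup>2 = \<parallel>T\<^sub>2 h\<parallel>\<^sup>2 + \<parallel>P\<^sup>\<bottom> L h\<parallel>\<^sup>2\<close> (\<open>schaffer_lift\<close>). A special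
  Ando tuple is built so that these four conditions are identities between defect operators
  (\<open>special_ando_tuple_lift\<close>).

  Conversely, let \<open>(V\<^sub>1, V\<^sub>2)\<close> be a minimal isometric lift and \<open>M\<close> the orthogonal complement of \<open>H\<close>, which is
  invariant under both. By minimality the isometry \<open>S = V\<^sub>1 V\<^sub>2\<close> is pure on \<open>M\<close> (\<open>S_pow_orthogonal\<close>), so the
  Wold decomposition identifies \<open>M\<close> with \<open>H\<^sup>2(F)\<close>, \<open>F = ker (S|\<^sub>M)\<^sup>*\<close>, and \<open>S|\<^sub>M\<close> with \<open>M\<^sub>z\<close>. As in the model of
  Berger, Coburn and Lebow, \<open>P\<close> is the projection of \<open>F\<close> onto the kernel of \<open>(V\<^sub>1|\<^sub>M)\<^sup>*\<close> and \<open>U\<close> compares the two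
  decompositions of \<open>F\<close> that come from \<open>S = V\<^sub>1 V\<^sub>2\<close> and \<open>S = q V\<^sub>2 V\<^sub>1\<close>; with these choices \<open>V\<^sub>1|\<^sub>M\<close> and
  \<open>V\<^sub>2|\<^sub>M\<close> become the lower right corners (\<open>hcoeff_to_hardy_W1_Suc\<close> and its companions). Finally the corner
  \<open>C\<close> of \<open>V\<^sub>1 V\<^sub>2\<close> maps into \<open>F\<close> and satisfies \<open>\<parallel>C h\<parallel> = \<parallel>D\<^sub>T h\<parallel>\<close>, so \<open>D\<^sub>T h \<mapsto> C h\<close> extends to the isometry
  \<open>\<Lambda>\<close>; the corners of \<open>V\<^sub>1\<close> and \<open>V\<^sub>2\<close> are then \<open>P U \<Lambda> D\<^sub>T\<close> and \<open>q\<^sup>-\<^sup>1 U\<^sup>* P\<^sup>\<bottom> \<Lambda> D\<^sub>T\<close> (\<open>model\<close>), which also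
  yields the identities for \<open>P\<close>, \<open>U\<close> and \<open>\<Lambda>\<close>.

  The underlying Hilbert space theory comes first: existence of adjoints by the Riesz representation
  theorem, and existence and uniqueness of the positive square root of \<open>I - T\<^sup>*T\<close>, on which the
  definition of the defect operator rests.
\<close>

section \<open>Riesz representation, adjoints and projections\<close>

lemma cinner_zero_right [simp]: "cinner (x::'a::complex_inner) 0 = 0"
  by (metis cinner_commute cinner_zero_left complex_cnj_zero)

lemma cinner_diff_left: "cinner (x - y) z = cinner x z - cinner y (z::'a::complex_inner)"
  using cinner_add_left[of "x - y" y z] by simp

lemma cinner_diff_right: "cinner z (x - y) = cinner z x - cinner (z::'a::complex_inner) y"
  using cinner_add_right[of z "x - y" y] by simp

lemma cinner_self_eq_0: "cinner x x = 0 \<longleftrightarrow> x = (0::'a::complex_inner)"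
  by (simp add: cinner_self)

lemma cinner_orth_sym: "cinner x y = 0 \<Longrightarrow> cinner y (x::'a::complex_inner) = 0"
  by (metis cinner_commute complex_cnj_zero)

lemma norm_add_Pythagorean_complex:
  assumes "cinner x (y::'a::complex_inner) = 0"
  shows "(norm (x + y))\<^sup>2 = (norm x)\<^sup>2 + (norm y)\<^sup>2"
  using assms by (intro norm_add_Pythagorean) (simp add: orthogonal_def inner_eq_Re_cinner)

lemma cinner_ext:
  assumes "complex_vector.subspace S" "x \<in> S" "y \<in> S" "\<And>a. a \<in> S \<Longrightarrow> cinner a x = cinner a y"
  shows "x = (y::'a::complex_inner)"
proof -
  have "cinner (x - y) (x - y) = 0"
    using assms(4)[OF complex_vector.subspace_diff[OF assms(1-3)]] by (simp add: cinner_diff_right)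
  then show ?thesis by (simp add: cinner_self_eq_0)
qed

text \<open>
  Polarization over \<open>\<complex>\<close>: the quadratic form at \<open>x + y\<close> gives the sum of the two mixed terms, at
  \<open>x + \<i> y\<close> their difference, and together these isolate each of them.
\<close>

lemma polarization_ext:
  fixes A B :: "'a::complex_inner \<Rightarrow> 'b::complex_inner" and C D :: "'a \<Rightarrow> 'c::complex_inner"
  assumes "\<And>x y. A (x + y) = A x + A y" "\<And>c x. A (c *\<^sub>C x) = c *\<^sub>C A x"
    and "\<And>x y. B (x + y) = B x + B y" "\<And>c x. B (c *\<^sub>C x) = c *\<^sub>C B x"
    and "\<And>x y. C (x + y) = C x + C y" "\<And>c x. C (c *\<^sub>C x) = c *\<^sub>C C x"
    and "\<And>x y. D (x + y) = D x + D y" "\<And>c x. D (c *\<^sub>C x) = c *\<^sub>C D x"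
    and eq: "\<And>x. cinner (A x) (B x) = cinner (C x) (D x)"
  shows "cinner (A x) (B y) = cinner (C x) (D y)"
proof -
  have *: "c * cinner (A y) (B x) + cnj c * cinner (A x) (B y)
      = c * cinner (C y) (D x) + cnj c * cinner (C x) (D y)" for c
    using eq[of "x + c *\<^sub>C y"] eq[of x] eq[of y]
    by (simp add: assms(1-8) cinner_add_left cinner_add_right cinner_scaleC_left
        cinner_scaleC_right distrib_left)
  have "\<i> * (cinner (A y) (B x) - cinner (A x) (B y)) = \<i> * (cinner (C y) (D x) - cinner (C x) (D y))"
    using *[of \<i>] by (simp add: algebra_simps)
  then have "cinner (A y) (B x) - cinner (A x) (B y) = cinner (C y) (D x) - cinner (C x) (D y)"
    by simp
  moreover have "cinner (A y) (B x) + cinner (A x) (B y) = cinner (C y) (D x) + cinner (C x) (D y)"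
    using *[of 1] by simp
  moreover have "b = b'" if "a - b = a' - b'" "a + b = a' + b'" for a b a' b' :: complex
    using that by (auto simp: complex_eq_iff)
  ultimately show ?thesis by blast
qed

lemma closed_csubspace_UNIV [simp]: "closed_csubspace UNIV"
  by (simp add: closed_csubspace_def)

lemma
  assumes "closed_csubspace S"
  shows closed_csubspace_0: "0 \<in> S"
    and closed_csubspace_add: "x \<in> S \<Longrightarrow> y \<in> S \<Longrightarrow> x + y \<in> S"
    and closed_csubspace_diff: "x \<in> S \<Longrightarrow> y \<in> S \<Longrightarrow> x - y \<in> S"
    and closed_csubspace_scaleC: "x \<in> S \<Longrightarrow> c *\<^sub>C x \<in> S"
    and closed_csubspace_scaleR: "x \<in> S \<Longrightarrow> r *\<^sub>R x \<in> S"
    and closed_csubspace_sum: "(\<And>i. i \<in> I \<Longrightarrow> g i \<in> S) \<Longrightarrow> sum g I \<in> S"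
    and closed_csubspace_lim: "X \<longlonglongrightarrow> l \<Longrightarrow> (\<And>n. X n \<in> S) \<Longrightarrow> l \<in> S"
    and closed_csubspace_subspace: "complex_vector.subspace S"
proof -
  show sub: "complex_vector.subspace S" using assms by (simp add: closed_csubspace_def)
  show "0 \<in> S" by (rule complex_vector.subspace_0[OF sub])
  show "x \<in> S \<Longrightarrow> y \<in> S \<Longrightarrow> x + y \<in> S" by (rule complex_vector.subspace_add[OF sub])
  show "x \<in> S \<Longrightarrow> y \<in> S \<Longrightarrow> x - y \<in> S" by (rule complex_vector.subspace_diff[OF sub])
  show "x \<in> S \<Longrightarrow> c *\<^sub>C x \<in> S" by (rule complex_vector.subspace_scale[OF sub])
  show "x \<in> S \<Longrightarrow> r *\<^sub>R x \<in> S"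
    unfolding scaleR_scaleC by (rule complex_vector.subspace_scale[OF sub])
  show "(\<And>i. i \<in> I \<Longrightarrow> g i \<in> S) \<Longrightarrow> sum g I \<in> S"
    by (rule complex_vector.subspace_sum[OF sub])
  show "X \<longlonglongrightarrow> l \<Longrightarrow> (\<And>n. X n \<in> S) \<Longrightarrow> l \<in> S"
    using assms closed_sequentially[of S X l] by (simp add: closed_csubspace_def)
qed

text \<open>
  A parabola through the origin that stays nonnegative is horizontal there.
\<close>

lemma first_variation_zero:
  fixes b c :: real
  assumes "\<And>t. 0 \<le> 2 * t * b + t\<^sup>2 * c"
  shows "b = 0"
proof (rule ccontr)
  assume b: "b \<noteq> 0"
  define d where "d = \<bar>c\<bar> + 1"
  have d: "d > 0" "c \<le> d" by (auto simp: d_def)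
  have "2 * (- b / d) * b + (- b / d)\<^sup>2 * c \<le> 2 * (- b / d) * b + (- b / d)\<^sup>2 * d"
    using d by (intro add_left_mono mult_left_mono) auto
  also have "\<dots> = - (b\<^sup>2 / d)" using d by (simp add: field_simps power2_eq_square)
  also have "\<dots> < 0" using b d by simp
  finally show False using assms[of "- b / d"] by simp
qed

text \<open>
  The representing vector minimizes \<open>\<parallel>x\<parallel>\<^sup>2 - 2 Re (f x)\<close> on the subspace: a minimizing sequence is
  Cauchy by the parallelogram law, and the first variation at its limit is the claim.
\<close>

lemma Riesz_representation:
  fixes f :: "'a::complex_hilbert \<Rightarrow> complex"
  assumes S: "closed_csubspace S"
    and add: "\<And>x y. x \<in> S \<Longrightarrow> y \<in> S \<Longrightarrow> f (x + y) = f x + f y"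
    and scale: "\<And>c x. x \<in> S \<Longrightarrow> f (c *\<^sub>C x) = c * f x"
    and bound: "\<And>x. x \<in> S \<Longrightarrow> norm (f x) \<le> C * norm x"
  shows "\<exists>u\<in>S. \<forall>a\<in>S. f a = cinner a u"
proof -
  define \<phi> where "\<phi> x = (norm x)\<^sup>2 - 2 * Re (f x)" for x
  have lower: "- C\<^sup>2 \<le> \<phi> x" if "x \<in> S" for x
  proof -
    have "Re (f x) \<le> C * norm x" using bound[OF that] complex_Re_le_cmod[of "f x"] by linarith
    moreover have "0 \<le> (norm x - C)\<^sup>2" by simp
    ultimately show ?thesis by (simp add: \<phi>_def power2_eq_square algebra_simps)
  qed
  define m where "m = Inf (\<phi> ` S)"
  have bdd: "bdd_below (\<phi> ` S)" by (rule bdd_belowI2[OF lower])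
  have m: "m \<le> \<phi> x" if "x \<in> S" for x
    unfolding m_def using that bdd by (intro cInf_lower) auto
  have "\<exists>x\<in>S. \<phi> x < m + inverse (real (Suc n))" for n
  proof -
    have "m < m + inverse (real (Suc n))" by simp
    then show ?thesis
      unfolding m_def using closed_csubspace_0[OF S] by (subst (asm) cInf_less_iff[OF _ bdd]) auto
  qed
  then obtain X where X: "\<And>n. X n \<in> S" and Xm: "\<And>n. \<phi> (X n) < m + inverse (real (Suc n))"
    by metis
  have scaleR: "f (r *\<^sub>R x) = complex_of_real r * f x" if "x \<in> S" for r x
    using scale[OF that] by (simp add: scaleR_scaleC)
  have par: "(norm (x - y))\<^sup>2 = 2 * \<phi> x + 2 * \<phi> y - 4 * \<phi> ((1/2) *\<^sub>R (x + y))"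
    if "x \<in> S" "y \<in> S" for x y
    using that S
    by (simp add: \<phi>_def scaleR add closed_csubspace_add closed_csubspace_scaleR dot_square_norm[symmetric]
        inner_add_left inner_add_right inner_diff_left inner_diff_right inner_commute algebra_simps)
  have close: "(norm (X k - X n))\<^sup>2 \<le> 4 * inverse (real (Suc N))" if "k \<ge> N" "n \<ge> N" for k n N
  proof -
    have "(norm (X k - X n))\<^sup>2 \<le> 2 * inverse (real (Suc k)) + 2 * inverse (real (Suc n))"
      using par[OF X X, of k n] Xm[of k] Xm[of n]
        m[OF closed_csubspace_scaleR[OF S closed_csubspace_add[OF S X[of k] X[of n]]], of "1/2"]
      by linarith
    moreover have "inverse (real (Suc k)) \<le> inverse (real (Suc N))"
      "inverse (real (Suc n)) \<le> inverse (real (Suc N))"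
      using that by (auto intro!: le_imp_inverse_le)
    ultimately show ?thesis by linarith
  qed
  have "Cauchy X"
  proof (rule metric_CauchyI)
    fix e :: real assume "e > 0"
    then have "e\<^sup>2 / 4 > 0" by simp
    then obtain N where N: "inverse (real (Suc N)) < e\<^sup>2 / 4" using reals_Archimedean by blast
    have "dist (X k) (X n) < e" if "k \<ge> N" "n \<ge> N" for k n
    proof -
      have "(norm (X k - X n))\<^sup>2 < e\<^sup>2" using close[OF that] N by linarith
      then show ?thesis using \<open>e > 0\<close> by (simp add: dist_norm power_less_imp_less_base)
    qed
    then show "\<exists>M. \<forall>k\<ge>M. \<forall>n\<ge>M. dist (X k) (X n) < e" by blast
  qed
  then obtain u where u: "X \<longlonglongrightarrow> u" by (auto simp: Cauchy_convergent_iff convergent_def)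
  have uS: "u \<in> S" using closed_csubspace_lim[OF S u] X by blast
  have re: "Re (f a) = inner a u" if a: "a \<in> S" for a
  proof -
    define b where "b = inner u a - Re (f a)"
    have var: "0 \<le> 2 * t * b + t\<^sup>2 * (norm a)\<^sup>2" for t
    proof (rule tendsto_lowerbound)
      show "(\<lambda>n. 2 * t * (inner (X n) a - Re (f a)) + t\<^sup>2 * (norm a)\<^sup>2 + inverse (real (Suc n)))
          \<longlonglongrightarrow> 2 * t * b + t\<^sup>2 * (norm a)\<^sup>2"
        unfolding b_def by (rule tendsto_eq_intros u LIMSEQ_inverse_real_of_nat refl | simp)+
      have "0 \<le> 2 * t * (inner (X n) a - Re (f a)) + t\<^sup>2 * (norm a)\<^sup>2 + inverse (real (Suc n))" for n
      proof -
        have ta: "t *\<^sub>R a \<in> S" using a S closed_csubspace_scaleR by blast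
        have "\<phi> (X n + t *\<^sub>R a) = \<phi> (X n) + 2 * t * (inner (X n) a - Re (f a)) + t\<^sup>2 * (norm a)\<^sup>2"
          using X[of n] a ta unfolding \<phi>_def power2_norm_eq_inner
          by (simp add: add scaleR inner_add_left inner_add_right inner_commute algebra_simps
              power2_eq_square)
        moreover have "m \<le> \<phi> (X n + t *\<^sub>R a)" using m closed_csubspace_add[OF S X ta] by blast
        ultimately show ?thesis using Xm[of n] by linarith
      qed
      then show "\<forall>\<^sub>F n in sequentially.
          0 \<le> 2 * t * (inner (X n) a - Re (f a)) + t\<^sup>2 * (norm a)\<^sup>2 + inverse (real (Suc n))"
        by simp
    qed simp
    from var have "b = 0" by (rule first_variation_zero)
    then show ?thesis by (simp add: b_def inner_commute)
  qed
  have "f a = cinner a u" if a: "a \<in> S" for a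
  proof (rule complex_eqI)
    show "Re (f a) = Re (cinner a u)" using re[OF a] by (simp add: inner_eq_Re_cinner)
    have "Re (f (\<i> *\<^sub>C a)) = Re (cinner (\<i> *\<^sub>C a) u)"
      using re[of "\<i> *\<^sub>C a"] a S by (simp add: inner_eq_Re_cinner closed_csubspace_scaleC)
    then show "Im (f a) = Im (cinner a u)" using scale[OF a] by (simp add: cinner_scaleC_left)
  qed
  with uS show ?thesis by blast
qed

lemma
  assumes "bounded_op A B f"
  shows bounded_op_mem: "x \<in> A \<Longrightarrow> f x \<in> B"
    and bounded_op_add: "x \<in> A \<Longrightarrow> y \<in> A \<Longrightarrow> f (x + y) = f x + f y"
    and bounded_op_scaleC: "x \<in> A \<Longrightarrow> f (c *\<^sub>C x) = c *\<^sub>C f x"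
    and bounded_op_bound: "\<exists>C\<ge>0. \<forall>x\<in>A. norm (f x) \<le> C * norm x"
proof -
  obtain C where C: "\<forall>x\<in>A. norm (f x) \<le> C * norm x"
    using assms unfolding bounded_op_def by blast
  have "\<forall>x\<in>A. norm (f x) \<le> max C 0 * norm x"
  proof
    fix x assume "x \<in> A"
    then have "norm (f x) \<le> C * norm x" using C by blast
    also have "\<dots> \<le> max C 0 * norm x" by (rule mult_right_mono) auto
    finally show "norm (f x) \<le> max C 0 * norm x" .
  qed
  then show "\<exists>C\<ge>0. \<forall>x\<in>A. norm (f x) \<le> C * norm x" by (intro exI[of _ "max C 0"]) auto
  show "x \<in> A \<Longrightarrow> f x \<in> B" "x \<in> A \<Longrightarrow> y \<in> A \<Longrightarrow> f (x + y) = f x + f y"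
    "x \<in> A \<Longrightarrow> f (c *\<^sub>C x) = c *\<^sub>C f x"
    using assms unfolding bounded_op_def by blast+
qed

lemma bounded_op_zero: "bounded_op A B f \<Longrightarrow> closed_csubspace A \<Longrightarrow> f 0 = 0"
  using bounded_op_scaleC[of A B f 0 0] closed_csubspace_0[of A] by simp

lemma bounded_op_diff:
  assumes f: "bounded_op A B f" and A: "closed_csubspace A" and x: "x \<in> A" and y: "y \<in> A"
  shows "f (x - y) = f x - f y"
  using bounded_op_add[OF f closed_csubspace_diff[OF A x y] y] by simp

lemma bounded_opI:
  assumes "\<And>x. x \<in> A \<Longrightarrow> f x \<in> B" "\<And>x y. x \<in> A \<Longrightarrow> y \<in> A \<Longrightarrow> f (x + y) = f x + f y"
    and "\<And>c x. x \<in> A \<Longrightarrow> f (c *\<^sub>C x) = c *\<^sub>C f x" "\<And>x. x \<in> A \<Longrightarrow> norm (f x) \<le> C * norm x"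
  shows "bounded_op A B f"
  unfolding bounded_op_def
proof (intro conjI allI ballI)
  show "f ` A \<subseteq> B" using assms(1) by blast
  show "\<exists>C. \<forall>x\<in>A. norm (f x) \<le> C * norm x" using assms(4) by blast
qed (fact assms(2) assms(3))+

lemma bounded_op_id: "bounded_op A A (\<lambda>x. x)"
  by (rule bounded_opI[where C = 1]) auto

lemma bounded_op_compose:
  assumes f: "bounded_op A B f" and g: "bounded_op B E g"
  shows "bounded_op A E (\<lambda>x. g (f x))"
proof -
  obtain C where C: "C \<ge> 0" "\<forall>x\<in>A. norm (f x) \<le> C * norm x" using bounded_op_bound[OF f] by blast
  obtain D where D: "D \<ge> 0" "\<forall>x\<in>B. norm (g x) \<le> D * norm x" using bounded_op_bound[OF g] by blast
  show ?thesis
  proof (rule bounded_opI[where C = "D * C"])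
    fix x assume x: "x \<in> A"
    have "norm (g (f x)) \<le> D * norm (f x)" using D(2) bounded_op_mem[OF f x] by blast
    also have "\<dots> \<le> D * (C * norm x)" using C(2) x D(1) by (intro mult_left_mono) auto
    finally show "norm (g (f x)) \<le> D * C * norm x" by (simp add: mult.assoc)
  qed (use f g in \<open>auto simp: bounded_op_mem bounded_op_add bounded_op_scaleC\<close>)
qed

lemma bounded_op_diff_fun:
  assumes f: "bounded_op A B f" and g: "bounded_op A B g" and B: "closed_csubspace B"
  shows "bounded_op A B (\<lambda>x. f x - g x)"
proof -
  obtain C where C: "C \<ge> 0" "\<forall>x\<in>A. norm (f x) \<le> C * norm x" using bounded_op_bound[OF f] by blast
  obtain D where D: "D \<ge> 0" "\<forall>x\<in>A. norm (g x) \<le> D * norm x" using bounded_op_bound[OF g] by blast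
  show ?thesis
  proof (rule bounded_opI[where C = "C + D"])
    fix x assume x: "x \<in> A"
    then have "norm (f x) \<le> C * norm x" "norm (g x) \<le> D * norm x" using C D by auto
    then show "norm (f x - g x) \<le> (C + D) * norm x"
      using norm_triangle_ineq4[of "f x" "g x"] by (simp add: algebra_simps)
  qed (use f g B in \<open>auto simp: bounded_op_mem bounded_op_add bounded_op_scaleC
      closed_csubspace_diff complex_vector.scale_right_diff_distrib\<close>)
qed

lemma bounded_linear_UNIV:
  assumes "bounded_op UNIV B f"
  shows "bounded_linear f"
proof -
  obtain C where "\<forall>x. norm (f x) \<le> C * norm x" using bounded_op_bound[OF assms] by auto
  then show ?thesis
    by (intro bounded_linear_intro[where K = C])
       (auto simp: bounded_op_add[OF assms] bounded_op_scaleC[OF assms] scaleR_scaleC mult.commute)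
qed

lemma adjoint_op_eqI:
  assumes "closed_csubspace A" "x \<in> A" "\<And>a. a \<in> A \<Longrightarrow> cinner (f a) y = cinner a x"
  shows "adjoint_op A B f y = x"
  unfolding adjoint_op_def
proof (rule the_equality)
  show "x \<in> A \<and> (\<forall>a\<in>A. cinner (f a) y = cinner a x)" using assms by blast
  fix x' assume "x' \<in> A \<and> (\<forall>a\<in>A. cinner (f a) y = cinner a x')"
  then show "x' = x" using assms by (auto intro!: cinner_ext[OF closed_csubspace_subspace[OF assms(1)]])
qed

lemma
  assumes f: "bounded_op A B f" and A: "closed_csubspace A"
  shows adjoint_op_mem: "adjoint_op A B f y \<in> A"
    and cinner_adjoint_op: "a \<in> A \<Longrightarrow> cinner (f a) y = cinner a (adjoint_op A B f y)"
proof -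
  obtain C where C: "C \<ge> 0" "\<forall>x\<in>A. norm (f x) \<le> C * norm x" using bounded_op_bound[OF f] by blast
  have "\<exists>u\<in>A. \<forall>a\<in>A. cinner (f a) y = cinner a u"
  proof (rule Riesz_representation[OF A, where C = "C * norm y"])
    fix x assume "x \<in> A"
    then have "norm (f x) * norm y \<le> C * norm x * norm y" using C by (intro mult_right_mono) auto
    then show "norm (cinner (f x) y) \<le> C * norm y * norm x"
      using norm_cinner_le[of "f x" y] by (simp add: mult_ac)
  qed (auto simp: bounded_op_add[OF f] bounded_op_scaleC[OF f] cinner_add_left cinner_scaleC_left)
  then obtain u where "u \<in> A" "\<forall>a\<in>A. cinner (f a) y = cinner a u" by blast
  moreover from this have "adjoint_op A B f y = u" using A by (intro adjoint_op_eqI) auto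
  ultimately show "adjoint_op A B f y \<in> A"
    "a \<in> A \<Longrightarrow> cinner (f a) y = cinner a (adjoint_op A B f y)" by auto
qed

lemma cinner_adjoint_op':
  assumes "bounded_op A B f" "closed_csubspace A" "a \<in> A"
  shows "cinner (adjoint_op A B f y) a = cinner y (f a)"
  using cinner_adjoint_op[OF assms] by (metis cinner_commute)

lemma bounded_op_adjoint_op:
  assumes f: "bounded_op A B f" and A: "closed_csubspace A"
  shows "bounded_op UNIV A (adjoint_op A B f)"
proof -
  obtain C where C: "C \<ge> 0" "\<forall>x\<in>A. norm (f x) \<le> C * norm x" using bounded_op_bound[OF f] by blast
  note mem = adjoint_op_mem[OF f A] and ci = cinner_adjoint_op[OF f A]
  show ?thesis
  proof (rule bounded_opI[where C = C])
    fix x y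
    show "adjoint_op A B f x \<in> A" by (rule mem)
    show "adjoint_op A B f (x + y) = adjoint_op A B f x + adjoint_op A B f y"
      by (rule adjoint_op_eqI) (auto simp: A mem ci closed_csubspace_add cinner_add_right)
    show "adjoint_op A B f (c *\<^sub>C x) = c *\<^sub>C adjoint_op A B f x" for c
      by (rule adjoint_op_eqI) (auto simp: A mem ci closed_csubspace_scaleC cinner_scaleC_right)
    let ?u = "adjoint_op A B f x"
    have "(norm ?u)\<^sup>2 = norm (cinner ?u ?u)" by (simp add: cinner_self norm_power)
    also have "\<dots> = norm (cinner (f ?u) x)" using ci[OF mem] by simp
    also have "\<dots> \<le> norm (f ?u) * norm x" by (rule norm_cinner_le)
    also have "\<dots> \<le> C * norm ?u * norm x" using C mem by (intro mult_right_mono) auto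
    finally have "norm ?u * norm ?u \<le> norm ?u * (C * norm x)" by (simp add: power2_eq_square mult_ac)
    then show "norm ?u \<le> C * norm x"
      using C(1) by (cases "norm ?u = 0") (auto simp: mult_le_cancel_left)
  qed
qed

lemma bounded_op_restrict: "bounded_op A B f \<Longrightarrow> A' \<subseteq> A \<Longrightarrow> bounded_op A' B f"
  unfolding bounded_op_def by blast

text \<open>The orthogonal projection onto a closed subspace is the adjoint of its inclusion.\<close>

definition closed_proj :: "'a::complex_hilbert set \<Rightarrow> 'a \<Rightarrow> 'a" where
  "closed_proj S = adjoint_op S UNIV (\<lambda>x. x)"

lemma
  assumes "closed_csubspace S"
  shows closed_proj_mem: "closed_proj S x \<in> S"
    and bounded_linear_closed_proj: "bounded_linear (closed_proj S)"
    and closed_proj_scaleC: "closed_proj S (c *\<^sub>C x) = c *\<^sub>C closed_proj S x"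
    and closed_proj_idem: "x \<in> S \<Longrightarrow> closed_proj S x = x"
    and bounded_op_closed_proj: "bounded_op UNIV S (closed_proj S)"
proof -
  have i: "bounded_op S UNIV (\<lambda>x. x)" by (rule bounded_opI[where C = 1]) auto
  show b: "bounded_op UNIV S (closed_proj S)"
    using bounded_op_adjoint_op[OF i assms] by (simp add: closed_proj_def)
  show "closed_proj S x \<in> S" using bounded_op_mem[OF b] by simp
  show "bounded_linear (closed_proj S)" by (rule bounded_linear_UNIV[OF b])
  show "closed_proj S (c *\<^sub>C x) = c *\<^sub>C closed_proj S x" using bounded_op_scaleC[OF b] by simp
  show "x \<in> S \<Longrightarrow> closed_proj S x = x"
    unfolding closed_proj_def by (rule adjoint_op_eqI) (use assms in auto)
qed

text \<open>
  An operator is a function of which only the values on a closed subspace matter. Precomposed with the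
  projection it becomes a bounded linear map of the whole space, so that continuity can be applied.
\<close>

lemma bounded_linear_comp_closed_proj:
  assumes f: "bounded_op A B f" and A: "closed_csubspace A"
  shows "bounded_linear (\<lambda>x. f (closed_proj A x))"
  by (rule bounded_linear_UNIV[OF bounded_op_compose[OF bounded_op_closed_proj[OF A] f]])

lemma bounded_op_sums:
  assumes f: "bounded_op A B f" and A: "closed_csubspace A" and mem: "\<And>n. X n \<in> A" and s: "X sums s"
  shows "s \<in> A" "(\<lambda>n. f (X n)) sums f s"
proof -
  show sA: "s \<in> A"
    using s unfolding sums_def by (rule closed_csubspace_lim[OF A]) (intro closed_csubspace_sum A mem)
  show "(\<lambda>n. f (X n)) sums f s"
    using bounded_linear.sums[OF bounded_linear_comp_closed_proj[OF f A] s]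
    by (simp add: closed_proj_idem A mem sA)
qed

lemma
  assumes "isometry_op A B f"
  shows isometry_op_bounded: "bounded_op A B f"
    and isometry_op_norm: "x \<in> A \<Longrightarrow> norm (f x) = norm x"
  using assms by (auto simp: isometry_op_def)

text \<open>
  Polarization needs linearity on the whole space; it is applied to \<open>f\<close> after the projection onto \<open>A\<close>.
\<close>

lemma isometry_op_cinner:
  assumes f: "isometry_op A B f" and A: "closed_csubspace A" and x: "x \<in> A" and y: "y \<in> A"
  shows "cinner (f x) (f y) = cinner x y"
proof -
  let ?p = "closed_proj A"
  note b = isometry_op_bounded[OF f] and p = closed_proj_mem[OF A]
  note pb = bounded_op_closed_proj[OF A]
  have "cinner (f (?p x)) (f (?p y)) = cinner (?p x) (?p y)"
    by (rule polarization_ext)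
       (auto simp: bounded_op_add[OF pb] bounded_op_scaleC[OF pb] bounded_op_add[OF b]
         bounded_op_scaleC[OF b] p cinner_self isometry_op_norm[OF f])
  then show ?thesis using x y by (simp add: closed_proj_idem[OF A])
qed

lemma
  assumes f: "isometry_op A B f" and A: "closed_csubspace A" and x: "x \<in> A"
  shows adjoint_isometry: "adjoint_op A B f (f x) = x"
  by (rule adjoint_op_eqI[OF A x]) (rule isometry_op_cinner[OF f A _ x])

lemma
  assumes U: "unitary_op A B U" and A: "closed_csubspace A" and y: "y \<in> B"
  shows unitary_adjoint_right: "U (adjoint_op A B U y) = y"
    and unitary_adjoint_norm: "norm (adjoint_op A B U y) = norm y"
proof -
  have i: "isometry_op A B U" using U by (simp add: unitary_op_def)
  obtain x where x: "x \<in> A" "y = U x" using U y by (auto simp: unitary_op_def)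
  show "U (adjoint_op A B U y) = y" "norm (adjoint_op A B U y) = norm y"
    using x by (auto simp: adjoint_isometry[OF i A x(1)] isometry_op_norm[OF i])
qed

lemma isometry_opI:
  assumes "\<And>x. x \<in> A \<Longrightarrow> f x \<in> B" "\<And>x y. x \<in> A \<Longrightarrow> y \<in> A \<Longrightarrow> f (x + y) = f x + f y"
    and "\<And>c x. x \<in> A \<Longrightarrow> f (c *\<^sub>C x) = c *\<^sub>C f x" "\<And>x. x \<in> A \<Longrightarrow> norm (f x) = norm x"
  shows "isometry_op A B f"
  using bounded_opI[of A f B 1] assms by (simp add: isometry_op_def)

section \<open>Positive square roots and defect operators\<close>

text \<open>
  Polynomials in \<open>B\<close> with nonnegative coefficients and without constant term; the second argument
  is the value of the polynomial at \<open>1\<close>, which bounds the norm when \<open>B\<close> is a contraction.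
\<close>

inductive nonneg_poly_of ::
  "('a::complex_hilbert \<Rightarrow> 'a) \<Rightarrow> ('a \<Rightarrow> 'a) \<Rightarrow> real \<Rightarrow> bool" for B where
  zero: "nonneg_poly_of B (\<lambda>_. 0) 0"
| base: "nonneg_poly_of B B 1"
| add: "nonneg_poly_of B f a \<Longrightarrow> nonneg_poly_of B g b \<Longrightarrow> nonneg_poly_of B (\<lambda>h. f h + g h) (a + b)"
| scale: "0 \<le> r \<Longrightarrow> nonneg_poly_of B f a \<Longrightarrow> nonneg_poly_of B (\<lambda>h. r *\<^sub>R f h) (r * a)"
| comp: "nonneg_poly_of B f a \<Longrightarrow> nonneg_poly_of B g b \<Longrightarrow> nonneg_poly_of B (\<lambda>h. f (g h)) (a * b)"

lemma nonneg_poly_of_bound: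
  assumes "\<And>h. norm (B h) \<le> norm h" "nonneg_poly_of B f a"
  shows "0 \<le> a \<and> (\<forall>h. norm (f h) \<le> a * norm h)"
  using assms(2)
proof induction
  case (add f a g b)
  have "norm (f h + g h) \<le> (a + b) * norm h" for h
    using norm_triangle_ineq[of "f h" "g h"] add.IH by (simp add: algebra_simps) (smt (verit))
  then show ?case using add.IH by simp
next
  case (scale r f a)
  then show ?case by (simp add: mult.assoc mult_left_mono)
next
  case (comp f a g b)
  have "norm (f (g h)) \<le> a * b * norm h" for h
  proof -
    have "norm (f (g h)) \<le> a * norm (g h)" using comp.IH by blast
    also have "\<dots> \<le> a * (b * norm h)" using comp.IH by (intro mult_left_mono) auto
    finally show ?thesis by (simp add: mult.assoc)
  qed
  then show ?case using comp.IH by simp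
qed (use assms(1) in auto)

lemma nonneg_poly_of_linear:
  assumes "\<And>x y. B (x + y) = B x + B y" "\<And>c x. B (c *\<^sub>C x) = c *\<^sub>C B x" "nonneg_poly_of B f a"
  shows "(\<forall>x y. f (x + y) = f x + f y) \<and> (\<forall>c x. f (c *\<^sub>C x) = c *\<^sub>C f x)"
  using assms(3)
  by induction (auto simp: assms(1,2) scaleC_add_right scaleR_scaleC scaleC_scaleC mult.commute)

lemma nonneg_poly_of_commute:
  assumes "\<And>x y. E (x + y) = E x + E y" "\<And>c x. E (c *\<^sub>C x) = c *\<^sub>C E x" "\<And>x. E (B x) = B (E x)"
    and "nonneg_poly_of B f a"
  shows "E (f x) = f (E x)"
  using assms(4)
proof (induction arbitrary: x)
  case zero
  then show ?case using assms(2)[of 0 0] by simp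
qed (auto simp: assms(1-3) scaleR_scaleC)

lemma nonneg_poly_of_symmetric:
  assumes "\<And>x y. B (x + y) = B x + B y" "\<And>c x. B (c *\<^sub>C x) = c *\<^sub>C B x"
    and "\<And>x y. cinner (B x) y = cinner x (B y)" and "nonneg_poly_of B f a"
  shows "cinner (f x) y = cinner x (f y)"
  using assms(4)
proof (induction arbitrary: x y)
  case (comp f a g b)
  have "f (B x) = B (f x)" for x
    by (rule nonneg_poly_of_commute[OF assms(1,2) _ comp.hyps(1), symmetric]) simp
  then have "f (g y) = g (f y)"
    using nonneg_poly_of_linear[OF assms(1,2) comp.hyps(1)]
    by (intro nonneg_poly_of_commute[OF _ _ _ comp.hyps(2)]) auto
  then show ?case by (simp add: comp.IH)
qed (auto simp: assms(3) cinner_add_left cinner_add_right scaleR_scaleC cinner_scaleC_left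
    cinner_scaleC_right)

primrec sqrt_iter :: "('a::complex_hilbert \<Rightarrow> 'a) \<Rightarrow> nat \<Rightarrow> 'a \<Rightarrow> 'a" where
  "sqrt_iter B 0 = (\<lambda>h. 0)"
| "sqrt_iter B (Suc n) = (\<lambda>h. (1/2) *\<^sub>R (B h + sqrt_iter B n (sqrt_iter B n h)))"

primrec sqrt_weight :: "nat \<Rightarrow> real" where
  "sqrt_weight 0 = 0"
| "sqrt_weight (Suc n) = (1/2) * (1 + sqrt_weight n * sqrt_weight n)"

lemma nonneg_poly_of_sqrt_iter: "nonneg_poly_of B (sqrt_iter B n) (sqrt_weight n)"
proof (induction n)
  case 0
  show ?case by (simp add: nonneg_poly_of.zero)
next
  case (Suc n)
  show ?case
    unfolding sqrt_iter.simps sqrt_weight.simps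
    by (rule nonneg_poly_of.scale[OF _
          nonneg_poly_of.add[OF nonneg_poly_of.base nonneg_poly_of.comp[OF Suc Suc]]]) simp
qed

lemma sqrt_weight_bounds: "0 \<le> sqrt_weight n \<and> sqrt_weight n \<le> 1"
proof (induction n)
  case (Suc n)
  then have "sqrt_weight n * sqrt_weight n \<le> 1" by (simp add: mult_le_one)
  then show ?case using Suc by simp
qed simp

text \<open>
  The increments are again polynomials with nonnegative coefficients, because
  \<open>Y\<^sub>n\<^sub>+\<^sub>1\<^sup>2 - Y\<^sub>n\<^sup>2 = (Y\<^sub>n\<^sub>+\<^sub>1 - Y\<^sub>n) (Y\<^sub>n\<^sub>+\<^sub>1 + Y\<^sub>n)\<close>; so the weights control the convergence.
\<close>

lemma nonneg_poly_of_sqrt_iter_diff: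
  assumes "\<And>x y. B (x + y) = B x + B y" "\<And>c x. B (c *\<^sub>C x) = c *\<^sub>C B x"
  shows "nonneg_poly_of B (\<lambda>h. sqrt_iter B (Suc n) h - sqrt_iter B n h)
    (sqrt_weight (Suc n) - sqrt_weight n)"
proof (induction n)
  case 0
  show ?case using nonneg_poly_of.scale[OF _ nonneg_poly_of.base, of "1/2" B] by simp
next
  case (Suc n)
  let ?Y = "sqrt_iter B n" and ?Z = "sqrt_iter B (Suc n)"
  let ?s = "sqrt_weight n" and ?t = "sqrt_weight (Suc n)"
  note poly = nonneg_poly_of_sqrt_iter[of B]
  have lin: "sqrt_iter B k (x + y) = sqrt_iter B k x + sqrt_iter B k y"
    "sqrt_iter B k (c *\<^sub>C x) = c *\<^sub>C sqrt_iter B k x" for k x y c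
    using nonneg_poly_of_linear[OF assms poly] by blast+
  have "?Z (B x) = B (?Z x)" for x
    by (rule nonneg_poly_of_commute[OF assms _ poly, symmetric]) simp
  then have comm: "?Z (?Y x) = ?Y (?Z x)" for x
    by (intro nonneg_poly_of_commute[OF lin _ poly]) auto
  have "nonneg_poly_of B (\<lambda>h. (1/2) *\<^sub>R (?Z (?Z h + ?Y h) - ?Y (?Z h + ?Y h))) ((1/2) * ((?t - ?s) * (?t + ?s)))"
    by (rule nonneg_poly_of.scale[OF _
          nonneg_poly_of.comp[OF Suc.IH nonneg_poly_of.add[OF poly poly]]]) simp
  moreover have "(1/2) *\<^sub>R (?Z (?Z h + ?Y h) - ?Y (?Z h + ?Y h))
      = sqrt_iter B (Suc (Suc n)) h - ?Z h" for h
  proof -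
    have "sqrt_iter B (Suc (Suc n)) h - ?Z h
        = (1/2) *\<^sub>R ((B h + ?Z (?Z h)) - (B h + ?Y (?Y h)))"
      by (simp only: sqrt_iter.simps scaleR_diff_right)
    then show ?thesis by (simp add: lin comm del: sqrt_iter.simps)
  qed
  moreover have "(1/2) * ((?t - ?s) * (?t + ?s)) = sqrt_weight (Suc (Suc n)) - ?t"
    unfolding sqrt_weight.simps(2)[of "Suc n"]
    by (simp add: algebra_simps)
  ultimately show ?case by (simp only:)
qed

text \<open>
  The square root of \<open>I - B\<close> is \<open>I - S\<close>, where \<open>S = (B + S\<^sup>2) / 2\<close> is the limit of the iteration
  \<open>Y\<^sub>0 = 0\<close>, \<open>Y\<^sub>n\<^sub>+\<^sub>1 = (B + Y\<^sub>n\<^sup>2) / 2\<close>. As a limit of polynomials in \<open>B\<close> it commutes with whatever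
  commutes with \<open>B\<close>, which is what the uniqueness of the root rests on.
\<close>

lemma sqrt_one_minus_exists:
  fixes B :: "'a::complex_hilbert \<Rightarrow> 'a"
  assumes b: "bounded_op UNIV UNIV B" and le: "\<And>h. norm (B h) \<le> norm h"
    and sym: "\<And>x y. cinner (B x) y = cinner x (B y)"
  shows "\<exists>D. positive_op D \<and> (\<forall>h. D (D h) = h - B h)
    \<and> (\<forall>E. bounded_op UNIV UNIV E \<and> (\<forall>x. E (B x) = B (E x)) \<longrightarrow> (\<forall>x. E (D x) = D (E x)))"
proof -
  have linB: "B (x + y) = B x + B y" "B (c *\<^sub>C x) = c *\<^sub>C B x" for x y c
    using bounded_op_add[OF b] bounded_op_scaleC[OF b] by auto
  let ?Y = "sqrt_iter B" and ?s = sqrt_weight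
  note poly = nonneg_poly_of_sqrt_iter[of B]
  note bound = nonneg_poly_of_bound[OF le]
  have lin: "?Y k (x + y) = ?Y k x + ?Y k y" "?Y k (c *\<^sub>C x) = c *\<^sub>C ?Y k x" for k x y c
    using nonneg_poly_of_linear[OF linB poly] by blast+
  have diff: "?Y k (x - y) = ?Y k x - ?Y k y" for k x y
    using lin(1)[of k "x - y" y] by simp
  have Yle: "norm (?Y n h) \<le> norm h" for n h
  proof -
    have "norm (?Y n h) \<le> ?s n * norm h" using bound[OF poly] by blast
    also have "\<dots> \<le> 1 * norm h" using sqrt_weight_bounds by (intro mult_right_mono) auto
    finally show ?thesis by simp
  qed
  have step: "?s n \<le> ?s (Suc n)" "norm (?Y (Suc n) h - ?Y n h) \<le> (?s (Suc n) - ?s n) * norm h" for n h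
    using bound[OF nonneg_poly_of_sqrt_iter_diff[OF linB], of n] by auto
  have "convergent ?s"
    using sqrt_weight_bounds step(1) by (intro Bseq_mono_convergent BseqI'[where K = 1]) (auto simp: incseq_SucI incseqD)
  then have "Cauchy ?s" by (rule convergent_Cauchy)
  have dist: "norm (?Y (n + k) h - ?Y n h) \<le> (?s (n + k) - ?s n) * norm h" for n k h
  proof (induction k)
    case (Suc k)
    have "norm (?Y (n + Suc k) h - ?Y n h)
        \<le> norm (?Y (Suc (n + k)) h - ?Y (n + k) h) + norm (?Y (n + k) h - ?Y n h)"
      using norm_triangle_ineq[of "?Y (Suc (n + k)) h - ?Y (n + k) h" "?Y (n + k) h - ?Y n h"]
      by (simp del: sqrt_iter.simps)
    also have "\<dots> \<le> (?s (Suc (n + k)) - ?s (n + k)) * norm h + (?s (n + k) - ?s n) * norm h"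
      by (intro add_mono step Suc.IH)
    finally show ?case by (simp add: left_diff_distrib del: sqrt_iter.simps sqrt_weight.simps)
  qed simp
  have "convergent (\<lambda>n. ?Y n h)" for h
  proof -
    have "Cauchy (\<lambda>n. ?Y n h)"
      unfolding Cauchy_altdef
    proof (intro allI impI)
      fix e :: real assume e: "e > 0"
      then have "e / (norm h + 1) > 0" by (simp add: add_nonneg_pos)
      then obtain M where M: "\<And>m n. m \<ge> M \<Longrightarrow> n \<ge> M \<Longrightarrow> dist (?s m) (?s n) < e / (norm h + 1)"
        using \<open>Cauchy ?s\<close> unfolding Cauchy_def by meson
      have "dist (?Y m h) (?Y n h) < e" if "m \<ge> M" "n > m" for m n
      proof -
        obtain k where k: "n = m + k" using \<open>n > m\<close> less_imp_add_positive by blast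
        have "dist (?Y m h) (?Y n h) \<le> (?s n - ?s m) * norm h"
          using dist[of m k h] by (simp add: k dist_norm norm_minus_commute)
        also have "\<dots> \<le> \<bar>?s n - ?s m\<bar> * (norm h + 1)" by (intro mult_mono) auto
        also have "\<dots> < e"
          using M[of n m] that by (simp add: dist_real_def pos_less_divide_eq add_nonneg_pos)
        finally show ?thesis .
      qed
      then show "\<exists>M. \<forall>m\<ge>M. \<forall>n>m. dist (?Y m h) (?Y n h) < e" by blast
    qed
    then show ?thesis by (simp add: Cauchy_convergent_iff)
  qed
  then obtain S where S: "\<And>h. (\<lambda>n. ?Y n h) \<longlonglongrightarrow> S h" unfolding convergent_def by metis
  have Slin: "S (x + y) = S x + S y" for x y
    by (rule LIMSEQ_unique[OF S]) (simp add: lin tendsto_add S)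
  have Sscale: "S (c *\<^sub>C x) = c *\<^sub>C S x" for c x
    by (rule LIMSEQ_unique[OF S])
       (simp add: lin bounded_linear.tendsto[OF bounded_linear_scaleC S])
  have Sle: "norm (S h) \<le> norm h" for h
    by (rule tendsto_upperbound[OF tendsto_norm[OF S]]) (auto simp: Yle)
  have Scomm: "E (S x) = S (E x)" if E: "bounded_op UNIV UNIV E" "\<And>x. E (B x) = B (E x)" for E x
  proof (rule LIMSEQ_unique[OF _ S])
    have "E (?Y n x) = ?Y n (E x)" for n
      using bounded_op_add[OF E(1)] bounded_op_scaleC[OF E(1)]
      by (intro nonneg_poly_of_commute[where B = B and E = E, OF _ _ E(2) poly]) auto
    then show "(\<lambda>n. ?Y n (E x)) \<longlonglongrightarrow> E (S x)"
      using bounded_linear.tendsto[OF bounded_linear_UNIV[OF E(1)] S[of x]] by simp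
  qed
  have Ssym: "cinner (S x) y = cinner x (S y)" for x y
  proof (rule LIMSEQ_unique)
    show "(\<lambda>n. cinner (?Y n x) y) \<longlonglongrightarrow> cinner (S x) y"
      by (rule bounded_linear.tendsto[OF bounded_linear_cinner_left S])
    have "(\<lambda>n. cnj (cinner (?Y n y) x)) \<longlonglongrightarrow> cnj (cinner (S y) x)"
      by (intro tendsto_cnj bounded_linear.tendsto[OF bounded_linear_cinner_left S])
    then show "(\<lambda>n. cinner (?Y n x) y) \<longlonglongrightarrow> cinner x (S y)"
      using nonneg_poly_of_symmetric[OF linB sym poly] by (simp add: cinner_commute[symmetric])
  qed
  have YY: "(\<lambda>n. ?Y n (?Y n h)) \<longlonglongrightarrow> S (S h)" for h
  proof -
    have "(\<lambda>n. ?Y n (?Y n h - S h)) \<longlonglongrightarrow> 0"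
    proof (rule Lim_null_comparison)
      show "\<forall>\<^sub>F n in sequentially. norm (?Y n (?Y n h - S h)) \<le> norm (?Y n h - S h)"
        by (simp add: Yle)
      show "(\<lambda>n. norm (?Y n h - S h)) \<longlonglongrightarrow> 0"
        using S[of h] by (simp add: LIM_zero tendsto_norm_zero)
    qed
    from tendsto_add[OF this S[of "S h"]] show ?thesis by (simp add: diff)
  qed
  have fix_eq: "S h = (1/2) *\<^sub>R (B h + S (S h))" for h
  proof (rule LIMSEQ_unique[OF LIMSEQ_Suc[OF S]])
    show "(\<lambda>n. ?Y (Suc n) h) \<longlonglongrightarrow> (1/2) *\<^sub>R (B h + S (S h))"
      unfolding sqrt_iter.simps(2) by (intro tendsto_intros YY)
  qed
  define D where "D h = h - S h" for h
  have Dlin: "D (x + y) = D x + D y" "D (c *\<^sub>C x) = c *\<^sub>C D x" for x y c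
    by (simp_all add: D_def Slin Sscale complex_vector.scale_right_diff_distrib)
  have bD: "bounded_op UNIV UNIV D"
  proof (rule bounded_opI[where C = 2])
    show "norm (D x) \<le> 2 * norm x" for x
      using norm_triangle_ineq4[of x "S x"] Sle[of x] by (simp add: D_def)
  qed (auto simp: Dlin)
  have "positive_op D"
    unfolding positive_op_def
  proof (intro conjI allI bD)
    fix x
    have "cnj (cinner (D x) x) = cinner (D x) x"
      by (simp add: D_def cinner_diff_left Ssym) (metis cinner_commute Ssym complex_cnj_diff)
    then show "cinner (D x) x \<in> \<real>" by (simp add: Reals_cnj_iff)
    have "inner (S x) x \<le> norm x * norm x"
      using norm_cauchy_schwarz[of "S x" x] mult_right_mono[OF Sle[of x], of "norm x"] by simp
    then show "0 \<le> Re (cinner (D x) x)"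
      by (simp add: D_def inner_eq_Re_cinner[symmetric] inner_diff_left dot_square_norm power2_eq_square)
  qed
  moreover have "D (D h) = h - B h" for h
  proof -
    have "S h + S h = B h + S (S h)"
      using arg_cong[OF fix_eq[of h], of "\<lambda>x. 2 *\<^sub>R x"] by (simp add: scaleR_2)
    moreover have "S (h - S h) = S h - S (S h)" by (metis Slin add_diff_cancel_right' diff_add_cancel)
    moreover have "h - S h - (S h - S (S h)) = h - (S h + S h - S (S h))" by simp
    ultimately show ?thesis by (simp add: D_def)
  qed
  moreover have "E (D x) = D (E x)"
    if E: "bounded_op UNIV UNIV E" "\<And>x. E (B x) = B (E x)" for E x
    using Scomm[OF E] bounded_op_diff[OF E(1)] by (simp add: D_def)
  ultimately show ?thesis by blast
qed

lemma positive_op_symmetric: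
  assumes "positive_op D"
  shows "cinner (D x) y = cinner x (D y)"
proof -
  have b: "bounded_op UNIV UNIV D" using assms by (simp add: positive_op_def)
  note l = bounded_op_add[OF b, simplified] bounded_op_scaleC[OF b, simplified]
  show ?thesis
  proof (rule polarization_ext[of D "\<lambda>x. x" "\<lambda>x. x" D])
    fix x
    have "cinner (D x) x \<in> \<real>" using assms by (simp add: positive_op_def)
    then show "cinner (D x) x = cinner x (D x)" by (metis Reals_cnj_iff cinner_commute)
  qed (simp_all add: l)
qed

text \<open>
  The quadratic form of \<open>D\<close> is nonnegative and vanishes at \<open>x\<close>; its derivative at \<open>x\<close> in the direction \<open>D x\<close>
  is \<open>2 \<parallel>D x\<parallel>\<^sup>2\<close>.
\<close>

lemma positive_op_kernel:
  assumes D: "positive_op D" and 0: "Re (cinner (D x) x) = 0"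
  shows "D x = 0"
proof -
  have b: "bounded_op UNIV UNIV D" using D by (simp add: positive_op_def)
  note l = bounded_op_add[OF b, simplified] bounded_op_scaleC[OF b, simplified]
  have "(norm (D x))\<^sup>2 = 0"
  proof (rule first_variation_zero)
    fix t :: real
    have "0 \<le> Re (cinner (D (x + complex_of_real t *\<^sub>C D x)) (x + complex_of_real t *\<^sub>C D x))"
      using D by (simp add: positive_op_def)
    also have "\<dots> = 2 * t * (norm (D x))\<^sup>2 + t\<^sup>2 * Re (cinner (D (D x)) (D x))"
      using 0 by (simp add: l cinner_add_left cinner_add_right cinner_scaleC_left cinner_scaleC_right
          positive_op_symmetric[OF D, of "D x" x] cinner_self power2_eq_square
          algebra_simps del: of_real_power)
    finally show "0 \<le> 2 * t * (norm (D x))\<^sup>2 + t\<^sup>2 * Re (cinner (D (D x)) (D x))" .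
  qed
  then show ?thesis by simp
qed

text \<open>
  For \<open>y = (D - E) x\<close> commutation gives \<open>D y + E y = (D\<^sup>2 - E\<^sup>2) x = 0\<close>, so that both nonnegative numbers
  \<open>\<langle>D y, y\<rangle>\<close> and \<open>\<langle>E y, y\<rangle>\<close> are \<open>0\<close>. Then \<open>D y = E y = 0\<close> and \<open>\<parallel>y\<parallel>\<^sup>2 = \<langle>x, (D - E) y\<rangle> = 0\<close>.
\<close>

lemma positive_sqrt_unique:
  assumes D: "positive_op D" and E: "positive_op E"
    and eq: "\<And>x. D (D x) = E (E x)" and comm: "\<And>x. E (D x) = D (E x)"
  shows "D = E"
proof
  fix x
  have b: "bounded_op UNIV UNIV D" "bounded_op UNIV UNIV E" using D E by (auto simp: positive_op_def)
  note diff = bounded_op_diff[OF b(1), simplified] bounded_op_diff[OF b(2), simplified]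
  define y where "y = D x - E x"
  have "D y + E y = 0" by (simp add: y_def diff eq comm)
  then have "Re (cinner (D y) y) + Re (cinner (E y) y) = 0"
    by (metis cinner_add_left cinner_zero_left plus_complex.sel(1) zero_complex.sel(1))
  moreover have "0 \<le> Re (cinner (D y) y)" "0 \<le> Re (cinner (E y) y)"
    using D E by (auto simp: positive_op_def)
  ultimately have "D y = 0" "E y = 0"
    using positive_op_kernel[OF D, of y] positive_op_kernel[OF E, of y] by auto
  then have "cinner y y = 0"
    using positive_op_symmetric[OF D, of x y] positive_op_symmetric[OF E, of x y]
    by (simp add: y_def cinner_diff_left)
  then show "D x = E x" by (simp add: cinner_self_eq_0 y_def)
qed

lemma closed_csubspace_closure_range:
  assumes f: "bounded_op UNIV B f"
  shows "closed_csubspace (closure (range f))"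
  unfolding closed_csubspace_def complex_vector.subspace_def
proof (intro conjI ballI allI)
  have "f 0 = 0" by (rule bounded_op_zero[OF f]) simp
  then show "0 \<in> closure (range f)" using closure_subset[of "range f"] by (metis rangeI subsetD)
  fix x assume "x \<in> closure (range f)"
  then obtain X where X: "\<And>n. X n \<in> range f" "X \<longlonglongrightarrow> x" by (auto simp: closure_sequential)
  show "c *\<^sub>C x \<in> closure (range f)" for c
    unfolding closure_sequential
  proof (intro exI conjI allI)
    show "(\<lambda>n. c *\<^sub>C X n) \<longlonglongrightarrow> c *\<^sub>C x" by (rule bounded_linear.tendsto[OF bounded_linear_scaleC X(2)])
    show "c *\<^sub>C X n \<in> range f" for n
      using X(1)[of n] bounded_op_scaleC[OF f, of _ c] by (auto simp: image_iff) metis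
  qed
  fix y assume "y \<in> closure (range f)"
  then obtain Y where Y: "\<And>n. Y n \<in> range f" "Y \<longlonglongrightarrow> y" by (auto simp: closure_sequential)
  show "x + y \<in> closure (range f)"
    unfolding closure_sequential
  proof (intro exI conjI allI)
    show "(\<lambda>n. X n + Y n) \<longlonglongrightarrow> x + y" by (rule tendsto_add[OF X(2) Y(2)])
    show "X n + Y n \<in> range f" for n
      using X(1)[of n] Y(1)[of n] bounded_op_add[OF f] by (auto simp: image_iff) metis
  qed
qed simp

text \<open>
  The definition of the square root asks for the unique positive root. Any positive root \<open>E\<close> of \<open>I - B\<close>,
  \<open>B = T\<^sup>*T\<close>, commutes with \<open>E\<^sup>2 = I - B\<close>, hence with \<open>B\<close>, hence with the root constructed above, and
  so equals it.
\<close>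

lemma
  assumes T: "contraction_op T"
  shows positive_defect_op: "positive_op (defect_op T)"
    and defect_op_square: "defect_op T (defect_op T h) = h - adjoint_op UNIV UNIV T (T h)"
proof -
  have b: "bounded_op UNIV UNIV T" and le: "norm (T x) \<le> norm x" for x
    using T by (auto simp: contraction_op_def)
  let ?T' = "adjoint_op UNIV UNIV T"
  define B where "B h = ?T' (T h)" for h
  have bB: "bounded_op UNIV UNIV B"
    unfolding B_def by (rule bounded_op_compose[OF b bounded_op_adjoint_op[OF b]]) simp
  have sym: "cinner (B x) y = cinner x (B y)" for x y
    by (simp add: B_def cinner_adjoint_op[OF b, symmetric] cinner_adjoint_op'[OF b])
  have leB: "norm (B h) \<le> norm h" for h
  proof -
    have "(norm (B h))\<^sup>2 = norm (cinner (T (B h)) (T h))"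
      using cinner_adjoint_op[OF b, of "B h" "T h"] cinner_self[of "B h"]
      by (simp add: B_def norm_power)
    also have "\<dots> \<le> norm (T (B h)) * norm (T h)" by (rule norm_cinner_le)
    also have "\<dots> \<le> norm (B h) * norm h" by (intro mult_mono le) auto
    finally show ?thesis
      by (cases "norm (B h) = 0") (auto simp: power2_eq_square)
  qed
  obtain D where D: "positive_op D" "\<And>h. D (D h) = h - B h"
    and comm: "\<And>E x. bounded_op UNIV UNIV E \<Longrightarrow> (\<And>x. E (B x) = B (E x)) \<Longrightarrow> E (D x) = D (E x)"
    using sqrt_one_minus_exists[OF bB leB sym] by blast
  have "sqrt_op (\<lambda>x. x - B x) = D"
    unfolding sqrt_op_def
  proof (rule the_equality)
    show "positive_op D \<and> D \<circ> D = (\<lambda>x. x - B x)" using D by (auto simp: fun_eq_iff)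
    fix E assume E: "positive_op E \<and> E \<circ> E = (\<lambda>x. x - B x)"
    then have EE: "E (E x) = x - B x" for x by (metis comp_apply)
    have bE: "bounded_op UNIV UNIV E" using E by (simp add: positive_op_def)
    have "E (x - B x) = E x - B (E x)" for x by (metis EE)
    then have "E (B x) = B (E x)" for x using bounded_op_diff[OF bE, of x "B x"] by simp
    then have "D = E"
      using D E EE by (intro positive_sqrt_unique comm[OF bE]) auto
    then show "E = D" by simp
  qed
  then have "defect_op T = D" by (simp add: defect_op_def B_def)
  then show "positive_op (defect_op T)"
    "defect_op T (defect_op T h) = h - adjoint_op UNIV UNIV T (T h)"
    using D by (auto simp: B_def)
qed

lemma
  assumes T: "contraction_op T"
  shows bounded_defect_op: "bounded_op UNIV UNIV (defect_op T)"
    and norm_defect_op: "(norm (defect_op T x))\<^sup>2 = (norm x)\<^sup>2 - (norm (T x))\<^sup>2"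
    and closed_csubspace_defect_space: "closed_csubspace (defect_space T)"
    and defect_op_mem: "defect_op T x \<in> defect_space T"
proof -
  have b: "bounded_op UNIV UNIV T" using T by (auto simp: contraction_op_def)
  note D = positive_defect_op[OF T]
  show bD: "bounded_op UNIV UNIV (defect_op T)" using D by (simp add: positive_op_def)
  have eq: "cinner (defect_op T x) (defect_op T x) = cinner x x - cinner (T x) (T x)"
    by (simp add: positive_op_symmetric[OF D] defect_op_square[OF T] cinner_diff_right
        cinner_adjoint_op[OF b, symmetric])
  show "(norm (defect_op T x))\<^sup>2 = (norm x)\<^sup>2 - (norm (T x))\<^sup>2"
    using eq unfolding cinner_self by (metis of_real_diff of_real_eq_iff)
  show "closed_csubspace (defect_space T)"
    unfolding defect_space_def by (rule closed_csubspace_closure_range[OF bD])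
  show "defect_op T x \<in> defect_space T" unfolding defect_space_def by (rule closure_subset[THEN subsetD]) simp
qed

section \<open>Taylor coefficients in the Hardy space\<close>

lemma sq_summable_bounded:
  assumes a: "sq_summable a" and le: "\<And>n. norm (b n) \<le> C * norm (a n)"
  shows "sq_summable b"
  unfolding sq_summable_def
proof (rule summable_comparison_test'[where N = 0])
  show "summable (\<lambda>n. C\<^sup>2 * (norm (a n))\<^sup>2)" using a by (simp add: sq_summable_def summable_mult)
  show "norm ((norm (b n))\<^sup>2) \<le> C\<^sup>2 * (norm (a n))\<^sup>2" for n
    using power_mono[OF le, of n 2] by (simp add: power_mult_distrib)
qed

text \<open>
  The coefficients of \<open>z f(z)\<close> in terms of those of \<open>f\<close>.
\<close>

definition delayed :: "(nat \<Rightarrow> 'a::zero) \<Rightarrow> nat \<Rightarrow> 'a" where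
  "delayed a n = (case n of 0 \<Rightarrow> 0 | Suc m \<Rightarrow> a m)"

lemma delayed_simps [simp]: "delayed a 0 = 0" "delayed a (Suc n) = a n"
  by (simp_all add: delayed_def)

lemma sums_delayed:
  assumes "(\<lambda>n. a n :: 'a::real_normed_vector) sums s"
  shows "delayed a sums s"
  by (subst sums_Suc_iff[symmetric, where f = "delayed a", simplified]) (rule assms)

lemma sq_summable_delayed: "sq_summable a \<Longrightarrow> sq_summable (delayed a)"
  unfolding sq_summable_def by (subst summable_Suc_iff[symmetric]) simp

lemma ev0_eq_hcoeff: "ev0 f = hcoeff f 0"
proof -
  have "(\<Sum>n. (0::complex) ^ n *\<^sub>C hcoeff f n) = (\<Sum>n\<in>{0}. 0 ^ n *\<^sub>C hcoeff f n)"
    by (rule suminf_finite) auto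
  then show ?thesis by (simp add: ev0_def hardy_eval_hcoeff hardy_series_def)
qed

lemma hardy_series_mem:
  assumes F: "closed_csubspace F" and a: "sq_summable a" "\<And>n. a n \<in> F"
  shows "hardy_series a z \<in> F"
proof (cases "norm z < 1")
  case True
  have "(\<lambda>n. z ^ n *\<^sub>C a n) sums hardy_series a z"
    using summable_sums[OF summable_hardy_series[OF a(1) True]] True by (simp add: hardy_series_def)
  from bounded_op_sums(1)[OF bounded_op_id F _ this] show ?thesis
    by (simp add: closed_csubspace_scaleC[OF F] a(2))
qed (simp add: hardy_series_def closed_csubspace_0[OF F])

text \<open>
  Projecting the coefficients of a function onto the closed subspace in which it takes its values
  does not change the function, hence not the coefficients.
\<close>

lemma hardy_space_iff:
  assumes F: "closed_csubspace F"
  shows "f \<in> hardy_space F \<longleftrightarrow> (\<forall>n. hcoeff f n \<in> F)"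
proof
  assume "\<forall>n. hcoeff f n \<in> F"
  then show "f \<in> hardy_space F"
    by (auto simp: hardy_space_def hardy_eval_hcoeff intro: hardy_series_mem F sq_summable_hcoeff)
next
  assume f: "f \<in> hardy_space F"
  define b where "b n = closed_proj F (hcoeff f n)" for n
  obtain C where C: "\<And>x. norm (closed_proj F x) \<le> C * norm x"
    using bounded_op_bound[OF bounded_op_closed_proj[OF F]] by auto
  have b: "sq_summable b" unfolding b_def by (rule sq_summable_bounded[OF sq_summable_hcoeff C])
  have "hardy_series b z = hardy_series (hcoeff f) z" for z
  proof (cases "norm z < 1")
    case True
    have "(\<lambda>n. z ^ n *\<^sub>C hcoeff f n) sums hardy_eval f z"
      using summable_sums[OF summable_hardy_series[OF sq_summable_hcoeff True]] True
      by (simp add: hardy_series_def hardy_eval_hcoeff)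
    from bounded_linear.sums[OF bounded_linear_closed_proj[OF F] this]
    have "(\<lambda>n. z ^ n *\<^sub>C b n) sums closed_proj F (hardy_eval f z)"
      by (simp add: b_def closed_proj_scaleC[OF F])
    moreover have "closed_proj F (hardy_eval f z) = hardy_eval f z"
      using f True by (simp add: hardy_space_def closed_proj_idem[OF F])
    ultimately show ?thesis using True by (simp add: hardy_series_def hardy_eval_hcoeff sums_iff)
  qed (simp add: hardy_series_def)
  then have "b = hcoeff f" using hardy_series_inj[OF b sq_summable_hcoeff] by blast
  then show "\<forall>n. hcoeff f n \<in> F" using closed_proj_mem[OF F] by (metis b_def)
qed

lemma bounded_linear_hcoeff: "bounded_linear (\<lambda>f. hcoeff f n)"
  by (rule bounded_linear_intro[where K = 1])
     (auto simp: hcoeff_add scaleR_scaleC hcoeff_scaleC norm_hcoeff_le)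

lemma closed_csubspace_hardy_space:
  assumes F: "closed_csubspace F"
  shows "closed_csubspace (hardy_space F)"
  unfolding closed_csubspace_def complex_vector.subspace_def
proof (intro conjI ballI allI)
  show "closed (hardy_space F)"
  proof (rule closed_sequential_limits[THEN iffD2], intro allI impI)
    fix X l assume X: "(\<forall>k. X k \<in> hardy_space F) \<and> X \<longlonglongrightarrow> l"
    have "hcoeff l n \<in> F" for n
    proof (rule closed_csubspace_lim[OF F])
      show "(\<lambda>k. hcoeff (X k) n) \<longlonglongrightarrow> hcoeff l n"
        by (rule bounded_linear.tendsto[OF bounded_linear_hcoeff]) (use X in blast)
      show "hcoeff (X k) n \<in> F" for k using X hardy_space_iff[OF F] by blast
    qed
    then show "l \<in> hardy_space F" by (simp add: hardy_space_iff[OF F])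
  qed
qed (auto simp: hardy_space_iff[OF F] hcoeff_zero hcoeff_add hcoeff_scaleC
    closed_csubspace_0[OF F] closed_csubspace_add[OF F] closed_csubspace_scaleC[OF F])

lemma cinner_hardy_single:
  assumes "\<And>k. k \<noteq> n \<Longrightarrow> hcoeff f k = 0 \<or> hcoeff g k = 0"
  shows "cinner f g = cinner (hcoeff f n) (hcoeff g n)"
proof -
  have "(if k = n then cinner (hcoeff f k) (hcoeff g k) else 0) = cinner (hcoeff f k) (hcoeff g k)" for k
    using assms[of k] by auto
  then have "(\<lambda>k. cinner (hcoeff f k) (hcoeff g k)) sums cinner (hcoeff f n) (hcoeff g n)"
    using sums_single[of n "\<lambda>k. cinner (hcoeff f k) (hcoeff g k)"] by simp
  then show ?thesis by (simp add: cinner_hardy_def sums_iff)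
qed

definition hardy_of :: "(nat \<Rightarrow> 'a::complex_hilbert) \<Rightarrow> 'a hardy" where
  "hardy_of a = Abs_hardy (hardy_series a)"

lemma hcoeff_hardy_of: "sq_summable a \<Longrightarrow> hcoeff (hardy_of a) = a"
  by (simp add: hardy_of_def hcoeff_Abs_hardy)

lemma sq_summable_const0: "sq_summable (\<lambda>n. if n = 0 then v else 0)"
  unfolding sq_summable_def by (rule summable_finite[of "{0}"]) auto

lemma hcoeff_adjoint_ev0:
  assumes F: "closed_csubspace F" and v: "v \<in> F"
  shows "hcoeff (adjoint_op (hardy_space F) F ev0 v) n = (if n = 0 then v else 0)"
proof -
  let ?g = "hardy_of (\<lambda>n. if n = 0 then v else 0)"
  have g: "hcoeff ?g = (\<lambda>n. if n = 0 then v else 0)" by (rule hcoeff_hardy_of[OF sq_summable_const0])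
  have "adjoint_op (hardy_space F) F ev0 v = ?g"
  proof (rule adjoint_op_eqI[OF closed_csubspace_hardy_space[OF F]])
    show "?g \<in> hardy_space F" by (simp add: hardy_space_iff[OF F] g v closed_csubspace_0[OF F])
    show "cinner (ev0 a) v = cinner a ?g" for a
      by (subst cinner_hardy_single[of 0]) (simp_all add: g ev0_eq_hcoeff)
  qed
  then show ?thesis by (simp add: g)
qed

lemma hcoeff_hardy_rot:
  assumes q: "norm q = 1"
  shows "hcoeff (hardy_rot q f) n = q ^ n *\<^sub>C hcoeff f n"
proof -
  let ?b = "\<lambda>n. q ^ n *\<^sub>C hcoeff f n"
  have b: "sq_summable ?b"
    by (rule sq_summable_bounded[OF sq_summable_hcoeff[of f], where C = 1])
       (simp add: norm_scaleC norm_power q)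
  have "hardy_rot q f = hardy_of ?b"
    unfolding hardy_rot_def hardy_of_def
    by (rule arg_cong[where f = Abs_hardy])
       (simp add: fun_eq_iff hardy_eval_hcoeff hardy_series_def norm_mult q scaleC_scaleC
         power_mult_distrib mult.commute)
  then show ?thesis by (simp add: hcoeff_hardy_of[OF b])
qed

text \<open>
  Operators that are bounded on \<open>F\<close> can be applied to the Taylor series term by term, because its partial
  sums lie in \<open>F\<close>.
\<close>

lemma hcoeff_hardy_mult:
  assumes F: "closed_csubspace F" and A: "bounded_op F F A" and B: "bounded_op F F B"
    and f: "f \<in> hardy_space F"
  shows "hcoeff (hardy_mult (\<lambda>z x. A x + z *\<^sub>C B x) f) n
    = A (hcoeff f n) + delayed (\<lambda>n. B (hcoeff f n)) n"
proof -
  let ?b = "\<lambda>n. A (hcoeff f n) + delayed (\<lambda>n. B (hcoeff f n)) n"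
  have mem: "hcoeff f n \<in> F" for n using f by (simp add: hardy_space_iff[OF F])
  have sq: "sq_summable (\<lambda>n. G (hcoeff f n))" if G: "bounded_op F F G" for G
  proof -
    obtain C where C: "\<forall>x\<in>F. norm (G x) \<le> C * norm x" using bounded_op_bound[OF G] by blast
    show ?thesis by (rule sq_summable_bounded[OF sq_summable_hcoeff]) (use C mem in blast)
  qed
  have b: "sq_summable ?b" by (intro sq_summable_add sq_summable_delayed sq A B)
  have "(if norm z < 1 then A (hardy_eval f z) + z *\<^sub>C B (hardy_eval f z) else 0) = hardy_series ?b z" for z
  proof (cases "norm z < 1")
    case True
    have s: "(\<lambda>n. z ^ n *\<^sub>C hcoeff f n) sums hardy_eval f z"
      using summable_sums[OF summable_hardy_series[OF sq_summable_hcoeff True]] True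
      by (simp add: hardy_series_def hardy_eval_hcoeff)
    have G: "(\<lambda>n. z ^ n *\<^sub>C G (hcoeff f n)) sums G (hardy_eval f z)" if G: "bounded_op F F G" for G
      using bounded_op_sums(2)[OF G F closed_csubspace_scaleC[OF F mem] s]
      by (simp add: bounded_op_scaleC[OF G mem])
    have "(\<lambda>n. z *\<^sub>C z ^ n *\<^sub>C B (hcoeff f n)) sums (z *\<^sub>C B (hardy_eval f z))"
      by (rule bounded_linear.sums[OF bounded_linear_scaleC G[OF B]])
    from sums_add[OF G[OF A] sums_delayed[OF this]]
    have "(\<lambda>n. z ^ n *\<^sub>C A (hcoeff f n) + delayed (\<lambda>n. z *\<^sub>C z ^ n *\<^sub>C B (hcoeff f n)) n)
        sums (A (hardy_eval f z) + z *\<^sub>C B (hardy_eval f z))" .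
    moreover have "delayed (\<lambda>n. z *\<^sub>C z ^ n *\<^sub>C B (hcoeff f n)) n
        = z ^ n *\<^sub>C delayed (\<lambda>n. B (hcoeff f n)) n" for n
      by (cases n) (auto simp: scaleC_scaleC)
    ultimately show ?thesis using True by (simp add: hardy_series_def scaleC_add_right sums_iff)
  qed (simp add: hardy_series_def)
  then have "hardy_mult (\<lambda>z x. A x + z *\<^sub>C B x) f = hardy_of ?b"
    unfolding hardy_mult_def hardy_of_def by presburger
  then show ?thesis by (simp add: hcoeff_hardy_of[OF b])
qed

section \<open>The block operators on \<open>H \<oplus> H\<^sup>2(F)\<close>\<close>

lemma hardy_mult_cong:
  assumes "f \<in> hardy_space F" "\<And>z x. x \<in> F \<Longrightarrow> \<phi> z x = \<psi> z x"
  shows "hardy_mult \<phi> f = hardy_mult \<psi> f"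
proof -
  have "(\<lambda>z. if norm z < 1 then \<phi> z (hardy_eval f z) else 0)
      = (\<lambda>z. if norm z < 1 then \<psi> z (hardy_eval f z) else 0)"
    using assms by (auto simp: hardy_space_def fun_eq_iff)
  then show ?thesis by (simp add: hardy_mult_def)
qed

lemma closed_csubspace_Times:
  assumes A: "closed_csubspace A" and S: "closed_csubspace S"
  shows "closed_csubspace (A \<times> S)"
  unfolding closed_csubspace_def complex_vector.subspace_def
proof (intro conjI ballI allI)
  show "closed (A \<times> S)" using A S by (simp add: closed_csubspace_def closed_Times)
  show "0 \<in> A \<times> S" by (simp add: zero_prod_def closed_csubspace_0 A S)
  show "x + y \<in> A \<times> S" if "x \<in> A \<times> S" "y \<in> A \<times> S" for x y
    using that closed_csubspace_add[OF A] closed_csubspace_add[OF S] by (cases x, cases y) auto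
  show "c *\<^sub>C x \<in> A \<times> S" if "x \<in> A \<times> S" for c x
    using that closed_csubspace_scaleC[OF A] closed_csubspace_scaleC[OF S]
    by (cases x) (auto simp: scaleC_prod_def)
qed

lemma norm_prod_square: "(norm x)\<^sup>2 = (norm (fst x))\<^sup>2 + (norm (snd x))\<^sup>2"
  by (simp add: norm_prod_def)

lemma
  assumes P: "orth_proj_op F P" and F: "closed_csubspace F"
  shows orth_proj_bounded: "bounded_op F F P"
    and compl_op_bounded: "bounded_op F F (compl_op P)"
    and orth_proj_idem: "x \<in> F \<Longrightarrow> P (P x) = P x"
    and compl_op_idem: "x \<in> F \<Longrightarrow> compl_op P (compl_op P x) = compl_op P x"
    and orth_proj_compl: "x \<in> F \<Longrightarrow> P (compl_op P x) = 0"
    and compl_orth_proj: "x \<in> F \<Longrightarrow> compl_op P (P x) = 0"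
    and cinner_orth_proj: "x \<in> F \<Longrightarrow> y \<in> F \<Longrightarrow> cinner (P x) y = cinner x (P y)"
    and cinner_orth_proj_compl: "x \<in> F \<Longrightarrow> y \<in> F \<Longrightarrow> cinner (P x) (compl_op P y) = 0"
    and norm_orth_proj_compl: "x \<in> F \<Longrightarrow> (norm (P x))\<^sup>2 + (norm (compl_op P x))\<^sup>2 = (norm x)\<^sup>2"
proof -
  show b: "bounded_op F F P" using P by (simp add: orth_proj_op_def)
  show bc: "bounded_op F F (compl_op P)"
    unfolding compl_op_def[abs_def] by (rule bounded_op_diff_fun[OF bounded_op_id b F])
  show i: "P (P x) = P x" if "x \<in> F" for x using P that by (simp add: orth_proj_op_def)
  show s: "cinner (P x) y = cinner x (P y)" if "x \<in> F" "y \<in> F" for x y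
    using P that by (simp add: orth_proj_op_def)
  note mem = bounded_op_mem[OF b] bounded_op_mem[OF bc]
  show pc: "P (compl_op P x) = 0" if "x \<in> F" for x
    using that by (simp add: compl_op_def bounded_op_diff[OF b F] mem i)
  show "compl_op P (P x) = 0" if "x \<in> F" for x using that by (simp add: compl_op_def i)
  show "compl_op P (compl_op P x) = compl_op P x" if "x \<in> F" for x
    using pc[OF that] by (simp add: compl_op_def[of P "compl_op P x"])
  show o: "cinner (P x) (compl_op P y) = 0" if "x \<in> F" "y \<in> F" for x y
    using that by (simp add: s mem pc)
  show "(norm (P x))\<^sup>2 + (norm (compl_op P x))\<^sup>2 = (norm x)\<^sup>2" if "x \<in> F" for x
    using norm_add_Pythagorean_complex[OF o[OF that that]] by (simp add: compl_op_def)
qed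

lemma contraction_comp: "contraction_op S \<Longrightarrow> contraction_op T \<Longrightarrow> contraction_op (S \<circ> T)"
  unfolding contraction_op_def using bounded_op_compose[of UNIV UNIV T UNIV S]
  by (auto simp: comp_def intro: order_trans)

text \<open>Shifting part of the coefficients by one place does not change the total mass.\<close>

lemma norm_hardy_split:
  assumes "\<And>n. (norm (hcoeff g n))\<^sup>2 = (if n = 0 then c else 0) + \<alpha> n + delayed \<beta> n"
    and "\<And>n. \<alpha> n + \<beta> n = (norm (hcoeff f n))\<^sup>2" "\<And>n. 0 \<le> \<alpha> n" "\<And>n. 0 \<le> \<beta> n"
  shows "(norm g)\<^sup>2 = c + (norm f)\<^sup>2"
proof -
  have f: "(\<lambda>n. \<alpha> n + \<beta> n) sums (norm f)\<^sup>2" using sums_norm_hardy[of f] by (simp add: assms(2))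
  have "summable \<alpha>" "summable \<beta>"
    by (rule summable_comparison_test'[OF sums_summable[OF f], where N = 0], use assms(3,4) in simp)+
  then have s: "\<alpha> sums suminf \<alpha>" "\<beta> sums suminf \<beta>" by (auto intro: summable_sums)
  have "(\<lambda>n. (if n = 0 then c else 0) + \<alpha> n + delayed \<beta> n) sums (c + suminf \<alpha> + suminf \<beta>)"
    using sums_single[of 0 "\<lambda>_. c"] by (intro sums_add s sums_delayed) auto
  then have "(norm g)\<^sup>2 = c + suminf \<alpha> + suminf \<beta>"
    using sums_norm_hardy[of g] by (simp add: assms(1) sums_iff)
  moreover have "(norm f)\<^sup>2 = suminf \<alpha> + suminf \<beta>"
    using sums_unique2[OF f sums_add[OF s]] .
  ultimately show ?thesis by simp
qed

lemma unimodular_power [simp]: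
  assumes "norm (q::complex) = 1"
  shows "q * cnj q = 1" "cnj q * q = 1" "q ^ n * cnj q ^ n = 1" "cnj q ^ n * q ^ n = 1"
proof -
  show *: "q * cnj q = 1" using complex_norm_square[of q] assms by simp
  then show **: "cnj q * q = 1" by (simp add: mult.commute)
  show "q ^ n * cnj q ^ n = 1" "cnj q ^ n * q ^ n = 1"
    by (simp_all add: power_mult_distrib[symmetric] * **)
qed

text \<open>
  The operators \<open>S1\<close> and \<open>S2\<close> below are the two block matrices of an Ando tuple; \<open>L = \<Lambda> D\<^sub>T\<close>, \<open>P'\<close> is the
  complementary projection and \<open>U'\<close> the inverse of \<open>U\<close>.
\<close>

locale schaffer_model =
  fixes q :: complex and T1 T2 :: "'h::complex_hilbert \<Rightarrow> 'h" and F :: "'f::complex_hilbert set"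
    and \<Lambda> :: "'h \<Rightarrow> 'f" and P U :: "'f \<Rightarrow> 'f"
  assumes q: "norm q = 1" and T1: "contraction_op T1" and T2: "contraction_op T2"
    and tuple: "ando_tuple T1 T2 F \<Lambda> P U"
begin

abbreviation L where "L h \<equiv> \<Lambda> (defect_op (T1 \<circ> T2) h)"
abbreviation P' where "P' \<equiv> compl_op P"
abbreviation U' where "U' \<equiv> adjoint_op F F U"
abbreviation S1 where "S1 \<equiv> schaffer1 q T1 T2 F \<Lambda> P U"
abbreviation S2 where "S2 \<equiv> schaffer2 q T1 T2 F \<Lambda> P U"

lemma F: "closed_csubspace F" and P: "orth_proj_op F P" and U: "unitary_op F F U"
  and \<Lambda>: "isometry_op (defect_space (T1 \<circ> T2)) F \<Lambda>"
  using tuple by (auto simp: ando_tuple_def)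

lemma T: "contraction_op (T1 \<circ> T2)" by (rule contraction_comp[OF T1 T2])

lemma bT1: "bounded_op UNIV UNIV T1" and bT2: "bounded_op UNIV UNIV T2"
  using T1 T2 by (auto simp: contraction_op_def)

lemma bL: "bounded_op UNIV F L"
proof -
  have "bounded_op UNIV (defect_space (T1 \<circ> T2)) (defect_op (T1 \<circ> T2))"
    using bounded_defect_op[OF T] defect_op_mem[OF T] by (auto simp: bounded_op_def)
  then show ?thesis by (rule bounded_op_compose) (rule isometry_op_bounded[OF \<Lambda>])
qed

lemma iU: "isometry_op F F U" using U by (simp add: unitary_op_def)

lemmas bU = isometry_op_bounded[OF iU]
lemmas bU' = bounded_op_restrict[OF bounded_op_adjoint_op[OF bU F] subset_UNIV[of F]]
lemmas bP = orth_proj_bounded[OF P F]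
lemmas bP' = compl_op_bounded[OF P F]
lemmas mem = bounded_op_mem[OF bU] bounded_op_mem[OF bU'] bounded_op_mem[OF bP]
  bounded_op_mem[OF bP'] bounded_op_mem[OF bL UNIV_I] closed_csubspace_add[OF F]
  closed_csubspace_scaleC[OF F] closed_csubspace_0[OF F]
lemmas lin = bounded_op_add[OF bU] bounded_op_add[OF bU'] bounded_op_add[OF bP]
  bounded_op_add[OF bP'] bounded_op_scaleC[OF bU] bounded_op_scaleC[OF bU']
  bounded_op_scaleC[OF bP] bounded_op_scaleC[OF bP'] bounded_op_add[OF bL UNIV_I UNIV_I]
  bounded_op_scaleC[OF bL UNIV_I] bounded_op_add[OF bT1 UNIV_I UNIV_I]
  bounded_op_add[OF bT2 UNIV_I UNIV_I] bounded_op_scaleC[OF bT1 UNIV_I]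
  bounded_op_scaleC[OF bT2 UNIV_I]
lemmas proj = orth_proj_idem[OF P F] compl_op_idem[OF P F] orth_proj_compl[OF P F]
  compl_orth_proj[OF P F]

lemma UU': "x \<in> F \<Longrightarrow> U (U' x) = x" by (rule unitary_adjoint_right[OF U F])
lemma U'U: "x \<in> F \<Longrightarrow> U' (U x) = x" by (rule adjoint_isometry[OF iU F])
lemma norm_U: "x \<in> F \<Longrightarrow> norm (U x) = norm x" by (rule isometry_op_norm[OF iU])
lemma norm_U': "x \<in> F \<Longrightarrow> norm (U' x) = norm x" by (rule unitary_adjoint_norm[OF U F])

lemma fst_S [simp]: "fst (S1 (h, f)) = T1 h" "fst (S2 (h, f)) = T2 h"
  by (simp_all add: schaffer1_def schaffer2_def)

lemma hcoeff_mem: "f \<in> hardy_space F \<Longrightarrow> hcoeff f n \<in> F"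
  by (simp add: hardy_space_iff[OF F])

text \<open>
  The rotation contributes the factor \<open>q\<^sup>n\<close> to the \<open>n\<close>-th coefficient before the multiplication in \<open>S1\<close>, and
  \<open>q\<^sup>-\<^sup>n\<close> after the multiplication in \<open>S2\<close>.
\<close>

lemma
  assumes f: "f \<in> hardy_space F"
  shows hcoeff_S1_0: "hcoeff (snd (S1 (h, f))) 0 = P (U (L h)) + q *\<^sub>C P' (U (hcoeff f 0))"
    and hcoeff_S1_Suc: "hcoeff (snd (S1 (h, f))) (Suc n)
      = q ^ (n + 2) *\<^sub>C P' (U (hcoeff f (Suc n))) + q ^ (n + 1) *\<^sub>C P (U (hcoeff f n))"
proof -
  have r: "hardy_rot q f \<in> hardy_space F"
    using f by (simp add: hardy_space_iff[OF F] hcoeff_hardy_rot[OF q] closed_csubspace_scaleC[OF F])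
  have "hcoeff (snd (S1 (h, f))) n = (if n = 0 then P (U (L h)) else 0)
      + q *\<^sub>C (P' (U (q ^ n *\<^sub>C hcoeff f n)) + delayed (\<lambda>n. P (U (q ^ n *\<^sub>C hcoeff f n))) n)" for n
    by (simp add: schaffer1_def hcoeff_add hcoeff_scaleC hcoeff_adjoint_ev0[OF F] mem
        hcoeff_hardy_mult[OF F bounded_op_compose[OF bU bP'] bounded_op_compose[OF bU bP] r]
        hcoeff_hardy_rot[OF q])
  note * = this
  show "hcoeff (snd (S1 (h, f))) 0 = P (U (L h)) + q *\<^sub>C P' (U (hcoeff f 0))"
    by (simp add: *)
  show "hcoeff (snd (S1 (h, f))) (Suc n)
      = q ^ (n + 2) *\<^sub>C P' (U (hcoeff f (Suc n))) + q ^ (n + 1) *\<^sub>C P (U (hcoeff f n))"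
    by (simp add: * lin mem hcoeff_mem[OF f] scaleC_add_right scaleC_scaleC)
qed

lemma
  assumes f: "f \<in> hardy_space F"
  shows hcoeff_S2_0: "hcoeff (snd (S2 (h, f))) 0 = cnj q *\<^sub>C U' (P' (L h) + P (hcoeff f 0))"
    and hcoeff_S2_Suc: "hcoeff (snd (S2 (h, f))) (Suc n)
      = cnj q ^ (n + 2) *\<^sub>C U' (P (hcoeff f (Suc n)) + P' (hcoeff f n))"
proof -
  have q': "norm (cnj q) = 1" using q by simp
  have "hardy_mult (\<lambda>z x. U' (P x + z *\<^sub>C P' x)) f = hardy_mult (\<lambda>z x. U' (P x) + z *\<^sub>C U' (P' x)) f"
    by (rule hardy_mult_cong[OF f]) (simp add: lin mem)
  then have "hcoeff (snd (S2 (h, f))) n = (if n = 0 then cnj q *\<^sub>C U' (P' (L h)) else 0)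
      + cnj q *\<^sub>C (cnj q ^ n *\<^sub>C (U' (P (hcoeff f n)) + delayed (\<lambda>n. U' (P' (hcoeff f n))) n))" for n
    by (simp add: schaffer2_def hcoeff_add hcoeff_scaleC hcoeff_adjoint_ev0[OF F] mem
        hcoeff_hardy_mult[OF F bounded_op_compose[OF bP bU'] bounded_op_compose[OF bP' bU'] f]
        hcoeff_hardy_rot[OF q'])
  note * = this
  show "hcoeff (snd (S2 (h, f))) 0 = cnj q *\<^sub>C U' (P' (L h) + P (hcoeff f 0))"
    by (simp add: * lin mem hcoeff_mem[OF f] scaleC_add_right)
  show "hcoeff (snd (S2 (h, f))) (Suc n)
      = cnj q ^ (n + 2) *\<^sub>C U' (P (hcoeff f (Suc n)) + P' (hcoeff f n))"
    by (simp add: * lin mem hcoeff_mem[OF f] scaleC_add_right scaleC_scaleC)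
qed

lemma S1_mem: "x \<in> UNIV \<times> hardy_space F \<Longrightarrow> S1 x \<in> UNIV \<times> hardy_space F"
  and S2_mem: "x \<in> UNIV \<times> hardy_space F \<Longrightarrow> S2 x \<in> UNIV \<times> hardy_space F"
proof -
  assume x: "x \<in> UNIV \<times> hardy_space F"
  obtain h f where hf: "x = (h, f)" "f \<in> hardy_space F" using x by auto
  have "hcoeff (snd (S1 (h, f))) n \<in> F" "hcoeff (snd (S2 (h, f))) n \<in> F" for n
    by (cases n; simp add: hcoeff_S1_0 hcoeff_S1_Suc hcoeff_S2_0 hcoeff_S2_Suc hf mem hcoeff_mem del: power_Suc)+
  then show "S1 x \<in> UNIV \<times> hardy_space F" "S2 x \<in> UNIV \<times> hardy_space F"
    by (simp_all add: hf mem_Times_iff hardy_space_iff[OF F])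
qed

lemma hardy_space_add: "f \<in> hardy_space F \<Longrightarrow> g \<in> hardy_space F \<Longrightarrow> f + g \<in> hardy_space F"
  and hardy_space_scaleC: "f \<in> hardy_space F \<Longrightarrow> c *\<^sub>C f \<in> hardy_space F"
  by (simp_all add: hardy_space_iff[OF F] hcoeff_add hcoeff_scaleC mem)

text \<open>
  Each coefficient of the image is a sum of a vector in the range of \<open>P\<close> and one in the range of \<open>P'\<close>. The
  \<open>P'\<close>-part of \<open>U f\<^sub>n\<close> stays in degree \<open>n\<close>, its \<open>P\<close>-part moves to degree \<open>n + 1\<close>, and the place that becomes
  free in degree \<open>0\<close> is taken by \<open>P U L h\<close>. For \<open>S2\<close> the roles of the two projections are exchanged.
\<close>

lemma isometry_S1:
  assumes iso: "\<And>h. (norm (T1 h))\<^sup>2 + (norm (P (U (L h))))\<^sup>2 = (norm h)\<^sup>2"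
  shows "isometry_op (UNIV \<times> hardy_space F) (UNIV \<times> hardy_space F) S1"
proof (rule isometry_opI[OF S1_mem])
  fix x y :: "'h \<times> 'f hardy" and c
  assume "x \<in> UNIV \<times> hardy_space F"
  then obtain h f where x: "x = (h, f)" and f: "f \<in> hardy_space F" by auto
  note coeff = hcoeff_S1_0[OF f] hcoeff_S1_Suc[OF f]
  show "S1 (c *\<^sub>C x) = c *\<^sub>C S1 x"
  proof (rule prod_eqI)
    show "snd (S1 (c *\<^sub>C x)) = snd (c *\<^sub>C S1 x)"
    proof (rule hardy_eqI, rule ext)
      show "hcoeff (snd (S1 (c *\<^sub>C x))) n = hcoeff (snd (c *\<^sub>C S1 x)) n" for n
        by (cases n) (simp_all add: x scaleC_prod_def hcoeff_scaleC coeff hardy_space_scaleC f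
            hcoeff_S1_0 hcoeff_S1_Suc lin mem hcoeff_mem scaleC_add_right scaleC_scaleC mult_ac
            del: power_Suc)
    qed
  qed (simp add: x scaleC_prod_def lin)
  have "(norm (snd (S1 x)))\<^sup>2 = (norm (P (U (L h))))\<^sup>2 + (norm f)\<^sup>2"
  proof (rule norm_hardy_split)
    fix n
    show "(norm (P' (U (hcoeff f n))))\<^sup>2 + (norm (P (U (hcoeff f n))))\<^sup>2 = (norm (hcoeff f n))\<^sup>2"
      using norm_orth_proj_compl[OF P F, of "U (hcoeff f n)"] hcoeff_mem[OF f, of n]
      by (simp add: mem norm_U)
    have split: "(norm (a *\<^sub>C P u + b *\<^sub>C P' v))\<^sup>2 = (norm (a *\<^sub>C P u))\<^sup>2 + (norm (b *\<^sub>C P' v))\<^sup>2"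
      if "u \<in> F" "v \<in> F" for a b u v
      using that by (intro norm_add_Pythagorean_complex)
         (simp add: cinner_scaleC_left cinner_scaleC_right cinner_orth_proj_compl[OF P F])
    show "(norm (hcoeff (snd (S1 x)) n))\<^sup>2 = (if n = 0 then (norm (P (U (L h))))\<^sup>2 else 0)
        + (norm (P' (U (hcoeff f n))))\<^sup>2 + delayed (\<lambda>n. (norm (P (U (hcoeff f n))))\<^sup>2) n"
    proof (cases n)
      case 0
      then show ?thesis
        using split[of "U (L h)" "U (hcoeff f 0)" 1 q]
        by (simp add: x coeff mem hcoeff_mem[OF f] norm_scaleC q)
    next
      case (Suc m)
      then show ?thesis
        using split[of "U (hcoeff f m)" "U (hcoeff f n)" "q ^ (m + 1)" "q ^ (m + 2)"]
        by (simp add: x coeff mem hcoeff_mem[OF f] norm_scaleC q norm_mult norm_power add.commute)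
    qed
  qed auto
  then have "(norm (S1 x))\<^sup>2 = (norm x)\<^sup>2"
    using iso[of h] by (simp add: norm_prod_square x)
  then show "norm (S1 x) = norm x" by simp
  assume "y \<in> UNIV \<times> hardy_space F"
  then obtain k g where y: "y = (k, g)" and g: "g \<in> hardy_space F" by auto
  show "S1 (x + y) = S1 x + S1 y"
  proof (rule prod_eqI)
    show "snd (S1 (x + y)) = snd (S1 x + S1 y)"
    proof (rule hardy_eqI, rule ext)
      show "hcoeff (snd (S1 (x + y))) n = hcoeff (snd (S1 x + S1 y)) n" for n
        by (cases n) (simp_all add: x y hcoeff_add coeff hardy_space_add f g hcoeff_S1_0 hcoeff_S1_Suc
            lin mem hcoeff_mem scaleC_add_right add_ac del: power_Suc)
    qed
  qed (simp add: x y lin)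
qed

lemma isometry_S2:
  assumes iso: "\<And>h. (norm (T2 h))\<^sup>2 + (norm (P' (L h)))\<^sup>2 = (norm h)\<^sup>2"
  shows "isometry_op (UNIV \<times> hardy_space F) (UNIV \<times> hardy_space F) S2"
proof (rule isometry_opI[OF S2_mem])
  fix x y :: "'h \<times> 'f hardy" and c
  assume "x \<in> UNIV \<times> hardy_space F"
  then obtain h f where x: "x = (h, f)" and f: "f \<in> hardy_space F" by auto
  note coeff = hcoeff_S2_0[OF f] hcoeff_S2_Suc[OF f]
  show "S2 (c *\<^sub>C x) = c *\<^sub>C S2 x"
  proof (rule prod_eqI)
    show "snd (S2 (c *\<^sub>C x)) = snd (c *\<^sub>C S2 x)"
    proof (rule hardy_eqI, rule ext)
      show "hcoeff (snd (S2 (c *\<^sub>C x))) n = hcoeff (snd (c *\<^sub>C S2 x)) n" for n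
        by (cases n) (simp_all add: x scaleC_prod_def hcoeff_scaleC coeff hardy_space_scaleC f
            hcoeff_S2_0 hcoeff_S2_Suc lin mem hcoeff_mem scaleC_add_right scaleC_scaleC mult_ac
            del: power_Suc)
    qed
  qed (simp add: x scaleC_prod_def lin)
  have "(norm (snd (S2 x)))\<^sup>2 = (norm (P' (L h)))\<^sup>2 + (norm f)\<^sup>2"
  proof (rule norm_hardy_split)
    fix n
    show "(norm (P (hcoeff f n)))\<^sup>2 + (norm (P' (hcoeff f n)))\<^sup>2 = (norm (hcoeff f n))\<^sup>2"
      by (rule norm_orth_proj_compl[OF P F hcoeff_mem[OF f]])
    have split: "(norm (a *\<^sub>C U' (P u + P' v)))\<^sup>2 = (norm (P u))\<^sup>2 + (norm (P' v))\<^sup>2"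
      if "u \<in> F" "v \<in> F" "norm a = 1" for a u v
      using that
      by (simp add: norm_scaleC norm_U' mem norm_add_Pythagorean_complex cinner_orth_proj_compl[OF P F])
    show "(norm (hcoeff (snd (S2 x)) n))\<^sup>2 = (if n = 0 then (norm (P' (L h)))\<^sup>2 else 0)
        + (norm (P (hcoeff f n)))\<^sup>2 + delayed (\<lambda>n. (norm (P' (hcoeff f n)))\<^sup>2) n"
    proof (cases n)
      case 0
      then show ?thesis
        using split[of "hcoeff f 0" "L h" "cnj q"]
        by (simp add: x coeff mem hcoeff_mem[OF f] q add.commute)
    next
      case (Suc m)
      then show ?thesis
        using split[of "hcoeff f n" "hcoeff f m" "cnj q ^ (m + 2)"]
        by (simp add: x coeff mem hcoeff_mem[OF f] q norm_mult norm_power)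
    qed
  qed auto
  then have "(norm (S2 x))\<^sup>2 = (norm x)\<^sup>2"
    using iso[of h] by (simp add: norm_prod_square x)
  then show "norm (S2 x) = norm x" by simp
  assume "y \<in> UNIV \<times> hardy_space F"
  then obtain k g where y: "y = (k, g)" and g: "g \<in> hardy_space F" by auto
  show "S2 (x + y) = S2 x + S2 y"
  proof (rule prod_eqI)
    show "snd (S2 (x + y)) = snd (S2 x + S2 y)"
    proof (rule hardy_eqI, rule ext)
      show "hcoeff (snd (S2 (x + y))) n = hcoeff (snd (S2 x + S2 y)) n" for n
        by (cases n) (simp_all add: x y hcoeff_add coeff hardy_space_add f g hcoeff_S2_0 hcoeff_S2_Suc
            lin mem hcoeff_mem scaleC_add_right add_ac del: power_Suc)
    qed
  qed (simp add: x y lin)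
qed

text \<open>
  Both products of the block operators are, up to the factor \<open>q\<close>, the lower triangular operator with
  diagonal \<open>T\<^sub>1 T\<^sub>2\<close>, \<open>M\<^sub>z\<close> and corner \<open>\<Lambda> D\<^sub>T\<close>.
\<close>

lemma S1_S2_commute:
  assumes T: "\<And>h. T1 (T2 h) = q *\<^sub>C T2 (T1 h)"
    and rel1: "\<And>h. P (U (L (T2 h))) + P' (L h) = L h"
    and rel2: "\<And>h. P' (L (T1 h)) + P (U (L h)) = U (L h)"
    and x: "x \<in> UNIV \<times> hardy_space F"
  shows "S1 (S2 x) = q *\<^sub>C S2 (S1 x)"
proof -
  obtain h f where hf: "x = (h, f)" and f: "f \<in> hardy_space F" using x by auto
  define e where "e = snd (S1 x)"
  define g where "g = snd (S2 x)"
  have S1: "S1 x = (T1 h, e)" and S2: "S2 x = (T2 h, g)"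
    by (simp_all add: prod_eq_iff e_def g_def hf)
  have e: "e \<in> hardy_space F" and g: "g \<in> hardy_space F"
    using S1_mem[OF x] S2_mem[OF x] by (simp_all add: S1 S2)
  note fm = hcoeff_mem[OF f]
  note q1 = unimodular_power[OF q]
  have e0: "hcoeff e 0 = P (U (L h)) + q *\<^sub>C P' (U (hcoeff f 0))"
    and eS: "hcoeff e (Suc n) = q ^ (n + 2) *\<^sub>C P' (U (hcoeff f (Suc n))) + q ^ (n + 1) *\<^sub>C P (U (hcoeff f n))" for n
    using hcoeff_S1_0[OF f] hcoeff_S1_Suc[OF f] by (simp_all add: e_def hf)
  have g0: "U (hcoeff g 0) = cnj q *\<^sub>C (P' (L h) + P (hcoeff f 0))"
    and gS: "U (hcoeff g (Suc n)) = cnj q ^ (n + 2) *\<^sub>C (P (hcoeff f (Suc n)) + P' (hcoeff f n))" for n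
    using hcoeff_S2_0[OF f] hcoeff_S2_Suc[OF f]
    by (simp_all add: g_def hf lin mem fm UU' del: power_Suc)
  have Pg: "P (U (hcoeff g n)) = cnj q ^ (n + 1) *\<^sub>C P (hcoeff f n)" for n
    by (cases n) (simp_all add: g0 gS lin mem fm proj)
  have Pe: "P' (hcoeff e n) = q ^ (n + 1) *\<^sub>C P' (U (hcoeff f n))" for n
    by (cases n) (simp_all add: e0 eS lin mem fm proj)
  have PP: "P' y + P y = y" "P y + P' y = y" for y by (simp_all add: compl_op_def)
  have 12: "hcoeff (snd (S1 (S2 x))) 0 = L h" "hcoeff (snd (S1 (S2 x))) (Suc n) = hcoeff f n" for n
  proof -
    show "hcoeff (snd (S1 (S2 x))) 0 = L h"
      using rel1[of h] by (simp add: S2 hcoeff_S1_0[OF g] g0 lin mem fm proj scaleC_scaleC q1)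
    have "q ^ (n + 2) * cnj q ^ (n + 2) = 1" "q ^ (n + 1) * cnj q ^ (n + 1) = 1"
      by (rule q1)+
    then show "hcoeff (snd (S1 (S2 x))) (Suc n) = hcoeff f n"
      by (simp add: S2 hcoeff_S1_Suc[OF g] Pg gS lin mem fm proj scaleC_scaleC PP del: power_Suc power_add)
  qed
  have 21: "hcoeff (snd (S2 (S1 x))) 0 = cnj q *\<^sub>C L h"
    "hcoeff (snd (S2 (S1 x))) (Suc n) = cnj q *\<^sub>C hcoeff f n" for n
  proof -
    show "hcoeff (snd (S2 (S1 x))) 0 = cnj q *\<^sub>C L h"
      using rel2[of h] by (simp add: S1 hcoeff_S2_0[OF e] e0 lin[of _ "_"] mem fm proj lin(3,7) U'U)
    have "P (hcoeff e (Suc n)) = q ^ (n + 1) *\<^sub>C P (U (hcoeff f n))"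
      by (simp add: eS lin mem fm proj)
    then have "P (hcoeff e (Suc n)) + P' (hcoeff e n) = q ^ (n + 1) *\<^sub>C U (hcoeff f n)"
      by (simp add: Pe scaleC_add_right[symmetric] PP del: power_Suc)
    moreover have "cnj q ^ (n + 2) * q ^ (n + 1) = cnj q"
      using q1(4)[of "n + 1"] by (simp add: mult.assoc)
    ultimately show "hcoeff (snd (S2 (S1 x))) (Suc n) = cnj q *\<^sub>C hcoeff f n"
      by (simp add: S1 hcoeff_S2_Suc[OF e] lin mem fm U'U scaleC_scaleC del: power_Suc)
  qed
  show ?thesis
  proof (rule prod_eqI)
    show "fst (S1 (S2 x)) = fst (q *\<^sub>C S2 (S1 x))" by (simp add: S1 S2 T scaleC_prod_def)
    show "snd (S1 (S2 x)) = snd (q *\<^sub>C S2 (S1 x))"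
    proof (rule hardy_eqI, rule ext)
      show "hcoeff (snd (S1 (S2 x))) n = hcoeff (snd (q *\<^sub>C S2 (S1 x))) n" for n
        by (cases n) (simp_all add: scaleC_prod_def hcoeff_scaleC 12 21 scaleC_scaleC q1)
    qed
  qed
qed

text \<open>
  The first columns are isometric by \<open>iso1\<close> and \<open>iso2\<close>, and \<open>rel1\<close> and \<open>rel2\<close> make the corners of the two
  products agree up to \<open>q\<close>. The adjoints map \<open>(h, 0)\<close> as required since the matrices are lower triangular.
\<close>

lemma schaffer_lift:
  assumes T: "\<And>h. T1 (T2 h) = q *\<^sub>C T2 (T1 h)"
    and iso1: "\<And>h. (norm (T1 h))\<^sup>2 + (norm (P (U (L h))))\<^sup>2 = (norm h)\<^sup>2"
    and iso2: "\<And>h. (norm (T2 h))\<^sup>2 + (norm (P' (L h)))\<^sup>2 = (norm h)\<^sup>2"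
    and rel1: "\<And>h. P (U (L (T2 h))) + P' (L h) = L h"
    and rel2: "\<And>h. P' (L (T1 h)) + P (U (L h)) = U (L h)"
  shows "q_commuting q (UNIV \<times> hardy_space F) S1 S2
    \<and> isometric_lift T1 T2 (UNIV \<times> hardy_space F) (\<lambda>h. (h, 0)) S1 S2"
proof -
  let ?K = "UNIV \<times> hardy_space F :: ('h \<times> 'f hardy) set"
  note i1 = isometry_S1[OF iso1] and i2 = isometry_S2[OF iso2]
  have H: "closed_csubspace (hardy_space F)" by (rule closed_csubspace_hardy_space[OF F])
  have K: "closed_csubspace ?K" by (rule closed_csubspace_Times[OF closed_csubspace_UNIV H])
  have J: "isometry_op UNIV ?K (\<lambda>h. (h, 0))"
    by (rule isometry_opI) (auto simp: scaleC_prod_def norm_prod_def closed_csubspace_0[OF H])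
  have adj: "adjoint_op ?K ?K S (h, 0) = (adjoint_op UNIV UNIV T h, 0)"
    if T: "bounded_op UNIV UNIV T" and S: "\<And>k f. fst (S (k, f)) = T k" for S T h
    by (rule adjoint_op_eqI[OF K])
       (auto simp: closed_csubspace_0[OF H] cinner_prod_def S cinner_adjoint_op[OF T])
  show ?thesis
    unfolding q_commuting_def isometric_lift_def
    using K J i1 i2 adj[OF bT1, of S1] adj[OF bT2, of S2] isometry_op_bounded[OF i1] isometry_op_bounded[OF i2]
      S1_S2_commute[OF T rel1 rel2]
    by simp
qed

end

text \<open>
  Here \<open>L h = (D\<^sub>1 T\<^sub>2 h, D\<^sub>2 h, 0)\<close>, \<open>U L h = (D\<^sub>1 h, D\<^sub>2 T\<^sub>1 h, 0)\<close> and \<open>P\<close> keeps the first coordinate. So the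
  columns are isometric by the definition of the defect operators \<open>D\<^sub>1\<close>, \<open>D\<^sub>2\<close> of \<open>T\<^sub>1\<close>, \<open>T\<^sub>2\<close>, and the two
  relations are read off coordinatewise.
\<close>

lemma special_ando_tuple_lift:
  fixes T1 T2 :: "'h::complex_hilbert \<Rightarrow> 'h"
  assumes q: "norm q = 1" and T1: "contraction_op T1" and T2: "contraction_op T2"
    and comm: "\<And>h. T1 (T2 h) = q *\<^sub>C T2 (T1 h)" and tuple: "special_ando_tuple T1 T2 F \<Lambda> P U"
  shows "q_commuting q (UNIV \<times> hardy_space F)
      (schaffer1 q T1 T2 F \<Lambda> P U) (schaffer2 q T1 T2 F \<Lambda> P U)
    \<and> isometric_lift T1 T2 (UNIV \<times> hardy_space F) (\<lambda>h. (h, 0))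
      (schaffer1 q T1 T2 F \<Lambda> P U) (schaffer2 q T1 T2 F \<Lambda> P U)"
proof -
  obtain E where E: "E = {0} \<or> E = UNIV" and FE: "F = defect_space T1 \<times> defect_space T2 \<times> E"
    and \<Lambda>i: "isometry_op (defect_space (T1 \<circ> T2)) F \<Lambda>" and U: "unitary_op F F U"
    and P: "orth_proj_op F P" and PF: "P ` F = defect_space T1 \<times> {0} \<times> {0}"
    and "\<forall>h. \<Lambda> (defect_op (T1 \<circ> T2) h) = (defect_op T1 (T2 h), defect_op T2 h, 0)"
    and "\<forall>h. U (defect_op T1 (T2 h), defect_op T2 h, 0) = (defect_op T1 h, defect_op T2 (T1 h), 0)"
    using tuple unfolding special_ando_tuple_def by (elim exE conjE) (rule that)
  then have \<Lambda>D: "\<Lambda> (defect_op (T1 \<circ> T2) h) = (defect_op T1 (T2 h), defect_op T2 h, 0)"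
    and U\<Lambda>: "U (defect_op T1 (T2 h), defect_op T2 h, 0) = (defect_op T1 h, defect_op T2 (T1 h), 0)" for h
    by simp_all
  have "closed_csubspace E" using E by (auto simp: closed_csubspace_def complex_vector.subspace_single_0)
  then have F: "closed_csubspace F"
    unfolding FE by (intro closed_csubspace_Times closed_csubspace_defect_space T1 T2)
  interpret schaffer_model q T1 T2 F \<Lambda> P U
    by standard (use q T1 T2 F \<Lambda>i U P in \<open>auto simp: ando_tuple_def\<close>)
  \<comment> \<open>\<open>P\<close> is given only by its range: the first coordinates of \<open>x\<close> and \<open>P x\<close> agree because
      \<open>x - P x\<close> is orthogonal to that range.\<close>
  have Peq: "P (a, b, c) = (a, 0, 0)" if abc: "(a, b, c) \<in> F" for a b c
  proof -
    have "P (a, b, c) \<in> defect_space T1 \<times> {0} \<times> {0}" using PF abc by blast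
    then obtain a' where a': "P (a, b, c) = (a', 0, 0)" "a' \<in> defect_space T1" by auto
    have "a = a'"
    proof (rule cinner_ext[OF closed_csubspace_subspace[OF closed_csubspace_defect_space[OF T1]]])
      show "a \<in> defect_space T1" "a' \<in> defect_space T1" using abc a' by (auto simp: FE)
      fix w assume w: "w \<in> defect_space T1"
      then have "(w, 0, 0) \<in> P ` F" by (simp add: PF)
      then obtain u where u: "u \<in> F" "P u = (w, 0, 0)" by auto
      show "cinner w a = cinner w a'"
        using cinner_orth_proj_compl[OF P F u(1) abc] u(2) a'(1)
        by (simp add: compl_op_def cinner_prod_def cinner_diff_right)
    qed
    then show ?thesis using a' by simp
  qed
  have L: "L h = (defect_op T1 (T2 h), defect_op T2 h, 0)" for h by (simp add: \<Lambda>D)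
  have PL: "P (L h) = (defect_op T1 (T2 h), 0, 0)" "P (U (L h)) = (defect_op T1 h, 0, 0)" for h
    using Peq mem(5)[of h] mem(1)[OF mem(5)[of h]] by (simp_all add: L U\<Lambda>)
  show ?thesis
  proof (rule schaffer_lift[OF comm])
    fix h
    show "(norm (T1 h))\<^sup>2 + (norm (P (U (L h))))\<^sup>2 = (norm h)\<^sup>2"
      by (simp add: PL norm_prod_square norm_defect_op[OF T1])
    show "(norm (T2 h))\<^sup>2 + (norm (P' (L h)))\<^sup>2 = (norm h)\<^sup>2"
      by (simp add: compl_op_def PL) (simp add: L norm_prod_square norm_defect_op[OF T2])
    show "P (U (L (T2 h))) + P' (L h) = L h"
      by (simp add: compl_op_def PL)
    show "P' (L (T1 h)) + P (U (L h)) = U (L h)"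
      by (simp add: compl_op_def PL) (simp add: L U\<Lambda>)
  qed
qed

section \<open>Pure q-commuting isometries\<close>

text \<open>
  The analogue of the Berger-Coburn-Lebow model. For a pair of q-commuting isometries on \<open>M\<close> with product
  \<open>S = W\<^sub>1 W\<^sub>2 = q W\<^sub>2 W\<^sub>1\<close>, the wandering subspace \<open>F = ker S\<^sup>*\<close> splits in two ways,
  \<open>F = ker W\<^sub>2\<^sup>* \<oplus> W\<^sub>2 ker W\<^sub>1\<^sup>* = W\<^sub>1 ker W\<^sub>2\<^sup>* \<oplus> ker W\<^sub>1\<^sup>*\<close>.
  The unitary \<open>U\<close> takes \<open>x + W\<^sub>2 p\<close> of the first splitting to \<open>q\<^sup>-\<^sup>1 (W\<^sub>1 x + p)\<close> in the second one, and \<open>P\<close>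
  projects onto \<open>ker W\<^sub>1\<^sup>*\<close>. In the formulas below \<open>p = W\<^sub>2\<^sup>* y\<close> is the second component of
  \<open>y \<in> F\<close>, and \<open>x = y - W\<^sub>2 W\<^sub>2\<^sup>* y\<close>. Further \<open>A = S\<^sup>*\<close>, \<open>V\<close> is the inverse of \<open>U\<close> on \<open>F\<close>, and \<open>E\<close> is the
  projection of \<open>M\<close> onto \<open>F\<close>.
\<close>

locale q_commuting_isometries =
  fixes q :: complex and M :: "'k::complex_hilbert set" and W1 W2 :: "'k \<Rightarrow> 'k"
  assumes q: "norm q = 1" and M: "closed_csubspace M"
    and W1: "isometry_op M M W1" and W2: "isometry_op M M W2"
    and comm: "x \<in> M \<Longrightarrow> W1 (W2 x) = q *\<^sub>C W2 (W1 x)"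
begin

abbreviation A1 where "A1 \<equiv> adjoint_op M M W1"
abbreviation A2 where "A2 \<equiv> adjoint_op M M W2"

definition S where "S x = W1 (W2 x)"
definition A where "A x = A2 (A1 x)"
definition E where "E x = x - S (A x)"
definition F where "F = {x \<in> M. A x = 0}"
definition P where "P x = x - W1 (A1 x)"
definition U where "U x = cnj q *\<^sub>C (W1 (x - W2 (A2 x)) + A2 x)"
definition V where "V x = q *\<^sub>C (A1 x + W2 (x - W1 (A1 x)))"

lemma qq: "q * cnj q = 1" "cnj q * q = 1"
  using complex_norm_square[of q] q by (simp_all add: mult.commute)

lemmas bW1 = isometry_op_bounded[OF W1] and bW2 = isometry_op_bounded[OF W2]
lemmas bA1 = bounded_op_adjoint_op[OF bW1 M] and bA2 = bounded_op_adjoint_op[OF bW2 M]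

lemmas mem = bounded_op_mem[OF bW1] bounded_op_mem[OF bW2] bounded_op_mem[OF bA1 UNIV_I]
  bounded_op_mem[OF bA2 UNIV_I] closed_csubspace_add[OF M] closed_csubspace_diff[OF M]
  closed_csubspace_scaleC[OF M] closed_csubspace_0[OF M]

lemmas lin = bounded_op_add[OF bW1] bounded_op_add[OF bW2] bounded_op_scaleC[OF bW1]
  bounded_op_scaleC[OF bW2] bounded_op_diff[OF bW1 M] bounded_op_diff[OF bW2 M]
  bounded_op_add[OF bA1 UNIV_I UNIV_I] bounded_op_add[OF bA2 UNIV_I UNIV_I]
  bounded_op_scaleC[OF bA1 UNIV_I] bounded_op_scaleC[OF bA2 UNIV_I]
  bounded_op_diff[OF bA1 closed_csubspace_UNIV UNIV_I UNIV_I]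
  bounded_op_diff[OF bA2 closed_csubspace_UNIV UNIV_I UNIV_I]
  bounded_op_zero[OF bW1 M] bounded_op_zero[OF bW2 M]
  bounded_op_zero[OF bA1 closed_csubspace_UNIV] bounded_op_zero[OF bA2 closed_csubspace_UNIV]

lemmas A1W1 [simp] = adjoint_isometry[OF W1 M] and A2W2 [simp] = adjoint_isometry[OF W2 M]

lemma comm': "x \<in> M \<Longrightarrow> W2 (W1 x) = cnj q *\<^sub>C W1 (W2 x)"
  by (simp add: comm scaleC_scaleC qq)

lemma A1_A2: "A1 (A2 x) = q *\<^sub>C A2 (A1 x)"
proof (rule cinner_ext[OF closed_csubspace_subspace[OF M]])
  fix a assume a: "a \<in> M"
  have "cinner a (A1 (A2 x)) = cinner (W2 (W1 a)) x"
    using a by (simp add: cinner_adjoint_op[OF bW1 M, symmetric] cinner_adjoint_op[OF bW2 M, symmetric] mem)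
  also have "\<dots> = cinner a (q *\<^sub>C A2 (A1 x))"
    using a by (simp add: cinner_adjoint_op[OF bW1 M, symmetric] cinner_adjoint_op[OF bW2 M, symmetric]
        mem comm' cinner_scaleC_left cinner_scaleC_right)
  finally show "cinner a (A1 (A2 x)) = cinner a (q *\<^sub>C A2 (A1 x))" .
qed (simp_all add: mem)

lemma S_eq: "x \<in> M \<Longrightarrow> S x = q *\<^sub>C W2 (W1 x)"
  by (simp add: S_def comm)

lemma bS: "bounded_op M M S"
  unfolding S_def[abs_def] by (rule bounded_op_compose[OF bW2 bW1])

lemma bA: "bounded_op UNIV M A"
  unfolding A_def[abs_def]
  by (rule bounded_op_compose[OF bA1 bounded_op_restrict[OF bA2 subset_UNIV]])

lemmas mem' = bounded_op_mem[OF bS] bounded_op_mem[OF bA UNIV_I]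
lemmas lin' = bounded_op_add[OF bS] bounded_op_scaleC[OF bS] bounded_op_diff[OF bS M]
  bounded_op_add[OF bA UNIV_I UNIV_I] bounded_op_scaleC[OF bA UNIV_I]
  bounded_op_diff[OF bA closed_csubspace_UNIV UNIV_I UNIV_I]
  bounded_op_zero[OF bS M] bounded_op_zero[OF bA closed_csubspace_UNIV]

lemma isometry_S: "isometry_op M M S"
  using bS isometry_op_norm[OF W1] isometry_op_norm[OF W2] by (simp add: isometry_op_def S_def mem)

lemma cinner_S: "x \<in> M \<Longrightarrow> cinner (S x) y = cinner x (A y)"
  by (simp add: S_def A_def cinner_adjoint_op[OF bW1 M] cinner_adjoint_op[OF bW2 M] mem)

text \<open>
  All of these come from \<open>S = W\<^sub>1 W\<^sub>2 = q W\<^sub>2 W\<^sub>1\<close> and \<open>S\<^sup>* = W\<^sub>2\<^sup>* W\<^sub>1\<^sup>* = q\<^sup>-\<^sup>1 W\<^sub>1\<^sup>* W\<^sub>2\<^sup>*\<close>.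
\<close>

lemma
  assumes x: "x \<in> M"
  shows A_S [simp]: "A (S x) = x" and A_W1: "A (W1 x) = A2 x" and A_W2: "A (W2 x) = cnj q *\<^sub>C A1 x"
    and A1_S: "A1 (S x) = W2 x" and A2_S: "A2 (S x) = q *\<^sub>C W1 x"
    and S_W1: "S (W1 x) = cnj q *\<^sub>C W1 (S x)" and S_W2: "S (W2 x) = q *\<^sub>C W2 (S x)"
    and A_A1: "A (A1 x) = cnj q *\<^sub>C A1 (A x)" and A_A2: "A (A2 x) = q *\<^sub>C A2 (A x)"
proof -
  have A_eq: "A y = cnj q *\<^sub>C A1 (A2 y)" for y by (simp add: A_def A1_A2 scaleC_scaleC qq)
  show "A (S x) = x" "A (W1 x) = A2 x" using x by (simp_all add: A_def S_def mem)
  show "A (W2 x) = cnj q *\<^sub>C A1 x" using x by (simp add: A_eq)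
  show "A1 (S x) = W2 x" using x by (simp add: S_def mem)
  show "A2 (S x) = q *\<^sub>C W1 x" using x by (simp add: S_eq mem lin)
  show "S (W1 x) = cnj q *\<^sub>C W1 (S x)" using x by (simp add: S_def mem lin comm')
  show "S (W2 x) = q *\<^sub>C W2 (S x)" using x by (simp add: S_def mem comm)
  show "A (A1 x) = cnj q *\<^sub>C A1 (A x)" "A (A2 x) = q *\<^sub>C A2 (A x)"
    by (simp_all add: A_def A1_A2 lin scaleC_scaleC qq)
qed

lemma F_subset: "x \<in> F \<Longrightarrow> x \<in> M"
  and F_kernel: "x \<in> F \<Longrightarrow> A x = 0" "x \<in> F \<Longrightarrow> A2 (A1 x) = 0" "x \<in> F \<Longrightarrow> A1 (A2 x) = 0"
  by (simp_all add: F_def A_def A1_A2)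

lemma F: "closed_csubspace F"
  unfolding closed_csubspace_def complex_vector.subspace_def
proof (intro conjI ballI allI)
  have "F = M \<inter> {x. A x = 0}" by (auto simp: F_def)
  moreover have "closed {x. A x = 0}"
    using bounded_linear.continuous_on[OF bounded_linear_UNIV[OF bA] continuous_on_id]
    by (intro closed_Collect_eq continuous_on_const) auto
  ultimately show "closed F" using M by (auto simp: closed_csubspace_def)
qed (auto simp: F_def mem lin')

lemma P: "orth_proj_op F P"
  unfolding orth_proj_op_def
proof (intro conjI ballI)
  have "bounded_op UNIV M (\<lambda>x. W1 (A1 x))" by (rule bounded_op_compose[OF bA1 bW1])
  then have "bounded_op M M P"
    unfolding P_def[abs_def]
    by (rule bounded_op_diff_fun[OF bounded_op_id bounded_op_restrict[OF _ subset_UNIV] M])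
  moreover have "P x \<in> F" if "x \<in> F" for x
    using that F_subset[OF that] F_kernel[OF that] by (simp add: F_def P_def mem lin' A_W1)
  moreover have "F \<subseteq> M" by (auto simp: F_def)
  ultimately show "bounded_op F F P" unfolding bounded_op_def by blast
  show "P (P x) = P x" if "x \<in> F" for x using F_subset[OF that] by (simp add: P_def mem lin)
  show "cinner (P x) y = cinner x (P y)" if "x \<in> F" "y \<in> F" for x y
    using that F_subset
    by (simp add: P_def cinner_diff_left cinner_diff_right cinner_adjoint_op[OF bW1 M]
        cinner_adjoint_op'[OF bW1 M, symmetric] mem)
qed

text \<open>
  The two components of \<open>x \<in> F\<close> are orthogonal, and so are their images, because \<open>W\<^sub>1\<^sup>* W\<^sub>2\<^sup>* x = 0\<close>.
\<close>

lemma U_mem: "x \<in> F \<Longrightarrow> U x \<in> F"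
  and norm_U: "x \<in> F \<Longrightarrow> norm (U x) = norm x"
proof -
  assume x: "x \<in> F"
  note xM = F_subset[OF x] and k = F_kernel[OF x]
  show "U x \<in> F" using xM k by (simp add: F_def U_def mem lin' A_W1 lin A_A2)
  have "cinner (W1 (x - W2 (A2 x))) (A2 x) = 0"
    using xM k by (simp add: cinner_adjoint_op[OF bW1 M] mem)
  from norm_add_Pythagorean_complex[OF this]
  have 1: "(norm (U x))\<^sup>2 = (norm (x - W2 (A2 x)))\<^sup>2 + (norm (A2 x))\<^sup>2"
    using q xM by (simp add: U_def norm_scaleC isometry_op_norm[OF W1] mem)
  have "cinner (x - W2 (A2 x)) (W2 (A2 x)) = 0"
    using xM by (intro cinner_orth_sym[of "W2 (A2 x)"])
       (simp add: cinner_adjoint_op[OF bW2 M] mem lin)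
  from norm_add_Pythagorean_complex[OF this]
  have "(norm x)\<^sup>2 = (norm (x - W2 (A2 x)))\<^sup>2 + (norm (A2 x))\<^sup>2"
    by (simp add: isometry_op_norm[OF W2] mem)
  with 1 show "norm (U x) = norm x" by (metis norm_ge_zero power2_eq_imp_eq)
qed

lemma V_mem: "x \<in> F \<Longrightarrow> V x \<in> F" and UV: "x \<in> F \<Longrightarrow> U (V x) = x"
proof -
  assume x: "x \<in> F"
  note xM = F_subset[OF x] and k = F_kernel[OF x]
  show "V x \<in> F" using xM k by (simp add: F_def V_def mem lin' A_W2 lin A_A1)
  have A2V: "A2 (V x) = q *\<^sub>C (x - W1 (A1 x))" using xM k by (simp add: V_def mem lin)
  have "V x - W2 (A2 (V x)) = q *\<^sub>C A1 x"
    unfolding A2V using xM by (simp add: V_def mem lin scaleC_add_right)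
  then show "U (V x) = x"
    using xM by (simp add: U_def A2V mem lin scaleC_add_right[symmetric] scaleC_scaleC qq)
qed

lemma U: "unitary_op F F U"
  unfolding unitary_op_def
proof
  show "isometry_op F F U"
  proof (rule isometry_opI[OF U_mem _ _ norm_U])
    fix x y c assume "x \<in> F"
    note xM = F_subset[OF this]
    show "U (c *\<^sub>C x) = c *\<^sub>C U x"
      using xM by (simp add: U_def mem lin scaleC_add_right scaleC_scaleC
          complex_vector.scale_right_diff_distrib mult_ac)
    assume "y \<in> F"
    note yM = F_subset[OF this]
    show "U (x + y) = U x + U y"
      using xM yM by (simp add: U_def mem lin scaleC_add_right
          complex_vector.scale_right_diff_distrib algebra_simps)
  qed
  show "U ` F = F" using U_mem V_mem UV by (auto simp: image_iff) metis
qed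

lemma adjoint_U: "x \<in> F \<Longrightarrow> adjoint_op F F U x = V x"
  using adjoint_isometry[OF _ F V_mem, of F U x] U UV by (simp add: unitary_op_def)

lemma E_mem: "x \<in> M \<Longrightarrow> E x \<in> F"
  by (simp add: F_def E_def mem mem' lin')

lemma bE: "bounded_op M F E"
proof -
  have "bounded_op M M (\<lambda>x. S (A x))"
    by (rule bounded_op_compose[OF bounded_op_restrict[OF bA subset_UNIV] bS])
  then have "bounded_op M M E"
    unfolding E_def[abs_def] by (rule bounded_op_diff_fun[OF bounded_op_id _ M])
  then show ?thesis using E_mem unfolding bounded_op_def by blast
qed

lemmas linE = bounded_op_add[OF bE] bounded_op_scaleC[OF bE] bounded_op_zero[OF bE M]

lemma E_ident: "x \<in> F \<Longrightarrow> E x = x" by (simp add: E_def F_kernel lin')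
lemma E_S: "x \<in> M \<Longrightarrow> E (S x) = 0" by (simp add: E_def)

lemma norm_E: "x \<in> M \<Longrightarrow> (norm (E x))\<^sup>2 = (norm x)\<^sup>2 - (norm (A x))\<^sup>2"
proof -
  assume x: "x \<in> M"
  have "cinner (S (A x)) (E x) = 0" using x by (simp add: E_def cinner_S mem' lin')
  from norm_add_Pythagorean_complex[OF this] show ?thesis
    by (simp add: E_def isometry_op_norm[OF isometry_S] mem')
qed

lemma
  assumes e: "e \<in> F"
  shows P'U: "compl_op P (U e) = cnj q *\<^sub>C (W1 e - S (A2 e))" and PU: "P (U e) = cnj q *\<^sub>C A2 e"
    and VP: "V (P e) = q *\<^sub>C W2 e - S (A1 e)" and VP': "V (compl_op P e) = q *\<^sub>C A1 e"
proof -
  note eM = F_subset[OF e] and k = F_kernel[OF e]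
  have *: "A1 (U e) = cnj q *\<^sub>C (e - W2 (A2 e))" using eM k by (simp add: U_def mem lin)
  show "compl_op P (U e) = cnj q *\<^sub>C (W1 e - S (A2 e))"
    using eM by (simp add: compl_op_def P_def * mem lin S_def)
  show "P (U e) = cnj q *\<^sub>C A2 e"
    using eM by (simp add: P_def * mem lin) (simp add: U_def mem lin scaleC_add_right)
  have "A1 (P e) = 0" using eM by (simp add: P_def mem lin)
  then show "V (P e) = q *\<^sub>C W2 e - S (A1 e)"
    using eM by (simp add: V_def lin) (simp add: P_def mem lin complex_vector.scale_right_diff_distrib S_eq)
  show "V (compl_op P e) = q *\<^sub>C A1 e"
    using eM by (simp add: V_def compl_op_def P_def mem lin)
qed

text \<open>
  The next four identities are the coefficient formulas of the block matrices in disguise. They follow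
  by expanding \<open>E y = y - S (A y)\<close> and moving \<open>S\<close> to the left past \<open>W\<^sub>1\<close>, \<open>W\<^sub>2\<close> and their adjoints.
\<close>

lemma E_W1: "y \<in> M \<Longrightarrow> E (W1 y) = q *\<^sub>C compl_op P (U (E y))"
proof -
  assume y: "y \<in> M"
  have "q *\<^sub>C compl_op P (U (E y)) = W1 (E y) - S (A2 (E y))"
    by (simp add: P'U[OF E_mem[OF y]] scaleC_scaleC qq)
  also have "\<dots> = W1 y - S (A2 y)"
    using y by (simp add: E_def mem mem' lin lin' A2_S S_W1 scaleC_scaleC qq)
  finally show ?thesis using y by (simp add: E_def[of "W1 y"] A_W1)
qed

lemma E_A2: "y \<in> M \<Longrightarrow> E (A2 y) = q\<^sup>2 *\<^sub>C compl_op P (U (E (A y))) + q *\<^sub>C P (U (E y))"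
proof -
  assume y: "y \<in> M"
  have "q\<^sup>2 *\<^sub>C compl_op P (U (E (A y))) = q *\<^sub>C E (W1 (A y))"
    by (simp add: E_W1 mem' scaleC_scaleC power2_eq_square)
  also have "\<dots> = q *\<^sub>C W1 (A y) - q *\<^sub>C S (A2 (A y))"
    by (simp add: E_def A_W1 mem' complex_vector.scale_right_diff_distrib)
  finally have 1: "q\<^sup>2 *\<^sub>C compl_op P (U (E (A y))) = q *\<^sub>C W1 (A y) - q *\<^sub>C S (A2 (A y))" .
  have 2: "q *\<^sub>C P (U (E y)) = A2 y - q *\<^sub>C W1 (A y)"
    using y by (simp add: PU[OF E_mem[OF y]] scaleC_scaleC qq) (simp add: E_def mem' lin A2_S)
  show ?thesis unfolding 1 2 using y by (simp add: E_def A_A2 lin' mem mem')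
qed

lemma E_W2: "y \<in> M \<Longrightarrow> E (W2 y) = cnj q *\<^sub>C V (P (E y))"
proof -
  assume y: "y \<in> M"
  have "cnj q *\<^sub>C V (P (E y)) = W2 (E y) - cnj q *\<^sub>C S (A1 (E y))"
    by (simp add: VP[OF E_mem[OF y]] complex_vector.scale_right_diff_distrib scaleC_scaleC qq)
  also have "\<dots> = W2 y - cnj q *\<^sub>C S (A1 y)"
    using y by (simp add: E_def mem mem' lin lin' A1_S S_W2 complex_vector.scale_right_diff_distrib scaleC_scaleC qq)
  finally show ?thesis using y by (simp add: E_def[of "W2 y"] A_W2 lin' mem)
qed

lemma E_A1: "y \<in> M \<Longrightarrow> E (A1 y) = cnj q *\<^sub>C (V (P (E (A y))) + V (compl_op P (E y)))"
proof -
  assume y: "y \<in> M"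
  have 1: "cnj q *\<^sub>C V (P (E (A y))) = W2 (A y) - cnj q *\<^sub>C S (A1 (A y))"
    by (subst E_W2[symmetric]) (simp_all add: mem' E_def A_W2 lin' mem)
  have 2: "cnj q *\<^sub>C V (compl_op P (E y)) = A1 y - W2 (A y)"
    using y by (simp add: VP'[OF E_mem[OF y]] scaleC_scaleC qq) (simp add: E_def mem' lin A1_S)
  show ?thesis unfolding scaleC_add_right 1 2 using y by (simp add: E_def A_A1 lin' mem mem')
qed

lemma bS_pow: "isometry_op M M (S ^^ n)"
proof (induction n)
  case 0
  show ?case by (rule isometry_opI) auto
next
  case (Suc n)
  then show ?case
    using bounded_op_compose[OF isometry_op_bounded[OF Suc] bS] isometry_op_norm[OF isometry_S]
    by (auto simp: isometry_op_def comp_def bounded_op_mem)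
qed

lemma bA_pow: "bounded_op M M (A ^^ n)"
proof (induction n)
  case 0
  show ?case by (simp add: id_def bounded_op_id)
next
  case (Suc n)
  then show ?case
    using bounded_op_compose[OF Suc bounded_op_restrict[OF bA subset_UNIV]] by (simp add: comp_def)
qed

lemmas S_pow_mem = bounded_op_mem[OF isometry_op_bounded[OF bS_pow]]
lemmas A_pow_mem = bounded_op_mem[OF bA_pow]

lemma cinner_S_pow: "x \<in> M \<Longrightarrow> cinner ((S ^^ n) x) y = cinner x ((A ^^ n) y)"
proof (induction n arbitrary: y)
  case (Suc n)
  then show ?case by (simp add: cinner_S S_pow_mem) (simp add: funpow_swap1)
qed simp

lemma A_S_pow: "x \<in> M \<Longrightarrow> (A ^^ n) ((S ^^ n) x) = x"
proof (induction n)
  case (Suc n)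
  then show ?case by (simp add: funpow_swap1[of A] S_pow_mem)
qed simp

lemma norm_diff_S_A_pow:
  assumes x: "x \<in> M"
  shows "(norm (x - (S ^^ n) ((A ^^ n) x)))\<^sup>2 = (norm x)\<^sup>2 - (norm ((A ^^ n) x))\<^sup>2"
proof -
  have "cinner ((S ^^ n) ((A ^^ n) x)) (x - (S ^^ n) ((A ^^ n) x)) = 0"
    using x by (simp add: cinner_S_pow A_pow_mem bounded_op_diff[OF bA_pow M] S_pow_mem A_S_pow)
  from norm_add_Pythagorean_complex[OF this] show ?thesis
    using x by (simp add: isometry_op_norm[OF bS_pow] A_pow_mem)
qed

text \<open>
  The projections \<open>S\<^sup>n S\<^sup>*\<^sup>n\<close> decrease, so the vectors \<open>S\<^sup>n S\<^sup>*\<^sup>n x\<close> converge. Their limit is fixed by each of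
  the projections, hence lies in the range of every power of \<open>S\<close> and must be \<open>0\<close>.
\<close>

lemma A_pow_tendsto_0:
  assumes pure: "\<And>x. x \<in> M \<Longrightarrow> \<forall>n. x \<in> (S ^^ n) ` M \<Longrightarrow> x = 0" and x: "x \<in> M"
  shows "(\<lambda>n. (A ^^ n) x) \<longlonglongrightarrow> 0"
proof -
  define y where "y n = (S ^^ n) ((A ^^ n) x)" for n
  define a where "a n = (norm ((A ^^ n) x))\<^sup>2" for n
  have yM: "y n \<in> M" for n using x by (simp add: y_def S_pow_mem A_pow_mem)
  have dist: "(norm (y n - y (n + k)))\<^sup>2 = a n - a (n + k)" for n k
  proof -
    have Ak: "(A ^^ (n + k)) x = (A ^^ k) ((A ^^ n) x)"
      by (subst add.commute) (simp add: funpow_add)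
    have "y (n + k) = (S ^^ n) ((S ^^ k) ((A ^^ k) ((A ^^ n) x)))"
      unfolding y_def Ak by (simp add: funpow_add)
    then have "y n - y (n + k) = (S ^^ n) ((A ^^ n) x - (S ^^ k) ((A ^^ k) ((A ^^ n) x)))"
      using x by (simp add: y_def bounded_op_diff[OF isometry_op_bounded[OF bS_pow] M]
          S_pow_mem A_pow_mem)
    then show ?thesis
      using x norm_diff_S_A_pow[of "(A ^^ n) x" k]
      by (simp add: isometry_op_norm[OF bS_pow] closed_csubspace_diff[OF M] S_pow_mem A_pow_mem
          a_def Ak)
  qed
  have "decseq a"
  proof (rule decseq_SucI)
    fix n
    have "0 \<le> a n - a (n + 1)" unfolding dist[symmetric] by simp
    then show "a (Suc n) \<le> a n" by simp
  qed
  moreover have "0 \<le> a n" for n by (simp add: a_def)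
  ultimately obtain L where "a \<longlonglongrightarrow> L" using decseq_convergent[of a 0] by metis
  then have "convergent a" by (rule convergentI)
  then have Ca: "Cauchy a" by (rule convergent_Cauchy)
  have "Cauchy y"
    unfolding Cauchy_altdef
  proof (intro allI impI)
    fix e :: real assume e: "e > 0"
    then have "e\<^sup>2 > 0" by simp
    from metric_CauchyD[OF Ca this]
    obtain N where N: "\<forall>m\<ge>N. \<forall>n\<ge>N. \<bar>a m - a n\<bar> < e\<^sup>2"
      unfolding dist_real_def by blast
    have "dist (y m) (y n) < e" if "m \<ge> N" "n > m" for m n
    proof -
      obtain k where k: "n = m + k" using \<open>n > m\<close> less_imp_add_positive by blast
      have "\<bar>a m - a n\<bar> < e\<^sup>2" using N that by simp
      then have "(dist (y m) (y n))\<^sup>2 < e\<^sup>2"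
        using dist[of m k] by (simp add: k dist_norm)
      then show ?thesis using e by (simp add: power_less_imp_less_base)
    qed
    then show "\<exists>N. \<forall>m\<ge>N. \<forall>n>m. dist (y m) (y n) < e" by blast
  qed
  then obtain l where l: "y \<longlonglongrightarrow> l" by (auto simp: Cauchy_convergent_iff convergent_def)
  have lM: "l \<in> M" by (rule closed_csubspace_lim[OF M l yM])
  have "l \<in> (S ^^ n) ` M" for n
  proof -
    have b: "bounded_op M M (\<lambda>x. (S ^^ n) ((A ^^ n) x))"
      by (rule bounded_op_compose[OF bA_pow isometry_op_bounded[OF bS_pow]])
    have "(\<lambda>m. (S ^^ n) ((A ^^ n) (y (m + n)))) \<longlonglongrightarrow> (S ^^ n) ((A ^^ n) l)"
      using bounded_linear.tendsto[OF bounded_linear_comp_closed_proj[OF b M] LIMSEQ_ignore_initial_segment[OF l, of n]]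
      by (simp add: closed_proj_idem[OF M] yM lM)
    moreover have "(S ^^ n) ((A ^^ n) (y (m + n))) = y (m + n)" for m
    proof -
      have "y (m + n) = (S ^^ n) ((S ^^ m) ((A ^^ (m + n)) x))"
        unfolding y_def by (subst add.commute) (simp add: funpow_add)
      then show ?thesis using x by (simp add: A_S_pow S_pow_mem A_pow_mem)
    qed
    ultimately have "y \<longlonglongrightarrow> (S ^^ n) ((A ^^ n) l)"
      using LIMSEQ_offset[of y n] by (simp only:)
    then have "l = (S ^^ n) ((A ^^ n) l)" by (rule LIMSEQ_unique[OF l])
    then show ?thesis using A_pow_mem[OF lM] by blast
  qed
  then have "l = 0" using pure[OF lM] by blast
  then have "(\<lambda>n. norm (y n)) \<longlonglongrightarrow> 0" using tendsto_norm[OF l] by simp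
  then show ?thesis
    using x by (intro tendsto_norm_zero_cancel[of "\<lambda>n. (A ^^ n) x"]) (simp add: y_def isometry_op_norm[OF bS_pow] A_pow_mem)
qed

end

locale pure_q_commuting_isometries = q_commuting_isometries +
  assumes pure: "x \<in> M \<Longrightarrow> \<forall>n. x \<in> (S ^^ n) ` M \<Longrightarrow> x = 0"
begin

text \<open>
  The Wold decomposition \<open>x = \<Sum> S\<^sup>n f\<^sub>n\<close> of a pure isometry, with \<open>f\<^sub>n = E S\<^sup>*\<^sup>n x\<close>,
  read as the function \<open>\<Sum> z\<^sup>n f\<^sub>n\<close>.
\<close>

definition to_hardy where "to_hardy x = hardy_of (\<lambda>n. E ((A ^^ n) x))"

lemma A_pow_tendsto: "x \<in> M \<Longrightarrow> (\<lambda>n. (A ^^ n) x) \<longlonglongrightarrow> 0"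
  by (rule A_pow_tendsto_0[OF pure])

text \<open>
  Since \<open>\<parallel>E y\<parallel>\<^sup>2 = \<parallel>y\<parallel>\<^sup>2 - \<parallel>A y\<parallel>\<^sup>2\<close>, the series telescopes.
\<close>

lemma sums_norm_E:
  assumes x: "x \<in> M"
  shows "(\<lambda>n. (norm (E ((A ^^ n) x)))\<^sup>2) sums (norm x)\<^sup>2"
proof -
  have "(\<lambda>n. (norm ((A ^^ n) x))\<^sup>2) \<longlonglongrightarrow> 0"
    using tendsto_power[OF tendsto_norm[OF A_pow_tendsto[OF x]], of 2] by simp
  from telescope_sums'[OF this]
  show ?thesis using x by (simp add: norm_E A_pow_mem)
qed

lemma hcoeff_to_hardy: "x \<in> M \<Longrightarrow> hcoeff (to_hardy x) n = E ((A ^^ n) x)"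
  using sums_norm_E[of x] by (simp add: to_hardy_def hcoeff_hardy_of sq_summable_def sums_iff)

lemma isometry_to_hardy: "isometry_op M (hardy_space F) to_hardy"
proof (rule isometry_opI)
  fix x y c assume x: "x \<in> M"
  show "to_hardy x \<in> hardy_space F"
    using x by (simp add: hardy_space_iff[OF F] hcoeff_to_hardy E_mem A_pow_mem)
  show "to_hardy (c *\<^sub>C x) = c *\<^sub>C to_hardy x"
    using x by (intro hardy_eqI ext) (simp add: hcoeff_to_hardy hcoeff_scaleC mem
        bounded_op_scaleC[OF bA_pow] linE A_pow_mem)
  have "(norm (to_hardy x))\<^sup>2 = (norm x)\<^sup>2"
    using sums_norm_hardy[of "to_hardy x"] sums_norm_E[OF x] x
    by (simp add: hcoeff_to_hardy sums_iff)
  then show "norm (to_hardy x) = norm x" by simp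
  assume y: "y \<in> M"
  show "to_hardy (x + y) = to_hardy x + to_hardy y"
    using x y by (intro hardy_eqI ext) (simp add: hcoeff_to_hardy hcoeff_add mem
        bounded_op_add[OF bA_pow] linE A_pow_mem)
qed

lemma hcoeff_to_hardy_S_pow:
  assumes y: "y \<in> F"
  shows "hcoeff (to_hardy ((S ^^ n) y)) k = (if k = n then y else 0)"
proof -
  note yM = F_subset[OF y]
  consider "k = n" | j where "n = k + Suc j" | j where "k = n + Suc j"
    using less_imp_Suc_add[of k n] less_imp_Suc_add[of n k] by (cases rule: linorder_cases[of k n]) auto
  then have "E ((A ^^ k) ((S ^^ n) y)) = (if k = n then y else 0)"
  proof cases
    case 1
    then show ?thesis using yM y by (simp add: A_S_pow E_ident)
  next
    case 2
    have "(S ^^ n) y = (S ^^ k) ((S ^^ Suc j) y)" by (simp only: 2 funpow_add comp_apply)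
    then have "(A ^^ k) ((S ^^ n) y) = (S ^^ Suc j) y"
      using A_S_pow[OF S_pow_mem[OF yM], of k "Suc j"] by (simp only:)
    then show ?thesis using 2 yM by (simp add: E_S S_pow_mem)
  next
    case 3
    have "(A ^^ m) 0 = 0" for m by (induction m) (simp_all add: lin')
    then have "(A ^^ Suc j) y = 0" using F_kernel(1)[OF y] by (simp add: funpow_swap1)
    moreover have "(A ^^ k) ((S ^^ n) y) = (A ^^ Suc j) ((A ^^ n) ((S ^^ n) y))"
      by (simp only: 3 add.commute[of n] funpow_add comp_apply)
    ultimately show ?thesis using 3 yM by (simp add: A_S_pow linE del: funpow.simps)
  qed
  then show ?thesis using yM by (simp add: hcoeff_to_hardy S_pow_mem)
qed

text \<open>A function orthogonal to all monomials \<open>z\<^sup>n y\<close>, which are images of \<open>S\<^sup>n y\<close>, vanishes.\<close>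

lemma to_hardy_surj: "to_hardy ` M = hardy_space F"
proof
  note b = isometry_op_bounded[OF isometry_to_hardy]
  show "to_hardy ` M \<subseteq> hardy_space F" using bounded_op_mem[OF b] by blast
  show "hardy_space F \<subseteq> to_hardy ` M"
  proof
    fix f assume f: "f \<in> hardy_space F"
    let ?R = "adjoint_op M (hardy_space F) to_hardy"
    note bR = bounded_op_adjoint_op[OF b M]
    have RM: "?R f \<in> M" by (rule adjoint_op_mem[OF b M])
    define g where "g = f - to_hardy (?R f)"
    have gF: "hcoeff g n \<in> F" for n
      using f bounded_op_mem[OF b RM] by (simp add: g_def hcoeff_diff hardy_space_iff[OF F] closed_csubspace_diff[OF F])
    have "?R g = 0"
      unfolding g_def
      by (simp add: bounded_op_diff[OF bR closed_csubspace_UNIV] adjoint_isometry[OF isometry_to_hardy M RM])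
    have "hcoeff g n = 0" for n
    proof -
      let ?y = "(S ^^ n) (hcoeff g n)"
      have "cinner (hcoeff g n) (hcoeff g n) = cinner (to_hardy ?y) g"
        by (subst cinner_hardy_single[of n]) (simp_all add: hcoeff_to_hardy_S_pow gF)
      also have "\<dots> = cinner ?y (?R g)"
        by (rule cinner_adjoint_op[OF b M S_pow_mem[OF F_subset[OF gF]]])
      finally show ?thesis using \<open>?R g = 0\<close> by (simp add: cinner_self_eq_0)
    qed
    then have "g = 0" by (intro hardy_eqI) (simp add: hcoeff_zero fun_eq_iff)
    then show "f \<in> to_hardy ` M" using RM by (auto simp: g_def)
  qed
qed

lemma A_pow_A1: "x \<in> M \<Longrightarrow> (A ^^ n) (A1 x) = cnj q ^ n *\<^sub>C A1 ((A ^^ n) x)"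
  by (induction n) (simp_all add: lin' A_A1 A_pow_mem scaleC_scaleC mult.commute)

lemma A_pow_A2: "x \<in> M \<Longrightarrow> (A ^^ n) (A2 x) = q ^ n *\<^sub>C A2 ((A ^^ n) x)"
  by (induction n) (simp_all add: lin' A_A2 A_pow_mem scaleC_scaleC mult.commute)

text \<open>
  In degree \<open>n + 1\<close> one has \<open>S\<^sup>*\<^sup>n\<^sup>+\<^sup>1 W\<^sub>1 = q\<^sup>n W\<^sub>2\<^sup>* S\<^sup>*\<^sup>n\<close>, because \<open>S\<^sup>* W\<^sub>1 = W\<^sub>2\<^sup>*\<close>, and likewise
  \<open>S\<^sup>*\<^sup>n\<^sup>+\<^sup>1 W\<^sub>2 = q\<^sup>-\<^sup>n\<^sup>-\<^sup>1 W\<^sub>1\<^sup>* S\<^sup>*\<^sup>n\<close>.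
\<close>

lemma
  assumes x: "x \<in> M"
  shows hcoeff_to_hardy_W1_0: "hcoeff (to_hardy (W1 x)) 0 = q *\<^sub>C compl_op P (U (hcoeff (to_hardy x) 0))"
    and hcoeff_to_hardy_W1_Suc: "hcoeff (to_hardy (W1 x)) (Suc n)
      = q ^ (n + 2) *\<^sub>C compl_op P (U (hcoeff (to_hardy x) (Suc n)))
        + q ^ (n + 1) *\<^sub>C P (U (hcoeff (to_hardy x) n))"
    and hcoeff_to_hardy_W2_0: "hcoeff (to_hardy (W2 x)) 0 = cnj q *\<^sub>C V (P (hcoeff (to_hardy x) 0))"
    and hcoeff_to_hardy_W2_Suc: "hcoeff (to_hardy (W2 x)) (Suc n)
      = cnj q ^ (n + 2) *\<^sub>C (V (P (hcoeff (to_hardy x) (Suc n))) + V (compl_op P (hcoeff (to_hardy x) n)))"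
proof -
  note c = hcoeff_to_hardy[OF x] hcoeff_to_hardy[OF bounded_op_mem[OF bW1 x]]
    hcoeff_to_hardy[OF bounded_op_mem[OF bW2 x]]
  show "hcoeff (to_hardy (W1 x)) 0 = q *\<^sub>C compl_op P (U (hcoeff (to_hardy x) 0))"
    "hcoeff (to_hardy (W2 x)) 0 = cnj q *\<^sub>C V (P (hcoeff (to_hardy x) 0))"
    using x by (simp_all add: c E_W1 E_W2)
  have "(A ^^ Suc n) (W1 x) = q ^ n *\<^sub>C A2 ((A ^^ n) x)"
    using x by (simp add: funpow_Suc_right A_W1 A_pow_A2 del: funpow.simps)
  then show "hcoeff (to_hardy (W1 x)) (Suc n)
      = q ^ (n + 2) *\<^sub>C compl_op P (U (hcoeff (to_hardy x) (Suc n)))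
        + q ^ (n + 1) *\<^sub>C P (U (hcoeff (to_hardy x) n))"
    using x by (simp add: c linE mem A_pow_mem E_A2 scaleC_add_right scaleC_scaleC power2_eq_square mult_ac)
  have "(A ^^ Suc n) (W2 x) = cnj q ^ Suc n *\<^sub>C A1 ((A ^^ n) x)"
    using x by (simp add: funpow_Suc_right A_W2 bounded_op_scaleC[OF bA_pow] mem A_pow_A1 scaleC_scaleC
        del: funpow.simps)
  then show "hcoeff (to_hardy (W2 x)) (Suc n)
      = cnj q ^ (n + 2) *\<^sub>C (V (P (hcoeff (to_hardy x) (Suc n))) + V (compl_op P (hcoeff (to_hardy x) n)))"
    using x by (simp add: c linE mem A_pow_mem E_A1 scaleC_scaleC mult_ac)
qed

end

section \<open>The model of a minimal isometric lift\<close>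

text \<open>
  The graph of the extension consists of the limits of the pairs \<open>(D h, C h)\<close>. It is single-valued and
  isometric because the two components of a pair have the same norm.
\<close>

lemma isometry_extension:
  fixes D :: "'h::complex_hilbert \<Rightarrow> 'd::complex_hilbert" and C :: "'h \<Rightarrow> 'f::complex_hilbert"
  assumes D: "bounded_op UNIV UNIV D" and C: "bounded_op UNIV F C" and F: "closed_csubspace F"
    and norm_eq: "\<And>h. norm (C h) = norm (D h)"
  shows "\<exists>\<Lambda>. isometry_op (closure (range D)) F \<Lambda> \<and> (\<forall>h. \<Lambda> (D h) = C h)"
proof -
  define R where "R x y \<longleftrightarrow> (\<exists>X. (\<lambda>n. D (X n)) \<longlonglongrightarrow> x \<and> (\<lambda>n. C (X n)) \<longlonglongrightarrow> y)" for x y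
  have R_add: "R (x + x') (y + y')" if xy: "R x y" and xy': "R x' y'" for x y x' y'
  proof -
    obtain X where "(\<lambda>n. D (X n)) \<longlonglongrightarrow> x" "(\<lambda>n. C (X n)) \<longlonglongrightarrow> y"
      using xy unfolding R_def by auto
    moreover obtain X' where "(\<lambda>n. D (X' n)) \<longlonglongrightarrow> x'" "(\<lambda>n. C (X' n)) \<longlonglongrightarrow> y'"
      using xy' unfolding R_def by auto
    ultimately show ?thesis
      unfolding R_def using bounded_op_add[OF D] bounded_op_add[OF C]
      by (intro exI[of _ "\<lambda>n. X n + X' n"]) (simp add: tendsto_add)
  qed
  have R_scale: "R (c *\<^sub>C x) (c *\<^sub>C y)" if xy: "R x y" for c x y
  proof -
    obtain X where "(\<lambda>n. D (X n)) \<longlonglongrightarrow> x" "(\<lambda>n. C (X n)) \<longlonglongrightarrow> y"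
      using xy unfolding R_def by auto
    then show ?thesis
      unfolding R_def using bounded_op_scaleC[OF D] bounded_op_scaleC[OF C]
      by (intro exI[of _ "\<lambda>n. c *\<^sub>C X n"])
         (simp add: bounded_linear.tendsto[OF bounded_linear_scaleC])
  qed
  have R_norm: "norm y = norm x" if xy: "R x y" for x y
  proof -
    obtain X where X: "(\<lambda>n. D (X n)) \<longlonglongrightarrow> x" "(\<lambda>n. C (X n)) \<longlonglongrightarrow> y"
      using xy unfolding R_def by auto
    show ?thesis
      using tendsto_norm[OF X(1)] tendsto_norm[OF X(2)] by (simp add: norm_eq LIMSEQ_unique)
  qed
  have R_unique: "y = y'" if "R x y" "R x y'" for x y y'
    using R_norm[OF R_add[OF that(1) R_scale[OF that(2), of "- 1"]]]
    by (simp add: complex_vector.scale_minus_left)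
  have R_F: "y \<in> F" if "R x y" for x y
    using that closed_csubspace_lim[OF F] bounded_op_mem[OF C] unfolding R_def by blast
  have R_ex: "\<exists>y. R x y" if x: "x \<in> closure (range D)" for x
  proof -
    obtain Z where Z: "\<And>n. Z n \<in> range D" "Z \<longlonglongrightarrow> x" using x by (auto simp: closure_sequential)
    have "\<forall>n. \<exists>a. Z n = D a" using Z(1) by auto
    then obtain X where X: "\<And>n. Z n = D (X n)" by metis
    have DX: "(\<lambda>n. D (X n)) \<longlonglongrightarrow> x" using Z(2) by (simp add: X[symmetric])
    then have "Cauchy (\<lambda>n. D (X n))" by (rule LIMSEQ_imp_Cauchy)
    moreover have "dist (C a) (C b) = dist (D a) (D b)" for a b
      using norm_eq[of "a - b"] bounded_op_diff[OF C closed_csubspace_UNIV, of a b]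
        bounded_op_diff[OF D closed_csubspace_UNIV, of a b] by (simp add: dist_norm)
    ultimately have "Cauchy (\<lambda>n. C (X n))" by (simp add: Cauchy_def)
    then obtain y where "(\<lambda>n. C (X n)) \<longlonglongrightarrow> y" by (auto simp: Cauchy_convergent_iff convergent_def)
    with DX show ?thesis unfolding R_def by (intro exI conjI)
  qed
  have R_D: "R (D h) (C h)" for h unfolding R_def by (intro exI[of _ "\<lambda>_. h"]) simp
  define \<Lambda> where "\<Lambda> x = (SOME y. R x y)" for x
  have \<Lambda>: "R x (\<Lambda> x)" if "x \<in> closure (range D)" for x
    unfolding \<Lambda>_def using R_ex[OF that] by (rule someI_ex)
  have \<Lambda>_eq: "\<Lambda> x = y" if "R x y" for x y
    unfolding \<Lambda>_def using that R_unique by (metis someI)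
  have "isometry_op (closure (range D)) F \<Lambda>"
  proof (rule isometry_opI)
    fix x assume x: "x \<in> closure (range D)"
    show "\<Lambda> x \<in> F" by (rule R_F[OF \<Lambda>[OF x]])
    show "norm (\<Lambda> x) = norm x" by (rule R_norm[OF \<Lambda>[OF x]])
    show "\<Lambda> (c *\<^sub>C x) = c *\<^sub>C \<Lambda> x" for c by (rule \<Lambda>_eq[OF R_scale[OF \<Lambda>[OF x]]])
    fix y assume y: "y \<in> closure (range D)"
    show "\<Lambda> (x + y) = \<Lambda> x + \<Lambda> y" by (rule \<Lambda>_eq[OF R_add[OF \<Lambda>[OF x] \<Lambda>[OF y]]])
  qed
  moreover have "\<Lambda> (D h) = C h" for h by (rule \<Lambda>_eq[OF R_D])
  ultimately show ?thesis by blast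
qed

lemma orthogonal_to_span_closure:
  assumes "x \<in> closure (complex_vector.span G)" "\<And>g. g \<in> G \<Longrightarrow> cinner x g = 0"
  shows "x = (0::'a::complex_hilbert)"
proof -
  let ?K = "{v. cinner v x = 0}"
  have "complex_vector.subspace ?K"
    by (simp add: complex_vector.subspace_def cinner_add_left cinner_scaleC_left)
  moreover have "G \<subseteq> ?K" using assms(2) cinner_orth_sym by blast
  ultimately have "complex_vector.span G \<subseteq> ?K" by (metis complex_vector.span_minimal)
  moreover have "closed ?K"
    using bounded_linear.continuous_on[OF bounded_linear_cinner_left continuous_on_id, of UNIV x]
    by (intro closed_Collect_eq continuous_on_const) auto
  ultimately have "closure (complex_vector.span G) \<subseteq> ?K" by (rule closure_minimal)
  then show ?thesis using assms(1) by (auto simp: cinner_self_eq_0)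
qed

context schaffer_model
begin

text \<open>
  Tested against a vector \<open>k\<close>, with \<open>D\<^sub>T\<close>, \<open>\<Lambda>\<^sup>*\<close> and \<open>U\<^sup>*\<close> moved to the side of \<open>k\<close>, the identities are the
  isometry conditions on the first columns in polarized form.
\<close>

lemma defect_identities:
  assumes 1: "\<And>k h. cinner (T1 k) (T1 h) + cinner (P (U (L k))) (P (U (L h))) = cinner k h"
    and 2: "\<And>k h. cinner (T2 k) (T2 h) + cinner (P' (L k)) (P' (L h)) = cinner k h"
  defines "D \<equiv> defect_op (T1 \<circ> T2)" and "\<Lambda>' \<equiv> adjoint_op (defect_space (T1 \<circ> T2)) F \<Lambda>"
  shows "adjoint_op UNIV UNIV T1 (T1 h) + D (\<Lambda>' (U' (P (U (L h))))) = h"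
    and "adjoint_op UNIV UNIV T2 (T2 h) + D (\<Lambda>' (P' (L h))) = h"
proof -
  have PP: "cinner a (P b) = cinner (P a) (P b)" "cinner a (P' b) = cinner (P' a) (P' b)"
    if "a \<in> F" "b \<in> F" for a b
  proof -
    show "cinner a (P b) = cinner (P a) (P b)"
      using that cinner_orth_proj[OF P F, of a "P b"] by (simp add: mem proj)
    show "cinner a (P' b) = cinner (P' a) (P' b)"
      using that cinner_orth_proj_compl[OF P F, of a b] by (simp add: compl_op_def cinner_diff_left)
  qed
  have D: "cinner k (D (\<Lambda>' v)) = cinner (L k) v" for k v
    using cinner_adjoint_op[OF isometry_op_bounded[OF \<Lambda>] closed_csubspace_defect_space[OF T]
        defect_op_mem[OF T], of k v]
    by (simp add: D_def \<Lambda>'_def positive_op_symmetric[OF positive_defect_op[OF T], symmetric])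
  have U: "cinner a (U' b) = cinner (U a) b" if "a \<in> F" for a b
    using cinner_adjoint_op[OF bU F that] by simp
  show "adjoint_op UNIV UNIV T1 (T1 h) + D (\<Lambda>' (U' (P (U (L h))))) = h"
  proof (rule cinner_ext[of UNIV])
    fix k
    have "cinner k (adjoint_op UNIV UNIV T1 (T1 h)) = cinner (T1 k) (T1 h)"
      by (simp add: cinner_adjoint_op[OF bT1])
    then show "cinner k (adjoint_op UNIV UNIV T1 (T1 h) + D (\<Lambda>' (U' (P (U (L h)))))) = cinner k h"
      using 1[of k h] by (simp add: cinner_add_right D U mem PP(1))
  qed simp_all
  show "adjoint_op UNIV UNIV T2 (T2 h) + D (\<Lambda>' (P' (L h))) = h"
  proof (rule cinner_ext[of UNIV])
    fix k
    have "cinner k (adjoint_op UNIV UNIV T2 (T2 h)) = cinner (T2 k) (T2 h)"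
      by (simp add: cinner_adjoint_op[OF bT2])
    then show "cinner k (adjoint_op UNIV UNIV T2 (T2 h) + D (\<Lambda>' (P' (L h)))) = cinner k h"
      using 2[of k h] by (simp add: cinner_add_right D mem PP(2))
  qed simp_all
qed

end

text \<open>
  Let \<open>M = ker J\<^sup>*\<close> be the orthogonal complement of the copy of the original space. It is invariant under
  both isometries, and with respect to \<open>J H \<oplus> M\<close> they are lower triangular, with corners \<open>C1\<close> and \<open>C2\<close>
  below; \<open>C\<close> is the corner of \<open>V\<^sub>1 V\<^sub>2\<close>. The restrictions to \<open>M\<close> are modelled by the preceding section.
\<close>

locale minimal_q_lift =
  fixes q :: complex and T1 T2 :: "'h::complex_hilbert \<Rightarrow> 'h" and J :: "'h \<Rightarrow> 'k::complex_hilbert"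
    and V1 V2 :: "'k \<Rightarrow> 'k"
  assumes q: "norm q = 1" and T1: "contraction_op T1" and T2: "contraction_op T2"
    and T_comm: "T1 (T2 h) = q *\<^sub>C T2 (T1 h)"
    and V_comm: "V1 (V2 x) = q *\<^sub>C V2 (V1 x)"
    and lift: "isometric_lift T1 T2 UNIV J V1 V2" and minimal: "minimal_lift UNIV J V1 V2"
begin

abbreviation J' where "J' \<equiv> adjoint_op UNIV UNIV J"

definition M where "M = {x. J' x = 0}"

lemma J: "isometry_op UNIV UNIV J" and V1: "isometry_op UNIV UNIV V1" and V2: "isometry_op UNIV UNIV V2"
  and adj1: "adjoint_op UNIV UNIV V1 (J h) = J (adjoint_op UNIV UNIV T1 h)"
  and adj2: "adjoint_op UNIV UNIV V2 (J h) = J (adjoint_op UNIV UNIV T2 h)"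
  using lift by (simp_all add: isometric_lift_def)

lemmas bJ = isometry_op_bounded[OF J] and bV1 = isometry_op_bounded[OF V1]
  and bV2 = isometry_op_bounded[OF V2]
lemmas bJ' = bounded_op_adjoint_op[OF bJ closed_csubspace_UNIV]

lemma bT1: "bounded_op UNIV UNIV T1" and bT2: "bounded_op UNIV UNIV T2"
  using T1 T2 by (auto simp: contraction_op_def)

lemmas add = bounded_op_add[OF bJ UNIV_I UNIV_I] bounded_op_add[OF bV1 UNIV_I UNIV_I]
  bounded_op_add[OF bV2 UNIV_I UNIV_I] bounded_op_add[OF bJ' UNIV_I UNIV_I]
  bounded_op_add[OF bT1 UNIV_I UNIV_I] bounded_op_add[OF bT2 UNIV_I UNIV_I]
lemmas scale = bounded_op_scaleC[OF bJ UNIV_I] bounded_op_scaleC[OF bV1 UNIV_I]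
  bounded_op_scaleC[OF bV2 UNIV_I] bounded_op_scaleC[OF bJ' UNIV_I]
  bounded_op_scaleC[OF bT1 UNIV_I] bounded_op_scaleC[OF bT2 UNIV_I]
lemmas diff = bounded_op_diff[OF bJ closed_csubspace_UNIV UNIV_I UNIV_I]
  bounded_op_diff[OF bV1 closed_csubspace_UNIV UNIV_I UNIV_I]
  bounded_op_diff[OF bV2 closed_csubspace_UNIV UNIV_I UNIV_I]
  bounded_op_diff[OF bJ' closed_csubspace_UNIV UNIV_I UNIV_I]
  bounded_op_diff[OF bT1 closed_csubspace_UNIV UNIV_I UNIV_I]
  bounded_op_diff[OF bT2 closed_csubspace_UNIV UNIV_I UNIV_I]
lemmas zero = bounded_op_zero[OF bJ closed_csubspace_UNIV] bounded_op_zero[OF bT1 closed_csubspace_UNIV]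
  bounded_op_zero[OF bT2 closed_csubspace_UNIV] bounded_op_zero[OF bJ' closed_csubspace_UNIV]

lemma cinner_J': "cinner x (J h) = cinner (J' x) h"
  by (simp add: cinner_adjoint_op'[OF bJ])

lemma J'J: "J' (J h) = h" by (rule adjoint_isometry[OF J]) simp_all

text \<open>The lift condition says that \<open>J\<^sup>*\<close> intertwines the isometries with the contractions.\<close>

lemma intertwine:
  fixes V :: "'k \<Rightarrow> 'k"
  assumes V: "bounded_op UNIV UNIV V" and T: "bounded_op UNIV UNIV T"
    and adj: "\<And>h. adjoint_op UNIV UNIV V (J h) = J (adjoint_op UNIV UNIV T h)"
  shows "J' (V x) = T (J' x)"
proof -
  have "cinner (J' (V x)) k = cinner (T (J' x)) k" for k
    by (simp add: cinner_J'[symmetric] cinner_adjoint_op[OF V] adj) (simp add: cinner_J' cinner_adjoint_op[OF T])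
  then have "cinner k (J' (V x)) = cinner k (T (J' x))" for k by (metis cinner_commute)
  then show ?thesis by (rule cinner_ext[of UNIV, rotated 3]) simp_all
qed

lemmas J'V1 = intertwine[OF bV1 bT1 adj1] and J'V2 = intertwine[OF bV2 bT2 adj2]

lemma closed_M: "closed_csubspace M"
  unfolding closed_csubspace_def complex_vector.subspace_def
proof (intro conjI ballI allI)
  show "closed M"
    unfolding M_def using bounded_linear.continuous_on[OF bounded_linear_UNIV[OF bJ'] continuous_on_id]
    by (intro closed_Collect_eq continuous_on_const) auto
qed (auto simp: M_def add scale zero)

lemma isometry_M:
  assumes V: "isometry_op UNIV UNIV V" and "\<And>x. x \<in> M \<Longrightarrow> V x \<in> M"
  shows "isometry_op M M V"
  using isometry_op_bounded[OF V]
  by (intro isometry_opI)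
     (simp_all add: assms(2) bounded_op_add bounded_op_scaleC isometry_op_norm[OF V])

sublocale W: q_commuting_isometries q M V1 V2
proof
  show "isometry_op M M V1" by (rule isometry_M[OF V1]) (simp add: M_def J'V1 zero)
  show "isometry_op M M V2" by (rule isometry_M[OF V2]) (simp add: M_def J'V2 zero)
qed (simp_all add: q closed_M V_comm)

lemma V2_S_pow: "x \<in> M \<Longrightarrow> \<exists>y\<in>M. V2 ((W.S ^^ n) x) = (W.S ^^ n) y"
proof (induction n)
  case 0
  then show ?case using W.mem(2) by auto
next
  case (Suc n)
  then obtain y where y: "y \<in> M" "V2 ((W.S ^^ n) x) = (W.S ^^ n) y" by blast
  have "V2 ((W.S ^^ Suc n) x) = cnj q *\<^sub>C W.S (V2 ((W.S ^^ n) x))"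
    using Suc.prems by (simp add: W.S_W2 W.S_pow_mem scaleC_scaleC W.qq)
  also have "\<dots> = (W.S ^^ Suc n) (cnj q *\<^sub>C y)"
    using y by (simp add: bounded_op_scaleC[OF isometry_op_bounded[OF W.bS_pow]] W.lin' W.S_pow_mem)
  finally show ?case using y W.mem(7) by blast
qed

lemma V1_S_pow: "x \<in> M \<Longrightarrow> \<exists>y\<in>M. V1 ((W.S ^^ n) x) = (W.S ^^ n) y"
proof (induction n)
  case 0
  then show ?case using W.mem(1) by auto
next
  case (Suc n)
  then obtain y where y: "y \<in> M" "V1 ((W.S ^^ n) x) = (W.S ^^ n) y" by blast
  have "V1 ((W.S ^^ Suc n) x) = q *\<^sub>C W.S (V1 ((W.S ^^ n) x))"
    using Suc.prems by (simp add: W.S_W1 W.S_pow_mem scaleC_scaleC W.qq)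
  also have "\<dots> = (W.S ^^ Suc n) (q *\<^sub>C y)"
    using y by (simp add: bounded_op_scaleC[OF isometry_op_bounded[OF W.bS_pow]] W.lin' W.S_pow_mem)
  finally show ?case using y W.mem(7) by blast
qed

text \<open>
  Since \<open>S = V\<^sub>1 V\<^sub>2 = q V\<^sub>2 V\<^sub>1\<close>, a vector in the range of \<open>S\<^sup>n\<^sup>+\<^sup>1\<close> is both \<open>V\<^sub>1\<close> and \<open>V\<^sub>2\<close> of a vector in the
  range of \<open>S\<^sup>n\<close>. So each factor \<open>V\<^sub>1\<close> or \<open>V\<^sub>2\<close> can be cancelled at the cost of one power of \<open>S\<close>, until only
  \<open>M\<close> and \<open>J H\<close> are left.
\<close>

lemma S_pow_orthogonal:
  "y \<in> M \<Longrightarrow> cinner ((W.S ^^ (a + b)) y) ((V1 ^^ a) ((V2 ^^ b) (J h))) = 0"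
proof (induction a arbitrary: y)
  case 0
  then show ?case
  proof (induction b arbitrary: y)
    case 0
    then show ?case by (simp add: cinner_J' M_def)
  next
    case (Suc b)
    obtain z where z: "z \<in> M" "V1 ((W.S ^^ b) y) = (W.S ^^ b) z" using V1_S_pow[OF Suc.prems] by blast
    have "(W.S ^^ (0 + Suc b)) y = q *\<^sub>C V2 ((W.S ^^ b) z)"
      using Suc.prems by (simp add: W.S_eq W.S_pow_mem z(2))
    then show ?case
      using Suc.IH[OF z(1)] by (simp add: cinner_scaleC_left isometry_op_cinner[OF V2])
  qed
next
  case (Suc a)
  obtain z where z: "z \<in> M" "V2 ((W.S ^^ (a + b)) y) = (W.S ^^ (a + b)) z"
    using V2_S_pow[OF Suc.prems] by blast
  have "(W.S ^^ (Suc a + b)) y = V1 ((W.S ^^ (a + b)) z)"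
    by (simp add: W.S_def z(2))
  then show ?case using Suc.IH[OF z(1)] by (simp add: isometry_op_cinner[OF V1])
qed

text \<open>
  This is where minimality enters: a vector in the range of all powers of \<open>S\<close> is orthogonal to every
  generator \<open>V\<^sub>1\<^sup>a V\<^sub>2\<^sup>b J h\<close>.
\<close>

sublocale W: pure_q_commuting_isometries q M V1 V2
proof
  fix x assume x: "x \<in> M" "\<forall>n. x \<in> (W.S ^^ n) ` M"
  show "x = 0"
  proof (rule orthogonal_to_span_closure)
    let ?G = "{(V1 ^^ n1) ((V2 ^^ n2) (J h)) | n1 n2 h. True}"
    show "x \<in> closure (complex_vector.span ?G)"
      using minimal unfolding minimal_lift_def by blast
    fix g assume "g \<in> ?G"
    then obtain a b h where g: "g = (V1 ^^ a) ((V2 ^^ b) (J h))" by blast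
    obtain y where "y \<in> M" "x = (W.S ^^ (a + b)) y" using x(2) by blast
    then show "cinner x g = 0" by (simp add: g S_pow_orthogonal)
  qed
qed

definition C1 where "C1 h = V1 (J h) - J (T1 h)"
definition C2 where "C2 h = V2 (J h) - J (T2 h)"
definition C where "C h = V1 (V2 (J h)) - J (T1 (T2 h))"

lemma C_mem: "C1 h \<in> M" "C2 h \<in> M"
  by (simp_all add: M_def C1_def C2_def diff J'V1 J'V2 J'J)

text \<open>
  The two ways to multiply the triangular matrices. They decompose \<open>C h\<close> along the two splittings of the
  wandering subspace, because \<open>C1 h \<in> ker W\<^sub>1\<^sup>*\<close> and \<open>C2 h \<in> ker W\<^sub>2\<^sup>*\<close>.
\<close>

lemma C_eq: "C h = C1 (T2 h) + V1 (C2 h)" "C h = q *\<^sub>C (C2 (T1 h) + V2 (C1 h))"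
proof -
  show "C h = C1 (T2 h) + V1 (C2 h)" by (simp add: C_def C1_def C2_def diff)
  show "C h = q *\<^sub>C (C2 (T1 h) + V2 (C1 h))"
    by (simp add: C_def C1_def C2_def diff V_comm T_comm scale complex_vector.scale_right_diff_distrib)
qed

lemma cinner_M: "x \<in> M \<Longrightarrow> cinner x (J h) = 0" by (simp add: cinner_J' M_def)

text \<open>
  The second column of an isometric block matrix is orthogonal to its first column.
\<close>

lemma A1_C1: "W.A1 (C1 h) = 0"
proof (rule adjoint_op_eqI[OF closed_M closed_csubspace_0[OF closed_M]])
  fix a assume a: "a \<in> M"
  then have "V1 a \<in> M" by (rule W.mem(1))
  then show "cinner (V1 a) (C1 h) = cinner a 0"
    using a by (simp add: C1_def cinner_diff_right isometry_op_cinner[OF V1] cinner_M)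
qed

lemma A2_C2: "W.A2 (C2 h) = 0"
proof (rule adjoint_op_eqI[OF closed_M closed_csubspace_0[OF closed_M]])
  fix a assume a: "a \<in> M"
  then have "V2 a \<in> M" by (rule W.mem(2))
  then show "cinner (V2 a) (C2 h) = cinner a 0"
    using a by (simp add: C2_def cinner_diff_right isometry_op_cinner[OF V2] cinner_M)
qed

lemma A_C: "W.A1 (C h) = C2 h" "W.A2 (C h) = q *\<^sub>C C1 h" "C h \<in> W.F"
proof -
  show 1: "W.A1 (C h) = C2 h" by (simp add: C_eq(1) W.lin A1_C1 C_mem)
  show "W.A2 (C h) = q *\<^sub>C C1 h" by (simp add: C_eq(2) W.lin A2_C2 C_mem)
  show "C h \<in> W.F"
    by (simp add: W.F_def W.A_def 1 A2_C2) (simp add: C_eq(1) C_mem W.mem)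
qed

text \<open>
  From \<open>C h = q (C2 (T1 h) + V2 (C1 h))\<close> the unitary makes \<open>U C h = V1 (C2 (T1 h)) + C1 h\<close>; the projection
  \<open>P\<close> picks the summand in \<open>ker W\<^sub>1\<^sup>*\<close>. With \<open>L = C\<close> this identifies the corners of the model with \<open>C1\<close>
  and \<open>C2\<close>.
\<close>

lemma model: "W.P (W.U (C h)) = C1 h" "compl_op W.P (C h) = V1 (C2 h)"
  "compl_op W.P (C (T1 h)) = V1 (C2 (T1 h))" "W.U (C h) = V1 (C2 (T1 h)) + C1 h"
  "W.V (compl_op W.P (C h)) = q *\<^sub>C C2 h"
proof -
  show *: "compl_op W.P (C h) = V1 (C2 h)" for h by (simp add: compl_op_def W.P_def A_C)
  show "W.P (W.U (C h)) = C1 h" by (simp add: W.PU[OF A_C(3)] A_C scaleC_scaleC W.qq)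
  show "compl_op W.P (C (T1 h)) = V1 (C2 (T1 h))" by (rule *)
  have "C h - V2 (W.A2 (C h)) = q *\<^sub>C C2 (T1 h)"
    unfolding A_C(2) by (simp add: C_eq(2) scale scaleC_add_right)
  then show "W.U (C h) = V1 (C2 (T1 h)) + C1 h"
    by (simp add: W.U_def A_C scale scaleC_add_right scaleC_scaleC W.qq)
  show "W.V (compl_op W.P (C h)) = q *\<^sub>C C2 h" by (simp add: W.VP'[OF A_C(3)] A_C)
qed

lemma cinner_C1: "cinner (T1 k) (T1 h) + cinner (C1 k) (C1 h) = cinner k h"
  and cinner_C2: "cinner (T2 k) (T2 h) + cinner (C2 k) (C2 h) = cinner k h"
proof -
  have "V1 (J h) = J (T1 h) + C1 h" "V2 (J h) = J (T2 h) + C2 h" for h by (simp_all add: C1_def C2_def)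
  then show "cinner (T1 k) (T1 h) + cinner (C1 k) (C1 h) = cinner k h"
    "cinner (T2 k) (T2 h) + cinner (C2 k) (C2 h) = cinner k h"
    using isometry_op_cinner[OF V1, of "J k" "J h"] isometry_op_cinner[OF V2, of "J k" "J h"]
      C_mem[THEN cinner_M] C_mem[THEN cinner_M, THEN cinner_orth_sym]
    by (simp_all add: isometry_op_cinner[OF J] cinner_add_left cinner_add_right)
qed

lemma bC: "bounded_op UNIV W.F C"
proof -
  have "bounded_op UNIV UNIV C"
    unfolding C_def[abs_def]
    by (intro bounded_op_diff_fun bounded_op_compose[OF bounded_op_compose[OF bJ bV2] bV1]
        bounded_op_compose[OF bounded_op_compose[OF bT2 bT1] bJ] closed_csubspace_UNIV)
  then show ?thesis using A_C(3) unfolding bounded_op_def by blast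
qed

lemma contraction_T: "contraction_op (T1 \<circ> T2)" by (rule contraction_comp[OF T1 T2])

lemma norm_C: "norm (C h) = norm (defect_op (T1 \<circ> T2) h)"
proof -
  have CM: "C h \<in> M" using A_C(3) by (rule W.F_subset)
  have "V1 (V2 (J h)) = C h + J (T1 (T2 h))" by (simp add: C_def)
  then have "(norm h)\<^sup>2 = (norm (C h))\<^sup>2 + (norm (T1 (T2 h)))\<^sup>2"
    using norm_add_Pythagorean_complex[OF cinner_M[OF CM], of "T1 (T2 h)"]
      isometry_op_norm[OF V1, of "V2 (J h)"] isometry_op_norm[OF V2, of "J h"]
    by (simp add: isometry_op_norm[OF J])
  then have "(norm (C h))\<^sup>2 = (norm (defect_op (T1 \<circ> T2) h))\<^sup>2"
    by (simp add: norm_defect_op[OF contraction_T])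
  then show ?thesis by simp
qed

definition to_model where "to_model x = (J' x, W.to_hardy (x - J (J' x)))"

lemma defect_part_mem: "x - J (J' x) \<in> M" by (simp add: M_def diff J'J)

lemmas bto = isometry_op_bounded[OF W.isometry_to_hardy]

lemma unitary_to_model: "unitary_op UNIV (UNIV \<times> hardy_space W.F) to_model"
  unfolding unitary_op_def
proof
  show "isometry_op UNIV (UNIV \<times> hardy_space W.F) to_model"
  proof (rule isometry_opI)
    fix x y c
    show "to_model x \<in> UNIV \<times> hardy_space W.F"
      using bounded_op_mem[OF bto defect_part_mem] by (simp add: to_model_def)
    have "x + y - J (J' (x + y)) = (x - J (J' x)) + (y - J (J' y))" by (simp add: add)
    then show "to_model (x + y) = to_model x + to_model y"
      by (simp only: to_model_def add(4) add_Pair bounded_op_add[OF bto defect_part_mem defect_part_mem])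
    have "c *\<^sub>C x - J (J' (c *\<^sub>C x)) = c *\<^sub>C (x - J (J' x))"
      by (simp add: scale complex_vector.scale_right_diff_distrib)
    then show "to_model (c *\<^sub>C x) = c *\<^sub>C to_model x"
      by (simp only: to_model_def scaleC_prod_def fst_conv snd_conv scale(4)
          bounded_op_scaleC[OF bto defect_part_mem])
    have "(norm x)\<^sup>2 = (norm (x - J (J' x)))\<^sup>2 + (norm (J' x))\<^sup>2"
      using norm_add_Pythagorean_complex[OF cinner_M[OF defect_part_mem], of x "J' x"]
      by (simp add: isometry_op_norm[OF J])
    then have "(norm (to_model x))\<^sup>2 = (norm x)\<^sup>2"
      by (simp add: norm_prod_square to_model_def isometry_op_norm[OF W.isometry_to_hardy defect_part_mem])
    then show "norm (to_model x) = norm x" by simp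
  qed
  show "to_model ` UNIV = UNIV \<times> hardy_space W.F"
  proof
    show "to_model ` UNIV \<subseteq> UNIV \<times> hardy_space W.F"
      using bounded_op_mem[OF bto defect_part_mem] by (auto simp: to_model_def)
    show "UNIV \<times> hardy_space W.F \<subseteq> to_model ` UNIV"
    proof
      fix p assume "p \<in> (UNIV :: 'h set) \<times> hardy_space W.F"
      then obtain h f where p: "p = (h, f)" "f \<in> hardy_space W.F" by auto
      then have "f \<in> W.to_hardy ` M" by (simp only: W.to_hardy_surj)
      then obtain m where m: "m \<in> M" "W.to_hardy m = f" by auto
      then have "J' (J h + m) = h" by (simp add: add J'J M_def)
      then have "to_model (J h + m) = p" by (simp add: to_model_def p m)
      then show "p \<in> to_model ` UNIV" by blast
    qed
  qed
qed

lemma hcoeff_to_hardy_F: "c \<in> W.F \<Longrightarrow> hcoeff (W.to_hardy c) n = (if n = 0 then c else 0)"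
  using W.hcoeff_to_hardy_S_pow[of c 0 n] by simp

lemma C_F: "C1 h \<in> W.F" "C2 h \<in> W.F"
proof -
  show "C1 h \<in> W.F" by (simp add: W.F_def W.A_def C_mem A1_C1 W.lin)
  have "q *\<^sub>C W.A (C2 h) = W.A1 (W.A2 (C2 h))" by (simp add: W.A_def W.A1_A2)
  then have "q *\<^sub>C W.A (C2 h) = 0" by (simp add: A2_C2 W.lin)
  moreover have "q \<noteq> 0" using q by auto
  ultimately have "W.A (C2 h) = 0" by simp
  then show "C2 h \<in> W.F" by (simp add: W.F_def C_mem)
qed

text \<open>
  The isometry \<open>\<Lambda>\<close> is the extension of \<open>D\<^sub>T h \<mapsto> C h\<close>, which preserves norms since \<open>V\<^sub>1 V\<^sub>2\<close> is isometric
  with first column \<open>(T\<^sub>1 T\<^sub>2, C)\<close>. The unitary equivalence compares Taylor coefficients one by one.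
\<close>

lemma model_exists:
  "\<exists>(F :: 'k set) \<Lambda> P U. ando_tuple T1 T2 F \<Lambda> P U
     \<and> unitarily_equivalent UNIV V1 V2 (UNIV \<times> hardy_space F)
         (schaffer1 q T1 T2 F \<Lambda> P U) (schaffer2 q T1 T2 F \<Lambda> P U)
     \<and> (let D = defect_op (T1 \<circ> T2);
            \<Lambda>' = adjoint_op (defect_space (T1 \<circ> T2)) F \<Lambda>;
            U' = adjoint_op F F U
        in (\<forall>h. adjoint_op UNIV UNIV T1 (T1 h) + D (\<Lambda>' (U' (P (U (\<Lambda> (D h)))))) = h)
         \<and> (\<forall>h. adjoint_op UNIV UNIV T2 (T2 h) + D (\<Lambda>' (compl_op P (\<Lambda> (D h)))) = h)
         \<and> (\<forall>h. P (U (\<Lambda> (D (T2 h)))) + compl_op P (\<Lambda> (D h)) = \<Lambda> (D h))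
         \<and> (\<forall>h. \<Lambda> (D h) = U' (compl_op P (\<Lambda> (D (T1 h))) + P (U (\<Lambda> (D h))))))"
proof -
  from isometry_extension[OF bounded_defect_op[OF contraction_T] bC W.F norm_C]
  obtain \<Lambda> where "isometry_op (closure (range (defect_op (T1 \<circ> T2)))) W.F \<Lambda>
      \<and> (\<forall>h. \<Lambda> (defect_op (T1 \<circ> T2) h) = C h)" ..
  then have \<Lambda>: "isometry_op (defect_space (T1 \<circ> T2)) W.F \<Lambda>"
    and L: "\<Lambda> (defect_op (T1 \<circ> T2) h) = C h" for h
    by (simp_all add: defect_space_def)
  have tuple: "ando_tuple T1 T2 W.F \<Lambda> W.P W.U"
    by (simp add: ando_tuple_def W.F \<Lambda> W.P W.U)
  interpret N: schaffer_model q T1 T2 W.F \<Lambda> W.P W.U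
    by standard (fact q T1 T2 tuple)+
  have tau: "to_model (V1 x) = N.S1 (to_model x)" "to_model (V2 x) = N.S2 (to_model x)" for x
  proof -
    define h where "h = J' x"
    define m where "m = x - J (J' x)"
    define f where "f = W.to_hardy m"
    have m: "m \<in> M" and f: "f \<in> hardy_space W.F"
      using defect_part_mem bounded_op_mem[OF bto] by (auto simp: m_def f_def)
    have x: "to_model x = (h, f)" by (simp add: to_model_def h_def f_def m_def)
    have fm: "hcoeff f n \<in> W.F" for n by (rule N.hcoeff_mem[OF f])
    have "V1 x - J (J' (V1 x)) = V1 m + C1 h" "V2 x - J (J' (V2 x)) = V2 m + C2 h"
      by (simp_all add: J'V1 J'V2 m_def h_def C1_def C2_def diff)
    then have c: "hcoeff (snd (to_model (V1 x))) n = hcoeff (W.to_hardy (V1 m)) n + (if n = 0 then C1 h else 0)"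
      "hcoeff (snd (to_model (V2 x))) n = hcoeff (W.to_hardy (V2 m)) n + (if n = 0 then C2 h else 0)" for n
      by (simp_all add: to_model_def bounded_op_add[OF bto] W.mem m C_mem hcoeff_add hcoeff_to_hardy_F C_F)
    note W = W.hcoeff_to_hardy_W1_0[OF m, folded f_def] W.hcoeff_to_hardy_W1_Suc[OF m, folded f_def]
      W.hcoeff_to_hardy_W2_0[OF m, folded f_def] W.hcoeff_to_hardy_W2_Suc[OF m, folded f_def]
    have V: "N.U' y = W.V y" if "y \<in> W.F" for y by (rule W.adjoint_U[OF that])
    show "to_model (V1 x) = N.S1 (to_model x)"
    proof (rule prod_eqI)
      show "fst (to_model (V1 x)) = fst (N.S1 (to_model x))"
        by (simp add: x) (simp add: to_model_def J'V1 h_def)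
      show "snd (to_model (V1 x)) = snd (N.S1 (to_model x))"
      proof (rule hardy_eqI, rule ext)
        show "hcoeff (snd (to_model (V1 x))) n = hcoeff (snd (N.S1 (to_model x))) n" for n
          by (cases n) (simp_all add: c W x N.hcoeff_S1_0[OF f] N.hcoeff_S1_Suc[OF f] L model(1) add.commute
              del: power_Suc)
      qed
    qed
    show "to_model (V2 x) = N.S2 (to_model x)"
    proof (rule prod_eqI)
      show "fst (to_model (V2 x)) = fst (N.S2 (to_model x))"
        by (simp add: x) (simp add: to_model_def J'V2 h_def)
      show "snd (to_model (V2 x)) = snd (N.S2 (to_model x))"
      proof (rule hardy_eqI, rule ext)
        fix n
        show "hcoeff (snd (to_model (V2 x))) n = hcoeff (snd (N.S2 (to_model x))) n"
        proof (cases n)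
          case 0
          have "hcoeff (snd (N.S2 (h, f))) 0 = cnj q *\<^sub>C (W.V (compl_op W.P (C h)) + W.V (W.P (hcoeff f 0)))"
            using fm[of 0] A_C(3)[of h] by (simp add: N.hcoeff_S2_0[OF f] L N.lin N.mem) (simp add: V N.mem)
          then show ?thesis
            by (simp add: 0 c W x model(5) scaleC_add_right scaleC_scaleC W.qq add.commute)
        next
          case (Suc k)
          have "hcoeff (snd (N.S2 (h, f))) (Suc k)
              = cnj q ^ (k + 2) *\<^sub>C (W.V (W.P (hcoeff f (Suc k))) + W.V (compl_op W.P (hcoeff f k)))"
            using fm by (simp add: N.hcoeff_S2_Suc[OF f] N.lin N.mem del: power_Suc) (simp add: V N.mem)
          then show ?thesis by (simp add: Suc c W x del: power_Suc)
        qed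
      qed
    qed
  qed
  have rel1: "W.P (W.U (C (T2 h))) + compl_op W.P (C h) = C h" for h
    by (simp add: model(1,2) C_eq(1)[symmetric])
  have rel2: "C h = N.U' (compl_op W.P (C (T1 h)) + W.P (W.U (C h)))" for h
  proof -
    have "compl_op W.P (C (T1 h)) + W.P (W.U (C h)) = W.U (C h)"
      unfolding model(1,3) by (rule model(4)[symmetric])
    then show ?thesis by (simp add: N.U'U A_C)
  qed
  have id1: "cinner (T1 k) (T1 h) + cinner (W.P (W.U (N.L k))) (W.P (W.U (N.L h))) = cinner k h"
    and id2: "cinner (T2 k) (T2 h) + cinner (compl_op W.P (N.L k)) (compl_op W.P (N.L h)) = cinner k h" for k h
    by (simp_all add: L model(1,2) cinner_C1 cinner_C2 isometry_op_cinner[OF V1])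
  show ?thesis
  proof (intro exI conjI)
    show "ando_tuple T1 T2 W.F \<Lambda> W.P W.U" by (rule tuple)
    show "unitarily_equivalent UNIV V1 V2 (UNIV \<times> hardy_space W.F) N.S1 N.S2"
      unfolding unitarily_equivalent_def using unitary_to_model tau by blast
  qed (use N.defect_identities[OF id1 id2] rel1 rel2 in \<open>simp add: Let_def L\<close>)
qed

end

section \<open>Lifts of q-commuting contractions\<close>

theorem theorem3p1:
  fixes q :: complex and T1 T2 :: "'h::complex_hilbert \<Rightarrow> 'h"
  assumes "norm q = 1"
    and "contraction_op T1" and "contraction_op T2"
    and "q_commuting q UNIV T1 T2"
  shows
    "(\<forall>F \<Lambda> P U. special_ando_tuple T1 T2 F \<Lambda> P U \<longrightarrow>
        q_commuting q (UNIV \<times> hardy_space F)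
          (schaffer1 q T1 T2 F \<Lambda> P U) (schaffer2 q T1 T2 F \<Lambda> P U)
        \<and> isometric_lift T1 T2 (UNIV \<times> hardy_space F) (\<lambda>h. (h, 0))
            (schaffer1 q T1 T2 F \<Lambda> P U) (schaffer2 q T1 T2 F \<Lambda> P U))
     \<and>
     (\<forall>(J :: 'h \<Rightarrow> 'k::complex_hilbert) V1 V2.
        q_commuting q UNIV V1 V2 \<and> isometric_lift T1 T2 UNIV J V1 V2 \<and> minimal_lift UNIV J V1 V2
        \<longrightarrow>
        (\<exists>(F :: 'k set) \<Lambda> P U.
           ando_tuple T1 T2 F \<Lambda> P U
           \<and> unitarily_equivalent UNIV V1 V2 (UNIV \<times> hardy_space F)
               (schaffer1 q T1 T2 F \<Lambda> P U) (schaffer2 q T1 T2 F \<Lambda> P U)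
           \<and> (let D = defect_op (T1 \<circ> T2);
                  \<Lambda>' = adjoint_op (defect_space (T1 \<circ> T2)) F \<Lambda>;
                  U' = adjoint_op F F U
              in (\<forall>h. adjoint_op UNIV UNIV T1 (T1 h) + D (\<Lambda>' (U' (P (U (\<Lambda> (D h)))))) = h)
               \<and> (\<forall>h. adjoint_op UNIV UNIV T2 (T2 h) + D (\<Lambda>' (compl_op P (\<Lambda> (D h)))) = h)
               \<and> (\<forall>h. P (U (\<Lambda> (D (T2 h)))) + compl_op P (\<Lambda> (D h)) = \<Lambda> (D h))
               \<and> (\<forall>h. \<Lambda> (D h) = U' (compl_op P (\<Lambda> (D (T1 h))) + P (U (\<Lambda> (D h))))))))"
proof -
  have comm: "T1 (T2 h) = q *\<^sub>C T2 (T1 h)" for h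
    using assms(4) by (simp add: q_commuting_def)
  show ?thesis
  proof (intro conjI allI impI)
    fix F :: "('h \<times> 'h \<times> 'h) set" and \<Lambda> P U
    assume tuple: "special_ando_tuple T1 T2 F \<Lambda> P U"
    note lift = special_ando_tuple_lift[OF assms(1-3) comm tuple]
    show "q_commuting q (UNIV \<times> hardy_space F)
        (schaffer1 q T1 T2 F \<Lambda> P U) (schaffer2 q T1 T2 F \<Lambda> P U)"
      by (rule conjunct1[OF lift])
    show "isometric_lift T1 T2 (UNIV \<times> hardy_space F) (\<lambda>h. (h, 0))
        (schaffer1 q T1 T2 F \<Lambda> P U) (schaffer2 q T1 T2 F \<Lambda> P U)"
      by (rule conjunct2[OF lift])
  next
    fix J :: "'h \<Rightarrow> 'k" and V1 V2
    assume V: "q_commuting q UNIV V1 V2 \<and> isometric_lift T1 T2 UNIV J V1 V2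
      \<and> minimal_lift UNIV J V1 V2"
    then have V_comm: "V1 (V2 x) = q *\<^sub>C V2 (V1 x)" for x
      by (simp add: q_commuting_def)
    interpret minimal_q_lift q T1 T2 J V1 V2
      by standard (use assms comm V V_comm in simp_all)
    show "\<exists>(F :: 'k set) \<Lambda> P U.
        ando_tuple T1 T2 F \<Lambda> P U
        \<and> unitarily_equivalent UNIV V1 V2 (UNIV \<times> hardy_space F)
            (schaffer1 q T1 T2 F \<Lambda> P U) (schaffer2 q T1 T2 F \<Lambda> P U)
        \<and> (let D = defect_op (T1 \<circ> T2);
               \<Lambda>' = adjoint_op (defect_space (T1 \<circ> T2)) F \<Lambda>;
               U' = adjoint_op F F U
           in (\<forall>h. adjoint_op UNIV UNIV T1 (T1 h) + D (\<Lambda>' (U' (P (U (\<Lambda> (D h)))))) = h)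
            \<and> (\<forall>h. adjoint_op UNIV UNIV T2 (T2 h) + D (\<Lambda>' (compl_op P (\<Lambda> (D h)))) = h)
            \<and> (\<forall>h. P (U (\<Lambda> (D (T2 h)))) + compl_op P (\<Lambda> (D h)) = \<Lambda> (D h))
            \<and> (\<forall>h. \<Lambda> (D h) = U' (compl_op P (\<Lambda> (D (T1 h))) + P (U (\<Lambda> (D h))))))"
      by (rule model_exists)
  qed
qed

end
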